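(* Let $\Delta(d,n)$ denote the maximum possible diameter of a $d$-dimensional polyhedron with $n$ facets. For integers $d,n$ the following hold. (a) $\Delta(d,n)\le (n-d)^{\log_2(d/2)} = (n-d)^{-1+\log_2 d}$ for all $n\ge d\ge 7$. (b) $\Delta(d,n)\le (n-d)^{\log_2(d/4)} = (n-d)^{-2+\log_2 d}$ for all $n\ge d\ge 37$. (c) $\Delta(d,n)\le (n-d)^{\log_2(16+d/8)} = (n-d)^{-3+\log_2 d+O(1/d)}$ for all $n\ge d\ge 1$.
   Context: A polyhedron $P\subseteq\mathbb{R}^m$ is an intersection of finitely many closed halfspaces (it need not be bounded); $\dim(P)$ is the dimension of its affine hull. An inequality $a^\top x\le\beta$ is valid for $P$ if every $x\in P$ satisfies it; a face of $P$ is a set $P\cap\{x: a^\top x=\beta\}$ for a valid inequality $a^\top x\le \beta$. Vertices, edges and facets are the faces of dimension $0$, $1$ and $\dim(P)-1$, respectively. The diameter $\delta(P)$ is the smallest (nonnegative) integer $k$ such that every pair of vertices of $P$ can be connected by a path using at most $k$ edges of $P$. $\Delta(d,n)$ is the maximum of $\delta(P)$ over all $d$-dimensional polyhedra $P$ with $n$ facets; thus an inequality $\Delta(d,n)\le B$ means $\delta(P)\le B$ for every such $P$. In (c), the equality means $\log_2(16+d/8)=-3+\log_2 d+O(1/d)$. *)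

theory Defs
  imports "HOL-Analysis.Analysis" "HOL-Library.Landau_Symbols"
begin

text \<open>For convex \<open>P\<close>, the exposed faces are exactly the sets \<open>P \<inter> {x. a \<bullet> x = b}\<close> for an inequality
  \<open>a \<bullet> x \<le> b\<close> that is valid for \<open>P\<close>; \<open>a = 0\<close> is allowed, so \<open>P\<close> and the empty set are faces.\<close>

definition dim_faces :: "int \<Rightarrow> 'a::euclidean_space set \<Rightarrow> 'a set set" where
  "dim_faces k P = {F. F exposed_face_of P \<and> aff_dim F = k}"

definition vertices :: "'a::euclidean_space set \<Rightarrow> 'a set" where
  "vertices P = {v. {v} \<in> dim_faces 0 P}"

definition edges :: "'a::euclidean_space set \<Rightarrow> 'a set set" where
  "edges P = dim_faces 1 P"

definition facets :: "'a::euclidean_space set \<Rightarrow> 'a set set" where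
  "facets P = dim_faces (aff_dim P - 1) P"

definition adjacent :: "'a::euclidean_space set \<Rightarrow> 'a \<Rightarrow> 'a \<Rightarrow> bool" where
  "adjacent P u v \<longleftrightarrow>
     u \<in> vertices P \<and> v \<in> vertices P \<and> u \<noteq> v \<and> (\<exists>E\<in>edges P. u \<in> E \<and> v \<in> E)"

text \<open>The value would be \<open>\<infinity>\<close> if no such \<open>k\<close> existed, so a finite upper bound on the diameter
  also asserts that the graph of \<open>P\<close> is connected. A polyhedron without vertices has diameter 0.\<close>

definition graph_diameter :: "'a::euclidean_space set \<Rightarrow> enat" where
  "graph_diameter P =
     Inf {enat k |k. \<forall>u\<in>vertices P. \<forall>v\<in>vertices P. \<exists>j\<le>k. (adjacent P ^^ j) u v}"

definition polyhedra :: "nat \<Rightarrow> nat \<Rightarrow> 'a::euclidean_space set set" where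
  "polyhedra d n = {P. polyhedron P \<and> aff_dim P = int d \<and> card (facets P) = n}"

lemma exposed_face_of_iff_valid_inequality:
  fixes P :: "'a::euclidean_space set"
  assumes "convex P"
  shows "F exposed_face_of P \<longleftrightarrow> (\<exists>a b. (\<forall>x\<in>P. a \<bullet> x \<le> b) \<and> F = P \<inter> {x. a \<bullet> x = b})"
  using assms face_of_Int_supporting_hyperplane_le[of P]
  unfolding exposed_face_of_def by blast

lemma vertices_eq_extreme_points:
  "polyhedron P \<Longrightarrow> vertices P = {v. v extreme_point_of P}"
  by (auto simp: vertices_def dim_faces_def exposed_face_of_polyhedron face_of_singleton)

lemma edges_eq_edge_of: "polyhedron P \<Longrightarrow> edges P = {E. E edge_of P}"
  by (auto simp: edges_def dim_faces_def exposed_face_of_polyhedron edge_of_def)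

lemma facets_eq_facet_of:
  assumes "polyhedron P" "aff_dim P \<ge> 1"
  shows "facets P = {F. F facet_of P}"
  using assms by (auto simp: facets_def dim_faces_def exposed_face_of_polyhedron facet_of_def)

lemma finite_facets:
  assumes "polyhedron P" "aff_dim P \<ge> 1"
  shows "finite (facets P)"
  using assms by (simp add: facets_eq_facet_of finite_polyhedron_facets)

end

theory Submission
  imports Defs
begin

text \<open>The proof rests on two inequalities for the largest diameter \<open>D d m\<close> of a polyhedron of dimension \<open>d\<close> with at most
  \<open>d + m\<close> facets. The first is the recursion of Kalai and Kleitman: drop all facets that are not met by the ball of
  radius \<open>k + 1\<close> around a vertex. If the relaxed polyhedron has diameter at most \<open>k\<close>, then the ball was everything; so two
  balls whose radii exceed the diameters possible with half of the facets meet a common facet, and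
  \<open>D d m \<le> D (d - 1) m + 2 * D d ((m - d) / 2) + 2\<close>. Connectedness of the graph comes out of the same induction. The second
  is the bound \<open>D d m \<le> 2 ^ (d - 2) * m\<close> of Larman and Barnette: greedily chosen facets that cover the distance layers
  from a vertex see every facet at most twice.

  A bound \<open>m powr log 2 (h d)\<close> passes from \<open>d - 1\<close> to \<open>d\<close> through the recursion if \<open>h\<close> grows fast enough: a slope
  \<open>1 / 2\<close> suffices from dimension 9 on, \<open>1 / 4\<close> from 38 on, and slopes that decrease to \<open>1 / 8\<close> from 37 on keep \<open>h d\<close>
  below \<open>16 + d / 8\<close> from 129 on. The induction starts at \<open>7 / 2\<close>, \<open>8 / 2\<close> and \<open>37 / 4\<close> in dimensions 7, 8 and 37. There
  powers of \<open>m\<close> are too crude for the recursion; instead piecewise linear functions are carried through all smaller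
  dimensions, together with the linear bound for large \<open>m\<close>.\<close>

section \<open>Relaxing a polyhedron to some of its facets\<close>

text \<open>Since \<open>m powr log 2 h = h powr log 2 m\<close>, halving \<open>m\<close> divides
  the bound by \<open>h\<close>, while lowering the base to \<open>h - \<delta>\<close> multiplies
  it by \<open>(1 - \<delta> / h) powr log 2 m\<close>, about
  \<open>1 - \<delta> * log 2 m / h\<close>. So a slope \<delta> survives the recursion roughly when
  \<open>\<delta> * log 2 m\<close> exceeds \<open>2 * (1 - d / m) powr log 2 h\<close>. Arguments
  \<open>m < d\<close> reduce to the previous dimension; hence the admissible slopes fall as
  \<open>log 2 d\<close> grows, and for \<open>m\<close> close to \<open>d\<close>, where the
  logarithm is smallest, the subtraction of \<open>d\<close> before halving makes up for it.

  The geometric induction runs in one fixed Euclidean space: dimension always means that of the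
  affine hull, so a facet or a relaxed polyhedron has the same type as the polyhedron it comes
  from.\<close>

definition facet_ineq :: "'a::euclidean_space set \<Rightarrow> 'a set \<Rightarrow> 'a \<times> real" where
  "facet_ineq P G = (SOME (a, b). a \<noteq> 0 \<and> P \<subseteq> {x. a \<bullet> x \<le> b} \<and> G = P \<inter> {x. a \<bullet> x = b})"

definition facet_halfspace :: "'a::euclidean_space set \<Rightarrow> 'a set \<Rightarrow> 'a set" where
  "facet_halfspace P G = {x. fst (facet_ineq P G) \<bullet> x \<le> snd (facet_ineq P G)}"

text \<open>Halfspaces alone would raise the dimension of a polyhedron that is not full-dimensional,
  such as a facet; the affine hull keeps it fixed.\<close>

definition relax :: "'a::euclidean_space set \<Rightarrow> 'a set set \<Rightarrow> 'a set" where
  "relax P \<G> = affine hull P \<inter> (\<Inter>G\<in>\<G>. facet_halfspace P G)"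

lemma facet_ineq:
  assumes "polyhedron P" "G facet_of P"
  shows "fst (facet_ineq P G) \<noteq> 0" "\<And>x. x \<in> P \<Longrightarrow> fst (facet_ineq P G) \<bullet> x \<le> snd (facet_ineq P G)"
    "G = P \<inter> {x. fst (facet_ineq P G) \<bullet> x = snd (facet_ineq P G)}"
proof -
  obtain a b where ab: "a \<noteq> 0" "P \<subseteq> {x. a \<bullet> x \<le> b}" "G = P \<inter> {x. a \<bullet> x = b}"
    by (rule facet_of_polyhedron[OF assms]) auto
  then have "\<exists>p. case p of (a, b) \<Rightarrow> a \<noteq> 0 \<and> P \<subseteq> {x. a \<bullet> x \<le> b} \<and> G = P \<inter> {x. a \<bullet> x = b}"
    by (intro exI[of _ "(a, b)"]) simp
  then have "case facet_ineq P G of (a, b) \<Rightarrow>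
      a \<noteq> 0 \<and> P \<subseteq> {x. a \<bullet> x \<le> b} \<and> G = P \<inter> {x. a \<bullet> x = b}"
    unfolding facet_ineq_def by (rule someI_ex)
  then show "fst (facet_ineq P G) \<noteq> 0" "\<And>x. x \<in> P \<Longrightarrow> fst (facet_ineq P G) \<bullet> x \<le> snd (facet_ineq P G)"
    "G = P \<inter> {x. fst (facet_ineq P G) \<bullet> x = snd (facet_ineq P G)}"
    unfolding case_prod_beta by (blast, blast, metis)
qed

lemma facet_halfspace_cases:
  assumes "polyhedron P" "G facet_of P"
  obtains a b where "a \<noteq> 0" "facet_halfspace P G = {x. a \<bullet> x \<le> b}"
    "P \<subseteq> {x. a \<bullet> x \<le> b}" "G = P \<inter> {x. a \<bullet> x = b}"
  using that[of "fst (facet_ineq P G)" "snd (facet_ineq P G)"] facet_ineq[OF assms]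
  unfolding facet_halfspace_def by blast

lemma subset_facet_halfspace:
  assumes "polyhedron P" "G facet_of P"
  shows "P \<subseteq> facet_halfspace P G"
  by (rule facet_halfspace_cases[OF assms]) simp

lemma subset_relax:
  assumes "polyhedron P" "\<And>G. G \<in> \<G> \<Longrightarrow> G facet_of P"
  shows "P \<subseteq> relax P \<G>"
proof
  fix x assume "x \<in> P"
  have "x \<in> facet_halfspace P G" if "G \<in> \<G>" for G
    using subset_facet_halfspace[OF assms(1) assms(2)[OF that]] \<open>x \<in> P\<close> by (rule subsetD)
  then show "x \<in> relax P \<G>"
    using \<open>x \<in> P\<close> hull_subset[of P affine] by (auto simp: relax_def)
qed

lemma polyhedron_relax:
  assumes "polyhedron P" "finite \<G>" "\<And>G. G \<in> \<G> \<Longrightarrow> G facet_of P"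
  shows "polyhedron (relax P \<G>)"
proof -
  have "polyhedron (facet_halfspace P G)" for G
    unfolding facet_halfspace_def by (rule polyhedron_halfspace_le)
  then show ?thesis
    unfolding relax_def using assms(2) by (intro polyhedron_Int polyhedron_affine_hull polyhedron_Inter) auto
qed

lemma affine_hull_relax:
  assumes "polyhedron P" "\<And>G. G \<in> \<G> \<Longrightarrow> G facet_of P"
  shows "affine hull (relax P \<G>) = affine hull P"
proof
  show "affine hull (relax P \<G>) \<subseteq> affine hull P"
    by (rule hull_minimal) (auto simp: relax_def)
  show "affine hull P \<subseteq> affine hull (relax P \<G>)"
    by (rule hull_mono) (rule subset_relax[OF assms])
qed

lemma aff_dim_relax:
  assumes "polyhedron P" "\<And>G. G \<in> \<G> \<Longrightarrow> G facet_of P"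
  shows "aff_dim (relax P \<G>) = aff_dim P"
proof -
  have "aff_dim (affine hull relax P \<G>) = aff_dim (affine hull P)"
    by (simp only: affine_hull_relax[OF assms])
  then show ?thesis by (simp only: aff_dim_affine_hull)
qed

lemma exists_minimal_subset:
  assumes "finite F" "Q F"
  obtains F' where "F' \<subseteq> F" "Q F'" "\<And>F''. F'' \<subset> F' \<Longrightarrow> \<not> Q F''"
proof -
  obtain B where B: "B \<subseteq> F \<and> Q B" "\<forall>C. C \<subseteq> F \<and> Q C \<longrightarrow> card B \<le> card C"
    using ex_has_least_nat[of "\<lambda>B. B \<subseteq> F \<and> Q B" F card] assms(2) by blast
  have "\<not> Q C" if "C \<subset> B" for C
  proof
    assume "Q C"
    moreover have "C \<subseteq> F" using that B(1) by blast
    ultimately have "card B \<le> card C" using B(2) by blast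
    moreover have "finite B" using B(1) assms(1) finite_subset by blast
    ultimately show False using psubset_card_mono[OF _ that] by simp
  qed
  then show ?thesis using that[of B] B(1) by simp
qed

text \<open>For an inclusion-minimal family of halfspaces the facets correspond to the halfspaces,
  so such a subfamily of the given one is chosen.\<close>

lemma card_facets_relax:
  assumes "polyhedron P" "finite \<G>" and fac: "\<And>G. G \<in> \<G> \<Longrightarrow> G facet_of P"
  shows "card {K. K facet_of relax P \<G>} \<le> card \<G>"
proof -
  let ?Q = "relax P \<G>"
  let ?R = "\<lambda>F. ?Q = affine hull ?Q \<inter> \<Inter>F"
  have "?R (facet_halfspace P ` \<G>)"
    by (subst affine_hull_relax[OF assms(1) fac]) (simp_all add: relax_def)
  then obtain F where F: "F \<subseteq> facet_halfspace P ` \<G>" "?R F" "\<And>F'. F' \<subset> F \<Longrightarrow> \<not> ?R F'"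
    using exists_minimal_subset[of "facet_halfspace P ` \<G>" ?R] assms(2) by blast
  have "finite F" using F(1) assms(2) finite_subset by blast
  have "\<exists>a b. a \<noteq> 0 \<and> h = {x. a \<bullet> x \<le> b}" if "h \<in> F" for h
  proof -
    obtain G where "G \<in> \<G>" "h = facet_halfspace P G" using F(1) \<open>h \<in> F\<close> by auto
    obtain a b where "a \<noteq> 0" "facet_halfspace P G = {x. a \<bullet> x \<le> b}"
      by (rule facet_halfspace_cases[OF assms(1) fac[OF \<open>G \<in> \<G>\<close>]])
    then show ?thesis using \<open>h = facet_halfspace P G\<close> by auto
  qed
  then obtain a b where ab: "\<And>h. h \<in> F \<Longrightarrow> a h \<noteq> 0 \<and> h = {x. a h \<bullet> x \<le> b h}" by metis
  have min: "?Q \<subset> affine hull ?Q \<inter> \<Inter>F'" if "F' \<subset> F" for F'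
  proof -
    have "?Q \<subseteq> affine hull ?Q \<inter> \<Inter>F'" using that F(2) hull_subset[of ?Q affine] by auto
    then show ?thesis using F(3)[OF that] by blast
  qed
  have eq: "{K. K facet_of ?Q} = (\<lambda>h. ?Q \<inter> {x. a h \<bullet> x = b h}) ` F"
    using facet_of_polyhedron_explicit[OF \<open>finite F\<close> F(2) ab min] by auto
  have "card {K. K facet_of ?Q} \<le> card F"
    unfolding eq by (rule card_image_le[OF \<open>finite F\<close>])
  also have "\<dots> \<le> card (facet_halfspace P ` \<G>)" using F(1) assms(2) by (simp add: card_mono)
  also have "\<dots> \<le> card \<G>" using assms(2) by (rule card_image_le)
  finally show ?thesis .
qed

text \<open>If the segment avoided the relative frontier, its part in \<open>P\<close> would be both
  closed and relatively open, against connectedness.\<close>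

lemma segment_meets_rel_frontier:
  fixes P :: "'a::euclidean_space set"
  assumes "closed P" "p \<in> P" "x \<in> affine hull P" "x \<notin> P"
  obtains z where "z \<in> closed_segment p x" "z \<in> rel_frontier P"
proof (rule ccontr)
  assume no: "\<not> thesis"
  let ?S = "closed_segment p x"
  have "p \<in> affine hull P" using assms(2) hull_subset[of P affine] by blast
  then have S: "?S \<subseteq> affine hull P"
    using assms(3) by (meson affine_affine_hull affine_imp_convex closed_segment_subset)
  have eq: "?S \<inter> P = ?S \<inter> rel_interior P"
    using no that assms(1) rel_interior_subset[of P]
    by (auto simp: rel_frontier_def)
  obtain T where T: "open T" "rel_interior P = T \<inter> affine hull P"
    using openin_rel_interior[of P] by (auto simp: openin_open)
  have "openin (top_of_set ?S) (?S \<inter> P)"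
    unfolding eq T(2) openin_open using S T(1) by blast
  moreover have "closedin (top_of_set ?S) (?S \<inter> P)"
    using assms(1) by (simp add: closedin_closed_Int)
  ultimately have "?S \<inter> P = {} \<or> ?S \<inter> P = ?S"
    using connected_segment(1)[of p x] by (simp add: connected_clopen)
  then show False using assms(2,4) by auto
qed

text \<open>A segment from a relative interior point to a point outside \<open>P\<close> crosses
  some facet. The inequality of that facet is strict at the inner end and weak at the outer end,
  hence strict at the crossing point, which is absurd.\<close>

lemma relax_all_facets:
  assumes "polyhedron P" "P \<noteq> {}"
  shows "relax P {G. G facet_of P} = P"
proof
  show "P \<subseteq> relax P {G. G facet_of P}" by (rule subset_relax) (use assms in auto)
  show "relax P {G. G facet_of P} \<subseteq> P"
  proof
    fix x assume x: "x \<in> relax P {G. G facet_of P}"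
    show "x \<in> P"
    proof (rule ccontr)
      assume "x \<notin> P"
      obtain p where p: "p \<in> rel_interior P"
        using assms polyhedron_imp_convex rel_interior_eq_empty by blast
      then have "p \<in> P" using rel_interior_subset by blast
      have "x \<in> affine hull P" using x by (simp add: relax_def)
      then obtain z where z: "z \<in> closed_segment p x" "z \<in> rel_frontier P"
        using segment_meets_rel_frontier[OF polyhedron_imp_closed[OF assms(1)] \<open>p \<in> P\<close> _ \<open>x \<notin> P\<close>]
        by blast
      then obtain G where G: "G facet_of P" "z \<in> G"
        using rel_frontier_of_polyhedron[OF assms(1)] by auto
      obtain a b where ab: "a \<noteq> 0" "facet_halfspace P G = {x. a \<bullet> x \<le> b}"
        "P \<subseteq> {x. a \<bullet> x \<le> b}" "G = P \<inter> {x. a \<bullet> x = b}"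
        by (rule facet_halfspace_cases[OF assms(1) G(1)])
      have "p \<notin> G" using p rel_interior_of_polyhedron[OF assms(1)] G(1) by auto
      then have pb: "a \<bullet> p < b" using ab(3,4) \<open>p \<in> P\<close> by force
      have "a \<bullet> x \<le> b" using x G(1) ab(2) by (auto simp: relax_def)
      obtain t where t: "0 \<le> t" "t \<le> 1" "z = (1 - t) *\<^sub>R p + t *\<^sub>R x"
        using z(1) by (auto simp: in_segment)
      have "t \<noteq> 1" using t G ab(4) \<open>x \<notin> P\<close> by auto
      then have "(1 - t) * (a \<bullet> p) + t * (a \<bullet> x) < (1 - t) * b + t * b"
        using t pb \<open>a \<bullet> x \<le> b\<close> by (intro add_less_le_mono mult_left_mono mult_strict_left_mono) auto
      then show False using G(2) ab(4) t(3) by (simp add: inner_simps algebra_simps)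
    qed
  qed
qed

text \<open>The dropped facets miss \<open>w\<close>, so their finitely many inequalities are strict
  there and stay valid in a small ball.\<close>

lemma relax_local:
  assumes "polyhedron P" "w \<in> P" and sub: "\<And>G. G facet_of P \<Longrightarrow> w \<in> G \<Longrightarrow> G \<in> \<G>"
    and fac: "\<And>G. G \<in> \<G> \<Longrightarrow> G facet_of P"
  obtains e where "e > 0" "relax P \<G> \<inter> ball w e \<subseteq> P"
proof -
  let ?H = "{G. G facet_of P} - \<G>"
  have fin: "finite ?H" using finite_polyhedron_facets[OF assms(1)] by simp
  have "w \<in> interior (facet_halfspace P G)" if "G \<in> ?H" for G
  proof -
    have G: "G facet_of P" "w \<notin> G" using that sub by auto
    obtain a b where ab: "a \<noteq> 0" "facet_halfspace P G = {x. a \<bullet> x \<le> b}"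
        "P \<subseteq> {x. a \<bullet> x \<le> b}" "G = P \<inter> {x. a \<bullet> x = b}"
      by (rule facet_halfspace_cases[OF assms(1) G(1)])
    have "a \<bullet> w < b" using ab(3,4) G(2) assms(2) by force
    then show ?thesis using ab(1,2) by simp
  qed
  then have "w \<in> (\<Inter>G\<in>?H. interior (facet_halfspace P G))" by blast
  moreover have "open (\<Inter>G\<in>?H. interior (facet_halfspace P G))" using fin by blast
  ultimately obtain e where e: "e > 0" "ball w e \<subseteq> (\<Inter>G\<in>?H. interior (facet_halfspace P G))"
    by (meson open_contains_ball)
  have "relax P \<G> \<inter> ball w e \<subseteq> relax P {G. G facet_of P}"
  proof
    fix x assume x: "x \<in> relax P \<G> \<inter> ball w e"
    have "x \<in> facet_halfspace P G" if "G facet_of P" for G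
    proof (cases "G \<in> \<G>")
      case True then show ?thesis using x by (auto simp: relax_def)
    next
      case False
      then have "x \<in> interior (facet_halfspace P G)" using e(2) x that by blast
      then show ?thesis using interior_subset by blast
    qed
    then show "x \<in> relax P {G. G facet_of P}" using x by (auto simp: relax_def)
  qed
  moreover have "P \<noteq> {}" using assms(2) by auto
  ultimately show ?thesis using that e(1) relax_all_facets[OF assms(1)] by auto
qed

text \<open>The form in which locality is used: every direction from \<open>w\<close> into the
  relaxation is feasible in \<open>P\<close> for a short while.\<close>

lemma relax_segment:
  assumes "polyhedron P" "w \<in> P" and sub: "\<And>G. G facet_of P \<Longrightarrow> w \<in> G \<Longrightarrow> G \<in> \<G>"
    and fac: "\<And>G. G \<in> \<G> \<Longrightarrow> G facet_of P" and x: "x \<in> relax P \<G>"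
  obtains t0 where "t0 > 0" "t0 \<le> 1" "\<And>t. 0 \<le> t \<Longrightarrow> t \<le> t0 \<Longrightarrow> w + t *\<^sub>R (x - w) \<in> P"
proof -
  obtain e where e: "e > 0" "relax P \<G> \<inter> ball w e \<subseteq> P"
    using relax_local[OF assms(1,2) sub fac] by blast
  \<comment> \<open>The \<open>+ 1\<close> covers \<open>x = w\<close>, where the norm
    vanishes.\<close>
  define t0 where "t0 = min 1 (e / (2 * (norm (x - w) + 1)))"
  have n: "norm (x - w) + 1 > 0" by (simp add: add_nonneg_pos)
  have conv: "convex (relax P \<G>)"
    unfolding relax_def facet_halfspace_def
    by (intro convex_Int convex_affine_hull convex_INT convex_halfspace_le affine_imp_convex affine_affine_hull)
  have wr: "w \<in> relax P \<G>" using subset_relax[OF assms(1) fac] \<open>w \<in> P\<close> by blast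
  have "w + t *\<^sub>R (x - w) \<in> P" if t: "0 \<le> t" "t \<le> t0" for t
  proof -
    have "t * norm (x - w) \<le> t * (norm (x - w) + 1)" using t by (intro mult_left_mono) auto
    also have "\<dots> \<le> e / (2 * (norm (x - w) + 1)) * (norm (x - w) + 1)"
      using t n by (intro mult_right_mono) (auto simp: t0_def)
    also have "\<dots> = e / 2" using n by (simp add: divide_simps)
    also have "\<dots> < e" using e(1) by simp
    finally have "t * norm (x - w) < e" .
    then have "w + t *\<^sub>R (x - w) \<in> ball w e"
      using t(1) by (simp add: dist_norm)
    moreover have "(1 - t) *\<^sub>R w + t *\<^sub>R x \<in> relax P \<G>"
      using convexD_alt[OF conv wr x] t by (auto simp: t0_def)
    moreover have "(1 - t) *\<^sub>R w + t *\<^sub>R x = w + t *\<^sub>R (x - w)" by (simp add: algebra_simps)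
    ultimately show ?thesis using e(2) by auto
  qed
  then show ?thesis using that[of t0] e(1) n by (auto simp: t0_def)
qed

lemma extreme_point_of_subset:
  "x extreme_point_of Q \<Longrightarrow> P \<subseteq> Q \<Longrightarrow> x \<in> P \<Longrightarrow> x extreme_point_of P"
  by (auto simp: extreme_point_of_def)

text \<open>A segment of the relaxation with \<open>w\<close> inside can be shrunk towards
  \<open>w\<close> until both ends lie in \<open>P\<close>.\<close>

lemma extreme_point_of_relax:
  assumes "polyhedron P" and w: "w extreme_point_of P"
    and sub: "\<And>G. G facet_of P \<Longrightarrow> w \<in> G \<Longrightarrow> G \<in> \<G>"
    and fac: "\<And>G. G \<in> \<G> \<Longrightarrow> G facet_of P"
  shows "w extreme_point_of (relax P \<G>)"
proof -
  have "w \<in> P" using w by (simp add: extreme_point_of_def)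
  have False if ab: "a \<in> relax P \<G>" "b \<in> relax P \<G>" "w \<in> open_segment a b" for a b
  proof -
    obtain ta where ta: "ta > 0" "\<And>t. 0 \<le> t \<Longrightarrow> t \<le> ta \<Longrightarrow> w + t *\<^sub>R (a - w) \<in> P"
      using relax_segment[OF assms(1) \<open>w \<in> P\<close> sub fac ab(1)] by blast
    obtain tb where tb: "tb > 0" "\<And>t. 0 \<le> t \<Longrightarrow> t \<le> tb \<Longrightarrow> w + t *\<^sub>R (b - w) \<in> P"
      using relax_segment[OF assms(1) \<open>w \<in> P\<close> sub fac ab(2)] by blast
    define t where "t = min ta tb"
    let ?a = "w + t *\<^sub>R (a - w)" and ?b = "w + t *\<^sub>R (b - w)"
    have t: "t > 0" "?a \<in> P" "?b \<in> P" using ta tb by (auto simp: t_def)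
    obtain u where u: "0 < u" "u < 1" "w = (1 - u) *\<^sub>R a + u *\<^sub>R b" "a \<noteq> b"
      using ab(3) by (auto simp: in_segment)
    have "(1 - u) *\<^sub>R ?a + u *\<^sub>R ?b = w + t *\<^sub>R ((1 - u) *\<^sub>R a + u *\<^sub>R b - w)"
      by (simp add: algebra_simps)
    also have "\<dots> = w" using u(3) by simp
    finally have "w = (1 - u) *\<^sub>R ?a + u *\<^sub>R ?b" by simp
    moreover have "?a \<noteq> ?b" using t(1) u(4) by simp
    ultimately have "w \<in> open_segment ?a ?b" using u(1,2) unfolding in_segment by blast
    then show False using w t by (auto simp: extreme_point_of_def)
  qed
  then show ?thesis using \<open>w \<in> P\<close> subset_relax[OF assms(1) fac] by (auto simp: extreme_point_of_def)
qed

text \<open>Cutting an edge at \<open>P\<close> leaves a face of \<open>P\<close>; it does not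
  collapse to the point \<open>w\<close>, because the edge starts at \<open>w\<close> with a piece
  inside \<open>P\<close>.\<close>

lemma edge_of_relax_Int:
  assumes P: "polyhedron P" and w: "w extreme_point_of P"
    and sub: "\<And>G. G facet_of P \<Longrightarrow> w \<in> G \<Longrightarrow> G \<in> \<G>"
    and fac: "\<And>G. G \<in> \<G> \<Longrightarrow> G facet_of P"
    and E: "E edge_of relax P \<G>" "w \<in> E"
  shows "(E \<inter> P) edge_of P"
proof -
  have wP: "w \<in> P" using w by (simp add: extreme_point_of_def)
  have Ef: "E face_of relax P \<G>" "aff_dim E = 1" using E(1) by (auto simp: edge_of_def)
  have "(E \<inter> P) face_of (relax P \<G> \<inter> P)"
    by (rule face_of_slice[OF Ef(1) polyhedron_imp_convex[OF P]])
  moreover have "relax P \<G> \<inter> P = P" using subset_relax[OF P fac] by blast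
  ultimately have 1: "(E \<inter> P) face_of P" by simp
  have "E \<noteq> {w}" using Ef(2) by auto
  then obtain x where x: "x \<in> E" "x \<noteq> w" using E(2) by blast
  have "x \<in> relax P \<G>" using x(1) face_of_imp_subset[OF Ef(1)] by blast
  then obtain t where t: "t > 0" "t \<le> 1" "\<And>s. 0 \<le> s \<Longrightarrow> s \<le> t \<Longrightarrow> w + s *\<^sub>R (x - w) \<in> P"
    using relax_segment[OF P wP sub fac] by blast
  let ?y = "w + t *\<^sub>R (x - w)"
  have "(1 - t) *\<^sub>R w + t *\<^sub>R x \<in> E"
    using convexD_alt[OF face_of_imp_convex[OF Ef(1)] E(2) x(1)] t by auto
  then have "?y \<in> E \<inter> P" using t by (simp add: algebra_simps)
  then have "{w, ?y} \<subseteq> E \<inter> P" using E(2) wP by simp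
  then have "aff_dim {w, ?y} \<le> aff_dim (E \<inter> P)" by (rule aff_dim_subset)
  moreover have "aff_dim {w, ?y} = 1" using x t by (simp add: aff_dim_2)
  moreover have "aff_dim (E \<inter> P) \<le> aff_dim E" by (rule aff_dim_subset) simp
  ultimately have "aff_dim (E \<inter> P) = 1" using Ef(2) by simp
  then show ?thesis using 1 by (simp add: edge_of_def)
qed

lemma edge_rel_frontier:
  assumes "polyhedron Q" "E edge_of Q" "z \<in> rel_frontier E"
  shows "z extreme_point_of E" "z extreme_point_of Q"
proof -
  have E: "E face_of Q" "aff_dim E = 1" using assms(2) by (auto simp: edge_of_def)
  obtain F where F: "F facet_of E" "z \<in> F"
    using assms(3) rel_frontier_of_polyhedron[OF face_of_polyhedron_polyhedron[OF assms(1) E(1)]] by auto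
  have "aff_dim F = 0" using F(1) E(2) by (simp add: facet_of_def)
  then obtain z' where "F = {z'}" using aff_dim_eq_0 by blast
  then have "{z} face_of E" using F by (simp add: facet_of_def)
  then show "z extreme_point_of E" "z extreme_point_of Q"
    using face_of_trans[OF _ E(1)] by (simp_all only: face_of_singleton[symmetric])
qed

text \<open>The exit point \<open>z\<close> is an end of the edge \<open>E \<inter> P\<close> of
  \<open>P\<close>. If all facets at \<open>z\<close> had been kept, the edge could be continued
  inside \<open>P\<close> beyond \<open>z\<close>.\<close>

lemma edge_of_relax_exit:
  assumes P: "polyhedron P" and w: "w extreme_point_of P" and fin: "finite \<G>"
    and sub: "\<And>G. G facet_of P \<Longrightarrow> w \<in> G \<Longrightarrow> G \<in> \<G>"
    and fac: "\<And>G. G \<in> \<G> \<Longrightarrow> G facet_of P"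
    and E: "E edge_of relax P \<G>" "w \<in> E" and e: "e \<in> E" "e \<notin> P"
  obtains z G where "z extreme_point_of P" "z \<noteq> w" "z \<in> E" "G facet_of P" "z \<in> G" "G \<notin> \<G>"
proof -
  let ?K = "E \<inter> P"
  have wP: "w \<in> P" using w by (simp add: extreme_point_of_def)
  have Ef: "E face_of relax P \<G>" "aff_dim E = 1" using E(1) by (auto simp: edge_of_def)
  have Esub: "E \<subseteq> relax P \<G>" using face_of_imp_subset[OF Ef(1)] .
  have Econv: "convex E" using face_of_imp_convex[OF Ef(1)] .
  have Ke: "?K edge_of P" by (rule edge_of_relax_Int[OF P w sub fac E])
  then have K: "?K face_of P" "aff_dim ?K = 1" by (auto simp: edge_of_def)
  have Kpoly: "polyhedron ?K" using face_of_polyhedron_polyhedron[OF P K(1)] .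
  have "?K \<noteq> {}" using E(2) wP by blast
  then obtain p where p: "p \<in> rel_interior ?K"
    using rel_interior_eq_empty[OF polyhedron_imp_convex[OF Kpoly]] by blast
  have pK: "p \<in> ?K" using p rel_interior_subset by blast
  have "affine hull ?K \<subseteq> affine hull E" by (rule hull_mono) simp
  moreover have "\<not> affine hull ?K \<subset> affine hull E"
    using aff_dim_psubset[of ?K E] K(2) Ef(2) by auto
  ultimately have "affine hull ?K = affine hull E" by blast
  then have "e \<in> affine hull ?K" using e(1) hull_subset[of E affine] by auto
  then obtain z where z: "z \<in> closed_segment p e" "z \<in> rel_frontier ?K"
    using segment_meets_rel_frontier[OF polyhedron_imp_closed[OF Kpoly] pK] e(2) by blast
  note zK = edge_rel_frontier(1)[OF P Ke z(2)] and zP = edge_rel_frontier(2)[OF P Ke z(2)]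
  have zin: "z \<in> E" "z \<in> P" using zK by (auto simp: extreme_point_of_def)
  have zp: "z \<noteq> p" using z(2) p by (auto simp: rel_frontier_def)
  have ze: "z \<noteq> e" using zin e(2) by blast
  have zopen: "z \<in> open_segment p e" using z(1) zp ze by (simp add: open_segment_def)
  \<comment> \<open>\<open>w\<close> is extreme in the relaxation, whereas \<open>z\<close> lies
    strictly between two points of it.\<close>
  have "z \<noteq> w"
  proof
    assume "z = w"
    moreover have "w extreme_point_of relax P \<G>"
      using extreme_point_of_relax[OF P w sub fac] .
    moreover have "p \<in> relax P \<G>" "e \<in> relax P \<G>" using Esub pK e(1) by auto
    ultimately show False using zopen by (auto simp: extreme_point_of_def)
  qed
  moreover have "\<exists>G. G facet_of P \<and> z \<in> G \<and> G \<notin> \<G>"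
  proof (rule ccontr)
    assume "\<not> ?thesis"
    then have subz: "\<And>G. G facet_of P \<Longrightarrow> z \<in> G \<Longrightarrow> G \<in> \<G>" by blast
    have "e \<in> relax P \<G>" using Esub e(1) by blast
    then obtain t where t: "t > 0" "t \<le> 1" "\<And>s. 0 \<le> s \<Longrightarrow> s \<le> t \<Longrightarrow> z + s *\<^sub>R (e - z) \<in> P"
      using relax_segment[OF P zin(2) subz fac] by blast
    let ?y = "z + t *\<^sub>R (e - z)"
    have "(1 - t) *\<^sub>R z + t *\<^sub>R e \<in> E"
      using convexD_alt[OF Econv zin(1) e(1)] t by auto
    then have y: "?y \<in> ?K" using t by (simp add: algebra_simps)
    obtain s where s: "0 < s" "s < 1" "z = (1 - s) *\<^sub>R p + s *\<^sub>R e" "p \<noteq> e"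
      using zopen by (auto simp: in_segment)
    \<comment> \<open>On the line from \<open>p\<close> to \<open>e\<close>, the point
      \<open>z\<close> has parameter \<open>s\<close> and \<open>?y\<close> has the larger parameter
      \<open>q\<close>. So \<open>z\<close> lies strictly between two points of
      \<open>E \<inter> P\<close>, of which it is an extreme point.\<close>
    define q where "q = s + t * (1 - s)"
    have q: "q > s" "q > 0" using s t by (auto simp: q_def intro: add_pos_pos)
    have zd: "z = p + s *\<^sub>R (e - p)" using s(3) by (simp add: algebra_simps)
    have yd: "?y = p + q *\<^sub>R (e - p)"
      unfolding q_def by (subst (1 2) zd) (simp add: algebra_simps)
    have "z = (1 - s / q) *\<^sub>R p + (s / q) *\<^sub>R (p + q *\<^sub>R (e - p))"
      using q(2) by (subst zd) (simp add: scaleR_add_right scaleR_diff_left)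
    then have "z = (1 - s / q) *\<^sub>R p + (s / q) *\<^sub>R ?y" unfolding yd .
    moreover have "p \<noteq> ?y" using q(2) s(4) by (simp only: yd) simp
    moreover have "0 < s / q" "s / q < 1" using q s by auto
    ultimately have "z \<in> open_segment p ?y" unfolding in_segment by blast
    then show False using zK pK y by (auto simp: extreme_point_of_def)
  qed
  ultimately show ?thesis using that zP zin(1) by blast
qed

text \<open>By induction on the dimension: \<open>v\<close> is moved along a level set of
  \<open>a\<close>, inside the cone \<open>relax Q\<close> of the facets at \<open>u\<close>, until
  it hits the hyperplane of one of these facets (a ratio test, \<open>r\<close>). The point reached
  may lie outside \<open>Q\<close>, but pulling it back towards \<open>u\<close> gives an improving
  point in that facet.\<close>

lemma improving_edge:
  fixes Q :: "'a::euclidean_space set"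
  assumes "polyhedron Q" "u extreme_point_of Q" "v \<in> Q" "a \<bullet> v > a \<bullet> u"
  shows "\<exists>E. E edge_of Q \<and> u \<in> E \<and> (\<exists>e\<in>E. a \<bullet> e > a \<bullet> u)"
  using assms
proof (induction "nat (aff_dim Q)" arbitrary: Q v rule: less_induct)
  case less
  note Q = less.prems(1) and u = less.prems(2) and v = less.prems(3,4)
  have uQ: "u \<in> Q" using u by (simp add: extreme_point_of_def)
  have "aff_dim {u, v} \<le> aff_dim Q" by (rule aff_dim_subset) (use uQ v in auto)
  moreover have "u \<noteq> v" using v by auto
  ultimately have d1: "aff_dim Q \<ge> 1" by (simp add: aff_dim_2)
  show ?case
  proof (cases "aff_dim Q = 1")
    case True
    then have "Q edge_of Q" using face_of_refl[OF polyhedron_imp_convex[OF Q]] by (simp add: edge_of_def)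
    then show ?thesis using uQ v by blast
  next
    case False
    then have d2: "aff_dim Q \<ge> 2" using d1 by simp
    let ?A = "affine hull Q"
    have vA: "v \<in> ?A" and uA: "u \<in> ?A" using v uQ hull_subset[of Q affine] by auto
    have "aff_dim (?A \<inter> {x. a \<bullet> x = a \<bullet> v}) \<ge> 1"
      using d2 vA by (subst aff_dim_affine_Int_hyperplane) (auto simp: aff_dim_affine_hull)
    then have "?A \<inter> {x. a \<bullet> x = a \<bullet> v} \<noteq> {v}" by auto
    then obtain y where y: "y \<in> ?A" "a \<bullet> y = a \<bullet> v" "y \<noteq> v" using vA by blast
    let ?\<G> = "{G. G facet_of Q \<and> u \<in> G}"
    define A where "A = (\<lambda>G. fst (facet_ineq Q G))"
    define B where "B = (\<lambda>G. snd (facet_ineq Q G))"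
    have facQ: "\<And>x. x \<in> Q \<Longrightarrow> A G \<bullet> x \<le> B G" "G = Q \<inter> {x. A G \<bullet> x = B G}" if "G facet_of Q" for G
      using facet_ineq[OF Q that] by (auto simp: A_def B_def)
    have relax_iff: "x \<in> relax Q ?\<G> \<longleftrightarrow> x \<in> ?A \<and> (\<forall>G\<in>?\<G>. A G \<bullet> x \<le> B G)" for x
      by (auto simp: relax_def facet_halfspace_def A_def B_def)
    have finG: "finite ?\<G>" using finite_polyhedron_facets[OF Q] by simp
    have uext: "u extreme_point_of relax Q ?\<G>"
      by (rule extreme_point_of_relax[OF Q u]) auto
    have Ab: "A G \<bullet> u = B G" if "G \<in> ?\<G>" for G using facQ(2)[of G] that by blast
    have aff: "p + s *\<^sub>R (y - v) \<in> ?A" if "p \<in> ?A" for p s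
      using mem_affine_3_minus[OF affine_affine_hull that y(1) vA] .
    \<comment> \<open>Otherwise the cone would contain the whole line through \<open>u\<close> in
      direction \<open>y - v\<close>, and \<open>u\<close> would not be extreme in it.\<close>
    have "\<exists>G\<in>?\<G>. A G \<bullet> (y - v) \<noteq> 0"
    proof (rule ccontr)
      assume "\<not> ?thesis"
      then have z: "A G \<bullet> (y - v) = 0" if "G \<in> ?\<G>" for G using that by blast
      have "u + s *\<^sub>R (y - v) \<in> relax Q ?\<G>" for s
        unfolding relax_iff using aff[OF uA] z Ab by (auto simp: inner_add_right)
      from this[of 1] this[of "-1"] have "u + (y - v) \<in> relax Q ?\<G>" "u + (v - y) \<in> relax Q ?\<G>"
        by simp_all
      moreover have "u \<in> open_segment (u + (y - v)) (u + (v - y))"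
      proof -
        have "u = (1 - 1/2) *\<^sub>R (u + (y - v)) + (1/2) *\<^sub>R (u + (v - y))"
          by (simp add: algebra_simps flip: scaleR_add_left)
        moreover have "u + (y - v) \<noteq> u + (v - y)"
        proof
          assume "u + (y - v) = u + (v - y)"
          then have "2 *\<^sub>R y = 2 *\<^sub>R v" by (simp add: scaleR_2 algebra_simps)
          then show False using y(3) by simp
        qed
        ultimately show ?thesis unfolding in_segment by (intro conjI exI[of _ "1/2"]) auto
      qed
      ultimately show False using uext by (auto simp: extreme_point_of_def)
    qed
    then obtain G0 where G0: "G0 \<in> ?\<G>" "A G0 \<bullet> (y - v) \<noteq> 0" by blast
    define z where "z = (if A G0 \<bullet> (y - v) > 0 then y - v else - (y - v))"
    have az: "a \<bullet> z = 0" using y(2) by (simp add: z_def inner_diff_right)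
    have G0z: "A G0 \<bullet> z > 0" using G0(2) by (auto simp: z_def inner_simps)
    have affz: "v + s *\<^sub>R z \<in> ?A" for s
      using aff[OF vA, of s] aff[OF vA, of "-s"] by (auto simp: z_def algebra_simps)
    define \<H> where "\<H> = {G \<in> ?\<G>. A G \<bullet> z > 0}"
    define r where "r = (\<lambda>G. (B G - A G \<bullet> v) / (A G \<bullet> z))"
    have "finite \<H>" by (rule finite_subset[OF _ finG]) (auto simp: \<H>_def)
    moreover have "\<H> \<noteq> {}" using G0(1) G0z by (auto simp: \<H>_def)
    ultimately obtain G1 where G1: "G1 \<in> \<H>" "\<And>G. G \<in> \<H> \<Longrightarrow> r G1 \<le> r G"
      using that[OF arg_min_if_finite(1)[of \<H> r] arg_min_least[of \<H> _ r]] by blast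
    have G1': "G1 facet_of Q" "u \<in> G1" "A G1 \<bullet> z > 0" using G1(1) by (auto simp: \<H>_def)
    let ?v = "v + r G1 *\<^sub>R z"
    have r0: "r G1 \<ge> 0" using facQ(1)[OF G1'(1) v(1)] G1'(3) by (simp add: r_def)
    have eq: "A G1 \<bullet> ?v = B G1" using G1'(3) by (simp add: r_def inner_add_right)
    have "A G \<bullet> ?v \<le> B G" if "G \<in> ?\<G>" for G
    proof (cases "A G \<bullet> z > 0")
      case True
      then have "r G1 \<le> (B G - A G \<bullet> v) / (A G \<bullet> z)" using G1(2)[of G] that by (simp add: \<H>_def r_def)
      then have "r G1 * (A G \<bullet> z) \<le> B G - A G \<bullet> v" using True by (simp add: pos_le_divide_eq)
      then show ?thesis by (simp add: inner_add_right)
    next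
      case False
      then have "r G1 * (A G \<bullet> z) \<le> 0" using r0 by (simp add: mult_nonneg_nonpos)
      then show ?thesis using facQ(1)[of G v] that v(1) by (simp add: inner_add_right)
    qed
    then have "?v \<in> relax Q ?\<G>" unfolding relax_iff using affz by blast
    then obtain t where t: "t > 0" "t \<le> 1" "\<And>s. 0 \<le> s \<Longrightarrow> s \<le> t \<Longrightarrow> u + s *\<^sub>R (?v - u) \<in> Q"
      using relax_segment[OF Q uQ, of ?\<G> ?v] by blast
    let ?x = "u + t *\<^sub>R (?v - u)"
    have "A G1 \<bullet> ?x = B G1"
      using eq Ab[of G1] G1' by (simp add: inner_add_right inner_diff_right)
    then have xG: "?x \<in> G1" using facQ(2)[OF G1'(1)] t by auto
    have "a \<bullet> (?v - u) > 0" using az v(2) by (simp add: inner_add_right inner_diff_right)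
    then have ax: "a \<bullet> ?x > a \<bullet> u" using t(1) by (simp add: inner_add_right)
    have G1f: "G1 face_of Q" "aff_dim G1 = aff_dim Q - 1" using G1'(1) by (auto simp: facet_of_def)
    have "\<exists>E. E edge_of G1 \<and> u \<in> E \<and> (\<exists>e\<in>E. a \<bullet> e > a \<bullet> u)"
    proof (rule less.hyps[OF _ _ _ xG ax])
      show "nat (aff_dim G1) < nat (aff_dim Q)" using G1f(2) d2 by simp
      show "polyhedron G1" using face_of_polyhedron_polyhedron[OF Q G1f(1)] .
      show "u extreme_point_of G1" using extreme_point_of_face[OF G1f(1)] u G1'(2) by blast
    qed
    then show ?thesis using face_of_trans[OF _ G1f(1)] by (auto simp: edge_of_def)
  qed
qed

section \<open>Paths in the graph of a polyhedron\<close>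

lemma adjacent_iff:
  assumes "polyhedron P"
  shows "adjacent P u v \<longleftrightarrow> u extreme_point_of P \<and> v extreme_point_of P \<and> u \<noteq> v \<and>
    (\<exists>E. E edge_of P \<and> u \<in> E \<and> v \<in> E)"
  unfolding adjacent_def vertices_eq_extreme_points[OF assms] edges_eq_edge_of[OF assms] by auto

lemma mem_vertices_iff: "polyhedron P \<Longrightarrow> v \<in> vertices P \<longleftrightarrow> v extreme_point_of P"
  by (simp add: vertices_eq_extreme_points)

lemma adjacent_sym: "adjacent P u v \<Longrightarrow> adjacent P v u"
  unfolding adjacent_def by blast

lemma adjacent_path_sym: "(adjacent P ^^ n) u v \<Longrightarrow> (adjacent P ^^ n) v u"
proof (induction n arbitrary: u)
  case (Suc n)
  then obtain w where "adjacent P u w" "(adjacent P ^^ n) w v" by (metis relpowp_Suc_D2)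
  then show ?case using Suc.IH adjacent_sym by (metis relpowp_Suc_I)
qed simp

lemma path_vertex:
  assumes "u \<in> vertices P" "(adjacent P ^^ n) u v" shows "v \<in> vertices P"
proof (cases n)
  case 0 then show ?thesis using assms by simp
next
  case (Suc k)
  then obtain w where "adjacent P w v" using assms(2) by (metis relpowp_Suc_E)
  then show ?thesis by (simp add: adjacent_def)
qed

lemma path_trans: "(R ^^ i) x y \<Longrightarrow> (R ^^ j) y z \<Longrightarrow> (R ^^ (i + j)) x z"
  unfolding relpowp_add by blast

definition diam_le :: "'a::euclidean_space set \<Rightarrow> nat \<Rightarrow> bool" where
  "diam_le P k \<longleftrightarrow> (\<forall>u\<in>vertices P. \<forall>v\<in>vertices P. \<exists>j\<le>k. (adjacent P ^^ j) u v)"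

text \<open>At a vertex of \<open>S\<close> all facets are kept, so each edge of the relaxation
  there starts along an edge of \<open>P\<close>. The latter ends either in the same vertex or
  earlier, on a facet outside \<open>\<G>\<close> and hence outside \<open>S\<close>.\<close>

lemma follow_path:
  assumes P: "polyhedron P" and fin: "finite \<G>"
    and S: "\<And>z. z \<in> S \<Longrightarrow> z \<in> vertices P" "\<And>z G. z \<in> S \<Longrightarrow> G facet_of P \<Longrightarrow> z \<in> G \<Longrightarrow> G \<in> \<G>"
    and fac: "\<And>G. G \<in> \<G> \<Longrightarrow> G facet_of P"
    and path: "(adjacent (relax P \<G>) ^^ j) y q" "y \<in> S"
  shows "(\<exists>z\<in>vertices P - S. \<exists>i\<le>j. (adjacent P ^^ i) y z) \<or> (q \<in> S \<and> (adjacent P ^^ j) y q)"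
  using path
proof (induction j arbitrary: q)
  case (Suc j)
  have Q: "polyhedron (relax P \<G>)" by (rule polyhedron_relax[OF P fin fac])
  obtain p where p: "(adjacent (relax P \<G>) ^^ j) y p" "adjacent (relax P \<G>) p q"
    using Suc.prems(1) by (metis relpowp_Suc_E)
  note ext = mem_vertices_iff[OF P]
  from Suc.IH[OF p(1) Suc.prems(2)] show ?case
  proof
    assume "\<exists>z\<in>vertices P - S. \<exists>i\<le>j. (adjacent P ^^ i) y z"
    then show ?thesis by (meson le_SucI)
  next
    assume pS: "p \<in> S \<and> (adjacent P ^^ j) y p"
    then have pext: "p extreme_point_of P" using S(1) ext by blast
    have subp: "\<And>G. G facet_of P \<Longrightarrow> p \<in> G \<Longrightarrow> G \<in> \<G>" using S(2) pS by blast
    obtain E where E: "E edge_of relax P \<G>" "p \<in> E" "q \<in> E" and pq: "p \<noteq> q" "q extreme_point_of relax P \<G>"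
      using p(2) adjacent_iff[OF Q, of p q] by blast
    have EP: "(E \<inter> P) edge_of P" using edge_of_relax_Int[OF P pext subp fac E(1,2)] .
    have pP: "p \<in> P" using pext by (simp add: extreme_point_of_def)
    have "\<exists>z\<in>vertices P. adjacent P p z \<and> (z = q \<or> z \<notin> S)"
    proof (cases "q \<in> P")
      case True
      then have "q extreme_point_of P"
        using extreme_point_of_subset[OF pq(2) subset_relax[OF P fac]] by blast
      then have "adjacent P p q" unfolding adjacent_iff[OF P] using pext pq(1) EP E pP True by blast
      then show ?thesis by (auto simp: adjacent_def)
    next
      case False
      obtain z G where z: "z extreme_point_of P" "z \<noteq> p" "z \<in> E" "G facet_of P" "z \<in> G" "G \<notin> \<G>"
        using edge_of_relax_exit[OF P pext fin subp fac E False] by blast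
      have "z \<in> P" using z(1) by (simp add: extreme_point_of_def)
      then have "adjacent P p z" unfolding adjacent_iff[OF P] using pext z EP E pP by blast
      moreover have "z \<notin> S" using S(2) z by blast
      ultimately show ?thesis by (auto simp: adjacent_def)
    qed
    then obtain z where z: "z \<in> vertices P" "adjacent P p z" "z = q \<or> z \<notin> S" by blast
    have "(adjacent P ^^ Suc j) y z" using pS z(2) by (metis relpowp_Suc_I)
    then show ?thesis using z by blast
  qed
qed (auto)

text \<open>An edge on which \<open>a\<close> is bounded cannot be unbounded in the improving
  direction. The factor \<open>s\<close> puts \<open>x\<close> so far out that \<open>a\<close>
  exceeds \<open>b\<close> there.\<close>

lemma bounded_edge_endpoint:
  fixes Q :: "'a::euclidean_space set"
  assumes Q: "polyhedron Q" and E: "E edge_of Q" "u \<in> E" "e \<in> E" "a \<bullet> u < a \<bullet> e"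
    and bd: "\<And>x. x \<in> E \<Longrightarrow> a \<bullet> x \<le> b"
  obtains z where "z extreme_point_of Q" "a \<bullet> z > a \<bullet> u"
proof -
  have Ef: "E face_of Q" "aff_dim E = 1" using E(1) by (auto simp: edge_of_def)
  have Epoly: "polyhedron E" using face_of_polyhedron_polyhedron[OF Q Ef(1)] .
  define s where "s = 1 + (b - a \<bullet> u + 1) / (a \<bullet> e - a \<bullet> u)"
  define x where "x = u + s *\<^sub>R (e - u)"
  have pos: "a \<bullet> e - a \<bullet> u > 0" using E(4) by simp
  have "b \<ge> a \<bullet> u" using bd[OF E(2)] .
  then have "(b - a \<bullet> u + 1) / (a \<bullet> e - a \<bullet> u) \<ge> 0" using pos by simp
  then have s1: "s \<ge> 1" by (simp add: s_def)
  have "a \<bullet> x = a \<bullet> u + s * (a \<bullet> e - a \<bullet> u)" by (simp add: x_def inner_add_right inner_diff_right)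
  also have "\<dots> = a \<bullet> e + (b - a \<bullet> u + 1)" using pos by (simp add: s_def field_simps)
  finally have ax: "a \<bullet> x = a \<bullet> e + (b - a \<bullet> u + 1)" .
  have "x \<notin> E"
  proof
    assume "x \<in> E"
    then show False using bd[of x] ax E(4) by simp
  qed
  moreover have "x \<in> affine hull E"
    unfolding x_def using hull_subset[of E affine] E(2,3)
    by (intro mem_affine_3_minus affine_affine_hull) auto
  ultimately obtain z where z: "z \<in> closed_segment e x" "z \<in> rel_frontier E"
    using segment_meets_rel_frontier[OF polyhedron_imp_closed[OF Epoly] E(3)] by blast
  have "z extreme_point_of Q" by (rule edge_rel_frontier(2)[OF Q E(1) z(2)])
  moreover obtain t where t: "0 \<le> t" "t \<le> 1" "z = (1 - t) *\<^sub>R e + t *\<^sub>R x"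
    using z(1) by (auto simp: in_segment)
  have "a \<bullet> z = (1 - t) * (a \<bullet> e) + t * (a \<bullet> x)"
    unfolding t(3) by (simp add: inner_add_right)
  then have "a \<bullet> z = a \<bullet> e + t * (b - a \<bullet> u + 1)"
    by (simp add: ax algebra_simps)
  moreover have "t * (b - a \<bullet> u + 1) \<ge> 0" using t \<open>b \<ge> a \<bullet> u\<close> by simp
  ultimately show ?thesis using that E(4) by simp
qed

text \<open>If the facets met by the ball of radius \<open>k + 1\<close> around \<open>w\<close> define a polyhedron of diameter at
  most \<open>k\<close>, then the ball of radius \<open>k\<close> is the whole graph: a facet outside would cut off an edge of
  the relaxed polyhedron that starts in the ball.\<close>

lemma ball_exhausts_vertices:
  fixes P :: "'a::euclidean_space set"
  assumes P: "polyhedron P" and w: "w \<in> vertices P" and v: "v \<in> vertices P"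
    and \<G>: "\<G> = {G. G facet_of P \<and> (\<exists>z\<in>G. \<exists>j\<le>Suc k. (adjacent P ^^ j) w z)}"
    and diam: "diam_le (relax P \<G>) k"
  shows "\<exists>j\<le>k. (adjacent P ^^ j) w v"
proof -
  let ?Q = "relax P \<G>"
  define S where "S = {z \<in> vertices P. \<exists>j\<le>Suc k. (adjacent P ^^ j) w z}"
  have fin: "finite \<G>" using finite_polyhedron_facets[OF P] unfolding \<G> by simp
  have fac: "\<And>G. G \<in> \<G> \<Longrightarrow> G facet_of P" by (simp add: \<G>)
  have Q: "polyhedron ?Q" using polyhedron_relax[OF P fin fac] .
  note ext = mem_vertices_iff[OF P] mem_vertices_iff[OF Q]
  have S: "z \<in> vertices P" "\<And>G. G facet_of P \<Longrightarrow> z \<in> G \<Longrightarrow> G \<in> \<G>" if "z \<in> S" for z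
    using that by (auto simp: S_def \<G>)
  have SQ: "z \<in> vertices ?Q" if "z \<in> vertices P" "\<And>G. G facet_of P \<Longrightarrow> z \<in> G \<Longrightarrow> G \<in> \<G>" for z
    using extreme_point_of_relax[OF P _ that(2) fac] that(1) ext by blast
  have wS: "w \<in> S" using w by (auto simp: S_def intro!: exI[of _ 0])
  have wQ: "w \<in> vertices ?Q" using SQ S[OF wS] by blast
  have near: "\<exists>j\<le>k. (adjacent P ^^ j) w q" "q \<in> S" if q: "q \<in> vertices ?Q" for q
  proof -
    obtain j where j: "j \<le> k" "(adjacent ?Q ^^ j) w q"
      using diam wQ q unfolding diam_le_def by blast
    have "\<not> (\<exists>z\<in>vertices P - S. \<exists>i\<le>j. (adjacent P ^^ i) w z)"
      using j(1) by (auto simp: S_def)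
    moreover have "(\<exists>z\<in>vertices P - S. \<exists>i\<le>j. (adjacent P ^^ i) w z) \<or> (q \<in> S \<and> (adjacent P ^^ j) w q)"
      by (rule follow_path[OF P fin _ _ _ j(2) wS]) (use S fac in blast)+
    ultimately have *: "q \<in> S \<and> (adjacent P ^^ j) w q" by blast
    then show "\<exists>j\<le>k. (adjacent P ^^ j) w q" "q \<in> S" using j(1) by auto
  qed
  show ?thesis
  proof (cases "\<forall>G. G facet_of P \<longrightarrow> v \<in> G \<longrightarrow> G \<in> \<G>")
    case True
    then show ?thesis using SQ[OF v] near(1) by blast
  next
    case False
    then obtain G0 where G0: "G0 facet_of P" "v \<in> G0" "G0 \<notin> \<G>" by blast
    \<comment> \<open>The vertex \<open>u\<close> of the relaxation is chosen best possible for the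
      normal \<open>a\<close> of the unreached facet \<open>G0\<close>. As \<open>v\<close> is still
      better, an improving edge starts at \<open>u\<close>; its other end will contradict the
      choice.\<close>
    obtain a b where ab: "P \<subseteq> {x. a \<bullet> x \<le> b}" "G0 = P \<inter> {x. a \<bullet> x = b}"
      by (rule facet_of_polyhedron[OF P G0(1)]) auto
    have "finite (vertices ?Q)"
      using finite_polyhedron_extreme_points[OF Q] by (simp add: vertices_eq_extreme_points[OF Q])
    then have fin': "finite ((\<lambda>x. a \<bullet> x) ` vertices ?Q)" by simp
    then have "Max ((\<lambda>x. a \<bullet> x) ` vertices ?Q) \<in> (\<lambda>x. a \<bullet> x) ` vertices ?Q"
      using wQ by (intro Max_in) auto
    then obtain u where u: "u \<in> vertices ?Q" "Max ((\<lambda>x. a \<bullet> x) ` vertices ?Q) = a \<bullet> u" by blast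
    have max: "a \<bullet> x \<le> a \<bullet> u" if "x \<in> vertices ?Q" for x
      using Max_ge[OF fin'] that u(2) by (metis imageI)
    have uS: "u \<in> S" using near(2)[OF u(1)] .
    then have uext: "u extreme_point_of P" and uP: "u \<in> P" using S(1) ext by (auto simp: extreme_point_of_def)
    have "u \<notin> G0" using S(2)[OF uS G0(1)] G0(3) by blast
    then have "a \<bullet> u < b" using ab uP by force
    moreover have "a \<bullet> v = b" using G0(2) ab(2) by blast
    moreover have "v \<in> ?Q" using subset_relax[OF P fac] G0(2) ab(2) by blast
    ultimately obtain E e where E: "E edge_of ?Q" "u \<in> E" "e \<in> E" "a \<bullet> e > a \<bullet> u"
      using improving_edge[OF Q, of u v a] u(1) ext by blast
    \<comment> \<open>An exit vertex would be adjacent to \<open>u\<close>, hence within distance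
      \<open>k + 1\<close> of \<open>w\<close>, and all its facets would have been kept. This is why
      the ball needs one step more than the diameter bound.\<close>
    have "E \<subseteq> P"
    proof
      fix x assume x: "x \<in> E"
      show "x \<in> P"
      proof (rule ccontr)
        assume "x \<notin> P"
        then obtain z G where z: "z extreme_point_of P" "z \<noteq> u" "z \<in> E" "G facet_of P" "z \<in> G" "G \<notin> \<G>"
          using edge_of_relax_exit[OF P uext fin S(2)[OF uS] fac E(1,2) x] by blast
        have "z \<in> P" using z(1) by (simp add: extreme_point_of_def)
        then have "adjacent P u z" unfolding adjacent_iff[OF P]
          using uext z uP E(2) edge_of_relax_Int[OF P uext S(2)[OF uS] fac E(1,2)] by blast
        moreover obtain j where "j \<le> k" "(adjacent P ^^ j) w u" using near(1)[OF u(1)] by blast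
        ultimately have "(adjacent P ^^ Suc j) w z" "Suc j \<le> Suc k" by (auto intro: relpowp_Suc_I)
        then have "G \<in> \<G>" using z(4,5) unfolding \<G> by blast
        then show False using z(6) by blast
      qed
    qed
    then have "a \<bullet> x \<le> b" if "x \<in> E" for x using ab(1) that by blast
    then obtain z where "z extreme_point_of ?Q" "a \<bullet> z > a \<bullet> u"
      using bounded_edge_endpoint[OF Q E] by blast
    then show ?thesis using max[of z] ext by force
  qed
qed

section \<open>The inequality of Kalai and Kleitman\<close>

text \<open>\<open>K\<close> is the intersection of the facets of \<open>P\<close> above it, so some
  \<open>H\<close> besides \<open>G\<close> contains it. The face \<open>G \<inter> H\<close> is
  proper in \<open>G\<close>, and its dimension leaves no room above \<open>K\<close>.\<close>

lemma facet_of_facet: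
  assumes P: "polyhedron P" and G: "G facet_of P" and K: "K facet_of G"
  obtains H where "H facet_of P" "H \<noteq> G" "K = G \<inter> H"
proof -
  have Gf: "G face_of P" "aff_dim G = aff_dim P - 1" using G by (auto simp: facet_of_def)
  have Kf: "K face_of G" "K \<noteq> {}" "aff_dim K = aff_dim G - 1" using K by (auto simp: facet_of_def)
  have KP: "K face_of P" using face_of_trans[OF Kf(1) Gf(1)] .
  have "K \<noteq> P" using Kf(3) Gf(2) by auto
  have Keq: "K = \<Inter>{F. F facet_of P \<and> K \<subseteq> F}"
    using face_of_polyhedron[OF P KP Kf(2) \<open>K \<noteq> P\<close>] .
  have "K \<noteq> G" using Kf(3) by auto
  have "K \<subseteq> G" using face_of_imp_subset[OF Kf(1)] .
  have "\<exists>H. H facet_of P \<and> K \<subseteq> H \<and> H \<noteq> G"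
  proof (rule ccontr)
    assume "\<not> ?thesis"
    then have "{F. F facet_of P \<and> K \<subseteq> F} = {G}" using G \<open>K \<subseteq> G\<close> by blast
    then show False using Keq \<open>K \<noteq> G\<close> by simp
  qed
  then obtain H where H: "H facet_of P" "K \<subseteq> H" "H \<noteq> G" by blast
  have Hf: "H face_of P" "aff_dim H = aff_dim P - 1" using H(1) by (auto simp: facet_of_def)
  have GHP: "(G \<inter> H) face_of P" using face_of_Int[OF Gf(1) Hf(1)] .
  have GHG: "(G \<inter> H) face_of G"
    using face_of_subset[OF GHP] face_of_imp_subset[OF Gf(1)] by blast
  have cG: "convex G" using face_of_imp_convex[OF Gf(1)] .
  have cH: "convex H" using face_of_imp_convex[OF Hf(1)] .
  have "G \<inter> H \<noteq> G"
  proof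
    assume "G \<inter> H = G"
    then have "G face_of H" using face_of_subset[OF Gf(1), of H] face_of_imp_subset[OF Hf(1)] by blast
    then have "aff_dim G < aff_dim H" using face_of_aff_dim_lt[OF cH] H(3) by blast
    then show False using Gf(2) Hf(2) by simp
  qed
  then have lt: "aff_dim (G \<inter> H) < aff_dim G" using face_of_aff_dim_lt[OF cG GHG] by blast
  have KGH: "K face_of (G \<inter> H)"
    using face_of_subset[OF Kf(1), of "G \<inter> H"] \<open>K \<subseteq> G\<close> H(2) by blast
  have "K = G \<inter> H"
  proof (rule ccontr)
    assume "K \<noteq> G \<inter> H"
    then have "aff_dim K < aff_dim (G \<inter> H)"
      using face_of_aff_dim_lt[OF face_of_imp_convex[OF GHP] KGH] by blast
    then show False using lt Kf(3) by simp
  qed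
  then show ?thesis using that H by blast
qed

text \<open>Each \<open>K\<close> is cut out of \<open>G\<close> by another facet of
  \<open>P\<close>, and this assignment is injective. It is applied to all facets, to those at a
  vertex, and to the neighbours of a facet in late layers.\<close>

lemma card_facets_of_facet_le:
  assumes P: "polyhedron P" and G: "G facet_of P"
    and \<N>: "finite \<N>" "\<And>H. H facet_of P \<Longrightarrow> H \<noteq> G \<Longrightarrow> G \<inter> H \<in> \<K> \<Longrightarrow> H \<in> \<N>"
    and \<K>: "\<And>K. K \<in> \<K> \<Longrightarrow> K facet_of G"
  shows "card \<K> \<le> card (\<N> - {G})"
proof -
  have "\<exists>H. H facet_of P \<and> H \<noteq> G \<and> K = G \<inter> H" if "K \<in> \<K>" for K
    by (rule facet_of_facet[OF P G \<K>[OF that]]) auto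
  then obtain h where h: "\<And>K. K \<in> \<K> \<Longrightarrow> h K facet_of P \<and> h K \<noteq> G \<and> K = G \<inter> h K" by metis
  have "inj_on h \<K>" by (rule inj_onI) (metis h)
  moreover have "h ` \<K> \<subseteq> \<N> - {G}"
  proof
    fix H assume "H \<in> h ` \<K>"
    then obtain K where K: "K \<in> \<K>" "H = h K" by blast
    then have "H facet_of P" "H \<noteq> G" "G \<inter> H = K" using h[OF K(1)] by auto
    then show "H \<in> \<N> - {G}" using \<N>(2)[of H] K(1) by simp
  qed
  ultimately show ?thesis using card_inj_on_le[of h \<K> "\<N> - {G}"] \<N>(1) by simp
qed

lemma card_facets_facet:
  assumes P: "polyhedron P" and G: "G facet_of P"
  shows "card {K. K facet_of G} \<le> card {H. H facet_of P} - 1"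
proof -
  have fin: "finite {H. H facet_of P}" using finite_polyhedron_facets[OF P] .
  have "card {K. K facet_of G} \<le> card ({H. H facet_of P} - {G})"
    by (rule card_facets_of_facet_le[OF P G fin]) auto
  also have "\<dots> = card {H. H facet_of P} - 1" using G fin by (simp add: card_Diff_singleton)
  finally show ?thesis .
qed

lemma vertex_of_facet:
  assumes P: "polyhedron P" and G: "G facet_of P"
  shows "polyhedron G" "vertices G = vertices P \<inter> G" "adjacent G u v \<Longrightarrow> adjacent P u v"
proof -
  have Gf: "G face_of P" using G by (auto simp: facet_of_def)
  show pG: "polyhedron G" using face_of_polyhedron_polyhedron[OF P Gf] .
  show *: "vertices G = vertices P \<inter> G"
    using extreme_point_of_face[OF Gf] by (auto simp: vertices_eq_extreme_points P pG)
  show "adjacent P u v" if "adjacent G u v"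
    using that extreme_point_of_face[OF Gf] face_of_trans[OF _ Gf]
    unfolding adjacent_iff[OF P] adjacent_iff[OF pG] edge_of_def by blast
qed

lemma path_of_facet:
  assumes "polyhedron P" "G facet_of P" "(adjacent G ^^ n) u v"
  shows "(adjacent P ^^ n) u v"
  using relpowp_mono[of "adjacent G" "adjacent P"] vertex_of_facet(3)[OF assms(1,2)] assms(3) by blast

lemma card_facets_at_vertex:
  assumes "polyhedron P" "aff_dim P = int d" "d \<ge> 1" "v \<in> vertices P"
  shows "d \<le> card {G. G facet_of P \<and> v \<in> G}"
  using assms
proof (induction d arbitrary: P)
  case (Suc d)
  note P = Suc.prems(1)
  have v: "{v} face_of P" using Suc.prems(4) by (simp add: mem_vertices_iff[OF P] face_of_singleton)
  have "{v} \<noteq> P" using Suc.prems(2) by auto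
  then obtain G where G: "G facet_of P" "v \<in> G"
    using face_of_polyhedron_subset_facet[OF P v] by auto
  have fin: "finite {G. G facet_of P \<and> v \<in> G}" using finite_polyhedron_facets[OF P] by simp
  have "d \<le> card ({G. G facet_of P \<and> v \<in> G} - {G})"
  proof (cases "d = 0")
    case False
    have "aff_dim G = int d" using G(1) Suc.prems(2) by (simp add: facet_of_def)
    moreover have "v \<in> vertices G" using vertex_of_facet(2)[OF P G(1)] Suc.prems(4) G(2) by blast
    ultimately have "d \<le> card {K. K facet_of G \<and> v \<in> K}"
      using Suc.IH[OF vertex_of_facet(1)[OF P G(1)]] False by simp
    also have "\<dots> \<le> card ({G. G facet_of P \<and> v \<in> G} - {G})"
      by (rule card_facets_of_facet_le[OF P G(1) fin]) auto
    finally show ?thesis .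
  qed simp
  also have "\<dots> = card {G. G facet_of P \<and> v \<in> G} - 1" using G fin by (simp add: card_Diff_singleton)
  finally have "d \<le> card {G. G facet_of P \<and> v \<in> G} - 1" .
  moreover have "card {G. G facet_of P \<and> v \<in> G} > 0" using G fin by (auto simp: card_gt_0_iff)
  ultimately show ?case by linarith
qed simp

text \<open>At most \<open>d + m\<close> facets, rather than exactly as many, because the facet
  numbers of facets and of relaxations are only estimated from above.\<close>

definition diam_bound :: "'a::euclidean_space itself \<Rightarrow> nat \<Rightarrow> nat \<Rightarrow> nat \<Rightarrow> bool" where
  "diam_bound (_::'a itself) d m k \<longleftrightarrow>
     (\<forall>P::'a set. polyhedron P \<and> aff_dim P = int d \<and> card {G. G facet_of P} \<le> d + m \<longrightarrow> diam_le P k)"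

lemma diam_boundD:
  fixes P :: "'a::euclidean_space set"
  assumes "diam_bound TYPE('a) d m k" "polyhedron P" "aff_dim P = int d" "card {G. G facet_of P} \<le> d + m"
  shows "diam_le P k"
  using assms unfolding diam_bound_def by blast

lemma diam_le_mono: "diam_le P k \<Longrightarrow> k \<le> k' \<Longrightarrow> diam_le P k'"
  unfolding diam_le_def by (meson le_trans)

lemma diam_bound_mono: "diam_bound T d m k \<Longrightarrow> k \<le> k' \<Longrightarrow> diam_bound T d m k'"
  unfolding diam_bound_def using diam_le_mono by blast

definition reached_facets :: "'a::euclidean_space set \<Rightarrow> 'a \<Rightarrow> nat \<Rightarrow> 'a set set" where
  "reached_facets P w r = {G. G facet_of P \<and> (\<exists>z\<in>G. \<exists>j\<le>r. (adjacent P ^^ j) w z)}"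

text \<open>If the ball of radius \<open>Suc k\<close> met at most \<open>d + m\<close> facets,
  relaxing to them would give a polyhedron of diameter at most \<open>k\<close>, and
  \<open>ball_exhausts_vertices\<close> would apply.\<close>

lemma reached_facets_large:
  fixes P :: "'a::euclidean_space set"
  assumes P: "polyhedron P" "aff_dim P = int d" and w: "w \<in> vertices P" and v: "v \<in> vertices P"
    and bound: "diam_bound TYPE('a) d m k"
  shows "d + m < card (reached_facets P w (Suc k)) \<or> (\<exists>j\<le>Suc k. (adjacent P ^^ j) w v)"
proof (rule disjCI)
  assume no: "\<not> (\<exists>j\<le>Suc k. (adjacent P ^^ j) w v)"
  show "d + m < card (reached_facets P w (Suc k))"
  proof (rule ccontr)
    assume "\<not> ?thesis"
    then have c: "card (reached_facets P w (Suc k)) \<le> d + m" by simp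
    have fin: "finite (reached_facets P w (Suc k))"
      using finite_polyhedron_facets[OF P(1)] by (simp add: reached_facets_def)
    have fac: "\<And>G. G \<in> reached_facets P w (Suc k) \<Longrightarrow> G facet_of P" by (simp add: reached_facets_def)
    have "diam_le (relax P (reached_facets P w (Suc k))) k"
    proof (rule diam_boundD[OF bound])
      show "polyhedron (relax P (reached_facets P w (Suc k)))" by (rule polyhedron_relax[OF P(1) fin fac])
      show "aff_dim (relax P (reached_facets P w (Suc k))) = int d"
        using aff_dim_relax[OF P(1) fac] P(2) by simp
      show "card {G. G facet_of relax P (reached_facets P w (Suc k))} \<le> d + m"
        using card_facets_relax[OF P(1) fin fac] c by simp
    qed
    then have "\<exists>j\<le>k. (adjacent P ^^ j) w v"
      by (rule ball_exhausts_vertices[OF P(1) w v reached_facets_def])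
    then show False using no by (meson le_SucI)
  qed
qed

text \<open>The two sets of reached facets have together at least \<open>N + M + 2\<close> members,
  more than there are facets. A common facet is entered from both ends and crossed by the bound in
  dimension \<open>d\<close>.\<close>

lemma path_via_common_facet:
  fixes P :: "'a::euclidean_space set"
  assumes P: "polyhedron P" "aff_dim P = int (Suc d)"
    and u: "u \<in> vertices P" and v: "v \<in> vertices P" and n: "card {G. G facet_of P} \<le> Suc d + m"
    and A: "N < card (reached_facets P u r) \<or> (\<exists>j\<le>r. (adjacent P ^^ j) u v)"
    and B: "M < card (reached_facets P v s) \<or> (\<exists>j\<le>s. (adjacent P ^^ j) v u)"
    and NM: "Suc d + m \<le> N + M + 1" and bound: "diam_bound TYPE('a) d m k"
  shows "\<exists>j\<le>k + r + s. (adjacent P ^^ j) u v"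
proof (cases "(\<exists>j\<le>r. (adjacent P ^^ j) u v) \<or> (\<exists>j\<le>s. (adjacent P ^^ j) v u)")
  case True
  then show ?thesis 
  proof
    assume "\<exists>j\<le>r. (adjacent P ^^ j) u v"
    then obtain j where "j \<le> r" "(adjacent P ^^ j) u v" by blast
    then show ?thesis by (intro exI[of _ j]) simp
  next
    assume "\<exists>j\<le>s. (adjacent P ^^ j) v u"
    then obtain j where "j \<le> s" "(adjacent P ^^ j) v u" by blast
    moreover from this(2) have "(adjacent P ^^ j) u v" by (rule adjacent_path_sym)
    ultimately show ?thesis by (intro exI[of _ j]) simp
  qed
next
  case False
  let ?F = "{G. G facet_of P}"
  let ?A = "reached_facets P u r" and ?B = "reached_facets P v s"
  have fin: "finite ?F" using finite_polyhedron_facets[OF P(1)] .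
  have sub: "?A \<subseteq> ?F" "?B \<subseteq> ?F" by (auto simp: reached_facets_def)
  then have finAB: "finite ?A" "finite ?B" using fin finite_subset by auto
  have "card (?A \<union> ?B) \<le> card ?F" using sub fin by (intro card_mono) auto
  moreover have "card ?A + card ?B = card (?A \<union> ?B) + card (?A \<inter> ?B)"
    using card_Un_Int[OF finAB] .
  moreover have "N < card ?A" "M < card ?B" using A B False by auto
  ultimately have "card (?A \<inter> ?B) > 0" using n NM by linarith
  then obtain G where G: "G \<in> ?A" "G \<in> ?B" by (auto simp: card_gt_0_iff)
  then obtain x i y j where x: "x \<in> G" "i \<le> r" "(adjacent P ^^ i) u x"
    and y: "y \<in> G" "j \<le> s" "(adjacent P ^^ j) v y" and Gf: "G facet_of P"
    by (auto simp: reached_facets_def)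
  have "diam_le G k"
  proof (rule diam_boundD[OF bound vertex_of_facet(1)[OF P(1) Gf]])
    show "aff_dim G = int d" using Gf P(2) by (simp add: facet_of_def)
    show "card {K. K facet_of G} \<le> d + m" using card_facets_facet[OF P(1) Gf] n by simp
  qed
  moreover have "x \<in> vertices G" "y \<in> vertices G"
    using path_vertex[OF u x(3)] path_vertex[OF v y(3)] x(1) y(1) vertex_of_facet(2)[OF P(1) Gf] by auto
  ultimately obtain l where l: "l \<le> k" "(adjacent G ^^ l) x y" unfolding diam_le_def by blast
  have "(adjacent P ^^ (i + (l + j))) u v"
    using path_trans[OF x(3) path_trans[OF path_of_facet[OF P(1) Gf l(2)] adjacent_path_sym[OF y(3)]]] .
  moreover have "i + (l + j) \<le> k + r + s" using x(2) y(2) l(1) by linarith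
  ultimately show ?thesis by blast
qed

text \<open>Each vertex lies on at least \<open>Suc d\<close> facets. There are fewer than
  \<open>2 * Suc d\<close> in all, so two vertices already share one.\<close>

lemma diam_bound_low:
  assumes "diam_bound TYPE('a::euclidean_space) d m k" "m \<le> d"
  shows "diam_bound TYPE('a) (Suc d) m k"
  unfolding diam_bound_def diam_le_def
proof (intro allI impI ballI)
  fix P :: "'a set" and u v
  assume P: "polyhedron P \<and> aff_dim P = int (Suc d) \<and> card {G. G facet_of P} \<le> Suc d + m"
    and u: "u \<in> vertices P" and v: "v \<in> vertices P"
  have r0: "d < card (reached_facets P w 0)" if "w \<in> vertices P" for w
    using card_facets_at_vertex[of P "Suc d" w] P that by (simp add: reached_facets_def)
  have "\<exists>j\<le>k + 0 + 0. (adjacent P ^^ j) u v"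
    by (rule path_via_common_facet[where N = d and M = d and m = m and d = d])
      (use P u v r0 assms in auto)
  then show "\<exists>j\<le>k. (adjacent P ^^ j) u v" by simp
qed

text \<open>The two halves add up to \<open>m - Suc d - 1\<close>, so the balls reach just enough
  facets to force a common one. The radii \<open>Suc r\<close> and \<open>Suc s\<close> account for
  the additive 2 of the recursion.\<close>

lemma diam_bound_Kalai_Kleitman:
  assumes low: "diam_bound TYPE('a::euclidean_space) d m k" and m: "Suc d < m"
    and b1: "diam_bound TYPE('a) (Suc d) ((m - Suc d) div 2) r"
    and b2: "diam_bound TYPE('a) (Suc d) ((m - Suc d - 1) div 2) s"
  shows "diam_bound TYPE('a) (Suc d) m (k + Suc r + Suc s)"
  unfolding diam_bound_def diam_le_def
proof (intro allI impI ballI)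
  fix P :: "'a set" and u v
  assume P: "polyhedron P \<and> aff_dim P = int (Suc d) \<and> card {G. G facet_of P} \<le> Suc d + m"
    and u: "u \<in> vertices P" and v: "v \<in> vertices P"
  have *: "(m - Suc d) div 2 + (m - Suc d - 1) div 2 = m - Suc d - 1" using m by presburger
  show "\<exists>j\<le>k + Suc r + Suc s. (adjacent P ^^ j) u v"
    by (rule path_via_common_facet[OF _ _ u v _
          reached_facets_large[OF _ _ u v b1] reached_facets_large[OF _ _ v u b2] _ low])
      (use P * m in auto)
qed

text \<open>Here the second half would be negative. One ball suffices, against the
  \<open>Suc d\<close> facets on which the other vertex lies.\<close>

lemma diam_bound_Kalai_Kleitman_eq:
  assumes low: "diam_bound TYPE('a::euclidean_space) d (Suc d) k"
    and b1: "diam_bound TYPE('a) (Suc d) 0 r"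
  shows "diam_bound TYPE('a) (Suc d) (Suc d) (k + Suc r)"
  unfolding diam_bound_def diam_le_def
proof (intro allI impI ballI)
  fix P :: "'a set" and u v
  assume P: "polyhedron P \<and> aff_dim P = int (Suc d) \<and> card {G. G facet_of P} \<le> Suc d + Suc d"
    and u: "u \<in> vertices P" and v: "v \<in> vertices P"
  have r0: "d < card (reached_facets P v 0)"
    using card_facets_at_vertex[of P "Suc d" v] P v by (simp add: reached_facets_def)
  have "\<exists>j\<le>k + Suc r + 0. (adjacent P ^^ j) u v"
    by (rule path_via_common_facet[OF _ _ u v _ reached_facets_large[OF _ _ u v b1] _ _ low, where M = d])
      (use P r0 in auto)
  then show "\<exists>j\<le>k + Suc r. (adjacent P ^^ j) u v" by simp
qed

lemma diam_bound_1: "diam_bound TYPE('a::euclidean_space) 1 m 1"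
  unfolding diam_bound_def diam_le_def
proof (intro allI impI ballI)
  fix P :: "'a set" and u v
  assume P: "polyhedron P \<and> aff_dim P = int 1 \<and> card {G. G facet_of P} \<le> 1 + m"
    and u: "u \<in> vertices P" and v: "v \<in> vertices P"
  show "\<exists>j\<le>1. (adjacent P ^^ j) u v"
  proof (cases "u = v")
    case True then show ?thesis by (intro exI[of _ 0]) simp
  next
    case False
    have "convex P" using P polyhedron_imp_convex by blast
    then have "P edge_of P" using P face_of_refl by (simp add: edge_of_def)
    then have "adjacent P u v"
      using P u v False by (auto simp: adjacent_iff mem_vertices_iff extreme_point_of_def)
    then show ?thesis by (intro exI[of _ 1]) (simp only: relpowp_1 order_refl simp_thms)
  qed
qed

text \<open>For \<open>n = d\<close> the theorem claims the bound \<open>0 powr _ = 0\<close>, so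
  the diameter must be known to be exactly 0; in dimension 2 this follows from here by
  \<open>diam_bound_low\<close>.\<close>

lemma diam_bound_1_0: "diam_bound TYPE('a::euclidean_space) 1 0 0"
  unfolding diam_bound_def diam_le_def
proof (intro allI impI ballI)
  fix P :: "'a set" and u v
  assume P: "polyhedron P \<and> aff_dim P = int 1 \<and> card {G. G facet_of P} \<le> 1 + 0"
    and u: "u \<in> vertices P" and v: "v \<in> vertices P"
  have fin: "finite {G. G facet_of P}" using finite_polyhedron_facets P by blast
  have "{w} facet_of P" if "w \<in> vertices P" for w
    using that P by (simp add: facet_of_def face_of_singleton mem_vertices_iff)
  then have "{{u}, {v}} \<subseteq> {G. G facet_of P}" using u v by auto
  then have "card {{u}, {v}} \<le> card {G. G facet_of P}" by (rule card_mono[OF fin])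
  then have "card {{u}, {v}} \<le> 1" using P by linarith
  then have "u = v" by (cases "u = v") auto
  then show "\<exists>j\<le>0. (adjacent P ^^ j) u v" by simp
qed

text \<open>In dimension 2 the recursion reproduces the bound \<open>m\<close> without loss: the two
  halves add up to \<open>m - 3\<close>, and the remaining terms are 3.\<close>

lemma diam_bound_2: "diam_bound TYPE('a::euclidean_space) 2 m m"
proof (induction m rule: less_induct)
  case (less m)
  have two: "2 = Suc 1" by simp
  consider "m = 0" | "m = 1" | "m = 2" | "m > 2" by linarith
  then show ?case
  proof cases
    case 1 then show ?thesis unfolding two using diam_bound_low[OF diam_bound_1_0[where 'a = 'a]] by simp
  next
    case 2 then show ?thesis unfolding two using diam_bound_low[OF diam_bound_1[where 'a = 'a]] by simp
  next
    case 3
    then show ?thesis unfolding two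
      using diam_bound_Kalai_Kleitman_eq[OF diam_bound_1[where 'a = 'a], of 0] less[of 0] by (simp add: numeral_2_eq_2)
  next
    case 4
    have "(m - 2) div 2 < m" "(m - 3) div 2 < m" using 4 by auto
    then have "diam_bound TYPE('a) (Suc 1) m (1 + Suc ((m - 2) div 2) + Suc ((m - 3) div 2))"
      using 4 less by (intro diam_bound_Kalai_Kleitman diam_bound_1) (auto simp: numeral_eq_Suc)
    moreover have "1 + Suc ((m - 2) div 2) + Suc ((m - 3) div 2) = m" using 4 by presburger
    ultimately show ?thesis by (simp add: two)
  qed
qed

text \<open>Besides making \<open>max_diam\<close> meaningful, this gives the connectedness on which
  the distance layers depend.\<close>

lemma diam_bound_exists: "d \<ge> 1 \<Longrightarrow> \<exists>k. diam_bound TYPE('a::euclidean_space) d m k"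
proof (induction d arbitrary: m)
  case (Suc d)
  show ?case
  proof (cases "d = 0")
    case True then show ?thesis using diam_bound_1 by auto
  next
    case False
    show ?thesis
    proof (induction m rule: less_induct)
      case (less m)
      obtain k where k: "diam_bound TYPE('a) d m k" using Suc.IH[of m] False by auto
      consider "m \<le> d" | "m = Suc d" | "m > Suc d" by linarith
      then show ?case
      proof cases
        case 1 then show ?thesis using diam_bound_low[OF k] by blast
      next
        case 2
        then obtain r where "diam_bound TYPE('a) (Suc d) 0 r" using less[of 0] by auto
        then show ?thesis using diam_bound_Kalai_Kleitman_eq k 2 by blast
      next
        case 3
        have "(m - Suc d) div 2 < m" "(m - Suc d - 1) div 2 < m" using 3 by auto
        then obtain r s where "diam_bound TYPE('a) (Suc d) ((m - Suc d) div 2) r"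
          "diam_bound TYPE('a) (Suc d) ((m - Suc d - 1) div 2) s"
          using less by blast
        then show ?thesis using diam_bound_Kalai_Kleitman[OF k 3] by blast
      qed
    qed
  qed
qed simp

section \<open>The linear bound of Larman and Barnette\<close>

lemma path_intermediate_value:
  fixes f :: "'a::euclidean_space \<Rightarrow> nat"
  assumes "\<And>x y. adjacent G x y \<Longrightarrow> f y \<le> Suc (f x)"
    and "(adjacent G ^^ n) x y" "x \<in> vertices G" "f x \<le> r" "r \<le> f y"
  shows "\<exists>z\<in>vertices G. f z = r"
  using assms(2-)
proof (induction n arbitrary: y)
  case 0
  then show ?case by auto
next
  case (Suc n)
  obtain w where w: "(adjacent G ^^ n) x w" "adjacent G w y"
    by (rule relpowp_Suc_E[OF Suc.prems(1)])
  show ?case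
  proof (cases "r \<le> f w")
    case True
    show ?thesis by (rule Suc.IH[OF w(1) Suc.prems(2,3) True])
  next
    case False
    then have "f y = r" using assms(1)[OF w(2)] Suc.prems(4) by linarith
    moreover have "y \<in> vertices G" using w(2) by (simp add: adjacent_def)
    ultimately show ?thesis by blast
  qed
qed

text \<open>Vertices are sorted by their distance from \<open>u\<close>; \<alpha> is the factor of a
  linear diameter bound in the dimension of the facets.\<close>

locale layered_polyhedron =
  fixes P :: "'a::euclidean_space set" and u :: 'a and d :: nat and \<alpha> :: nat
  assumes P: "polyhedron P" and dim: "aff_dim P = int (Suc d)" and d1: "d \<ge> 1"
    and u: "u \<in> vertices P" and \<alpha>: "\<alpha> \<ge> 1"
    and facet_bound: "\<And>m. diam_bound TYPE('a) d m (\<alpha> * m)"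
    and connected: "\<And>v. v \<in> vertices P \<Longrightarrow> \<exists>j. (adjacent P ^^ j) u v"
begin

definition layer :: "'a \<Rightarrow> nat" where
  "layer v = (LEAST j. (adjacent P ^^ j) u v)"

lemma layer_path: "v \<in> vertices P \<Longrightarrow> (adjacent P ^^ layer v) u v"
  unfolding layer_def by (rule LeastI_ex[OF connected])

lemma layer_le: "(adjacent P ^^ j) u v \<Longrightarrow> layer v \<le> j"
  unfolding layer_def by (rule Least_le)

lemma layer_u [simp]: "layer u = 0"
  using layer_le[of 0 u] by simp

lemma layer_path_le:
  assumes "v \<in> vertices P" "(adjacent P ^^ j) v w"
  shows "layer w \<le> layer v + j"
  by (rule layer_le) (rule path_trans[OF layer_path[OF assms(1)] assms(2)])

lemma layer_adjacent: "adjacent P v w \<Longrightarrow> layer w \<le> Suc (layer v)"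
  using layer_path_le[of v 1 w] unfolding relpowp_1 by (simp add: adjacent_def)

lemma layer_nonempty:
  assumes "v \<in> vertices P" "s \<le> layer v"
  obtains x where "x \<in> vertices P" "layer x = s"
proof -
  have "\<exists>z\<in>vertices P. layer z = s"
    by (rule path_intermediate_value[where f = layer, OF _ layer_path[OF assms(1)] u])
      (use assms(2) layer_adjacent in auto)
  then show ?thesis using that by blast
qed

definition active :: "'a set \<Rightarrow> nat \<Rightarrow> bool" where
  "active G s \<longleftrightarrow> G facet_of P \<and> (\<exists>z\<in>vertices P \<inter> G. layer z = s)"

lemma finite_vertices: "finite (vertices P)"
  using finite_polyhedron_extreme_points[OF P] by (simp add: vertices_eq_extreme_points[OF P])

lemma finite_facets_P: "finite {G. G facet_of P}"
  by (rule finite_polyhedron_facets[OF P])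

lemma aff_dim_facet: "G facet_of P \<Longrightarrow> aff_dim G = int d"
  using dim by (simp add: facet_of_def)

text \<open>The graph of a facet is connected, and the layer grows by at most one along an
  edge.\<close>

lemma active_interval:
  assumes "active G s" "active G t" "s \<le> r" "r \<le> t"
  shows "active G r"
proof -
  obtain x y where x: "x \<in> vertices P" "x \<in> G" "layer x = s" and y: "y \<in> vertices P" "y \<in> G" "layer y = t"
    and G: "G facet_of P"
    using assms(1,2) unfolding active_def by blast
  have "diam_le G (\<alpha> * card {K. K facet_of G})"
    by (rule diam_boundD[OF facet_bound vertex_of_facet(1)[OF P G] aff_dim_facet[OF G]]) simp
  moreover have xy: "x \<in> vertices G" "y \<in> vertices G" using x y vertex_of_facet(2)[OF P G] by auto
  ultimately obtain j where j: "(adjacent G ^^ j) x y" unfolding diam_le_def by blast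
  have lip: "\<And>v w. adjacent G v w \<Longrightarrow> layer w \<le> Suc (layer v)"
    using layer_adjacent vertex_of_facet(3)[OF P G] by blast
  have "\<exists>z\<in>vertices G. layer z = r"
    by (rule path_intermediate_value[OF lip j xy(1)]) (use x y assms in auto)
  then show ?thesis using G vertex_of_facet(2)[OF P G] unfolding active_def by blast
qed

text \<open>The greedy choice: among the facets that meet layer \<open>s\<close>, one that lasts
  longest.\<close>

lemma active_exists:
  assumes "v \<in> vertices P" "s \<le> layer v"
  obtains F where "active F s" "\<And>G t. active G s \<Longrightarrow> active G t \<Longrightarrow> \<exists>t'\<ge>t. active F t'"
proof -
  obtain x where x: "x \<in> vertices P" "layer x = s" using layer_nonempty[OF assms] by blast
  have "card {G. G facet_of P \<and> x \<in> G} > 0"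
    using card_facets_at_vertex[OF P dim _ x(1)] by simp
  then obtain F0 where F0: "F0 facet_of P" "x \<in> F0" by (auto simp: card_gt_0_iff)
  let ?T = "{t. \<exists>G. active G s \<and> active G t}"
  have "?T \<subseteq> layer ` vertices P" by (auto simp: active_def)
  then have fin: "finite ?T" using finite_vertices finite_subset by blast
  have "active F0 s" using F0 x unfolding active_def by blast
  then have "?T \<noteq> {}" by blast
  then have "Max ?T \<in> ?T" using fin by (rule Max_in[rotated])
  then obtain F where F: "active F s" "active F (Max ?T)" by blast
  have "\<exists>t'\<ge>t. active F t'" if "active G s" "active G t" for G t
  proof -
    have "t \<in> ?T" using that by blast
    then have "t \<le> Max ?T" by (rule Max_ge[OF fin])
    then show ?thesis using F(2) by blast
  qed
  then show ?thesis using that F(1) by blast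
qed

definition neighbours :: "'a set \<Rightarrow> nat \<Rightarrow> 'a set set" where
  "neighbours F s = {G. G facet_of P \<and> (\<exists>z\<in>vertices P \<inter> F \<inter> G. s \<le> layer z)}"

text \<open>Only the facets that meet \<open>F\<close> in the layers from \<open>s\<close> on matter for the distance between these
  layers: a path in the polyhedron that they define can leave \<open>F\<close> only below layer \<open>s\<close>.\<close>

lemma facet_layers_le:
  assumes F: "active F s" "active F b" and max: "\<And>t. active F t \<Longrightarrow> t \<le> b"
  shows "b \<le> s + \<alpha> * (card (neighbours F s) - Suc d)"
proof -
  have FP: "F facet_of P" using F(1) by (simp add: active_def)
  note pF = vertex_of_facet(1)[OF P FP] and vF = vertex_of_facet(2)[OF P FP]
  obtain x where x: "x \<in> vertices F" "layer x = s" using F(1) vF unfolding active_def by blast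
  obtain y where y: "y \<in> vertices F" "layer y = b" using F(2) vF unfolding active_def by blast
  have "s \<le> b" using max[OF F(1)] .
  define \<K> where "\<K> = {K. K facet_of F \<and> (\<exists>z\<in>vertices F \<inter> K. s \<le> layer z)}"
  define S where "S = {z \<in> vertices F. s \<le> layer z}"
  have fin: "finite \<K>" using finite_polyhedron_facets[OF pF] by (simp add: \<K>_def)
  have fac: "K facet_of F" if "K \<in> \<K>" for K using that by (simp add: \<K>_def)
  have finN: "finite (neighbours F s)" using finite_facets_P by (simp add: neighbours_def)
  have FN: "F \<in> neighbours F s" using FP x vF by (auto simp: neighbours_def)
  have "card \<K> \<le> card (neighbours F s - {F})"
    by (rule card_facets_of_facet_le[OF P FP finN _ fac]) (auto simp: \<K>_def neighbours_def vF)
  then have cK: "card \<K> \<le> card (neighbours F s) - 1"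
    using FN finN by (simp add: card_Diff_singleton)
  have S1: "z \<in> vertices F" "\<And>G. G facet_of F \<Longrightarrow> z \<in> G \<Longrightarrow> G \<in> \<K>" if "z \<in> S" for z
    using that by (auto simp: S_def \<K>_def)
  have xS: "x \<in> S" and yS: "y \<in> S" using x y \<open>s \<le> b\<close> by (auto simp: S_def)
  have Q: "polyhedron (relax F \<K>)" by (rule polyhedron_relax[OF pF fin fac])
  have SQ: "z \<in> vertices (relax F \<K>)" if "z \<in> S" for z
  proof -
    have "z extreme_point_of F" using S1(1)[OF that] mem_vertices_iff[OF pF] by blast
    then have "z extreme_point_of relax F \<K>"
      by (rule extreme_point_of_relax[OF pF _ S1(2)[OF that] fac])
    then show ?thesis using mem_vertices_iff[OF Q] by blast
  qed
  have "diam_le (relax F \<K>) (\<alpha> * (card \<K> - d))"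
  proof (rule diam_boundD[OF facet_bound Q])
    show "aff_dim (relax F \<K>) = int d"
      using aff_dim_relax[OF pF fac] aff_dim_facet[OF FP] by simp
    show "card {K. K facet_of relax F \<K>} \<le> d + (card \<K> - d)"
      using card_facets_relax[OF pF fin fac] by simp
  qed
  then obtain j where j: "j \<le> \<alpha> * (card \<K> - d)" "(adjacent (relax F \<K>) ^^ j) y x"
    using SQ[OF xS] SQ[OF yS] unfolding diam_le_def by blast
  \<comment> \<open>The path is followed downwards from the top vertex \<open>y\<close>. Either it
    ends in \<open>x\<close>, or it leaves \<open>S\<close> at a vertex below layer
    \<open>s\<close>; in both cases \<open>j\<close> steps in \<open>F\<close> suffice to descend to
    layer \<open>s\<close> or lower.\<close>
  have "(\<exists>z\<in>vertices F - S. \<exists>i\<le>j. (adjacent F ^^ i) y z) \<or> (x \<in> S \<and> (adjacent F ^^ j) y x)"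
    by (rule follow_path[OF pF fin _ _ _ j(2) yS]) (use S1 fac in blast)+
  then obtain z i where z: "z \<in> vertices F" "layer z \<le> s" "i \<le> j" "(adjacent F ^^ i) y z"
  proof
    assume "\<exists>z\<in>vertices F - S. \<exists>i\<le>j. (adjacent F ^^ i) y z"
    then obtain z i where "z \<in> vertices F - S" "i \<le> j" "(adjacent F ^^ i) y z" by blast
    then show thesis by (intro that[of z i]) (auto simp: S_def)
  next
    assume "x \<in> S \<and> (adjacent F ^^ j) y x"
    then show thesis using x by (intro that[of x j]) auto
  qed
  have "(adjacent P ^^ i) z y"
    by (rule adjacent_path_sym, rule path_of_facet[OF P FP z(4)])
  then have "layer y \<le> layer z + i" using layer_path_le[of z i y] z(1) vF by blast
  then have "b \<le> s + j" using y z by simp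
  also have "j \<le> \<alpha> * (card (neighbours F s) - Suc d)"
  proof -
    have "card \<K> - d \<le> card (neighbours F s) - Suc d" using cK by simp
    then show ?thesis using j(1) by (meson le_trans mult_le_mono2)
  qed
  finally show ?thesis by simp
qed

definition later :: "nat \<Rightarrow> nat" where
  "later s = card {G. \<exists>t\<ge>s. active G t}"

definition current :: "nat \<Rightarrow> nat" where
  "current s = card {G. active G s}"

lemma finite_active: "finite {G. \<exists>t\<ge>s. active G t}" "finite {G. active G s}"
  by (rule finite_subset[OF _ finite_facets_P]; auto simp: active_def)+

lemma current_le_later: "current s \<le> later s"
  unfolding current_def later_def by (rule card_mono[OF finite_active(1)]) auto

text \<open>Let \<open>F\<close> last until layer \<open>b\<close>. A neighbour of \<open>F\<close>
  that is still active after \<open>b\<close> is active in \<open>Suc b\<close>, because active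
  layers form an interval; this bounds the neighbours. No facet active in layer \<open>s\<close>
  survives \<open>b\<close>, because \<open>F\<close> lasts longest; this is the last
  inequality.\<close>

lemma greedy_facet:
  assumes v: "v \<in> vertices P" "s \<le> layer v"
  obtains F b where "s \<le> b" "b \<le> s + \<alpha> * (card (neighbours F s) - Suc d)"
    "Suc d \<le> card (neighbours F s)" "card (neighbours F s) \<le> later s"
    "card (neighbours F s) + later (Suc b) \<le> later s + current (Suc b)"
    "current s + later (Suc b) \<le> later s"
proof -
  obtain F where F: "active F s" "\<And>G t. active G s \<Longrightarrow> active G t \<Longrightarrow> \<exists>t'\<ge>t. active F t'"
    using active_exists[OF v] by blast
  have FP: "F facet_of P" using F(1) by (simp add: active_def)
  let ?T = "{t. active F t}"
  have "?T \<subseteq> layer ` vertices P" by (auto simp: active_def)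
  then have fin: "finite ?T" using finite_vertices finite_subset by blast
  define b where "b = Max ?T"
  have ne: "?T \<noteq> {}" using F(1) by blast
  have b: "active F b" "\<And>t. active F t \<Longrightarrow> t \<le> b"
    using Max_in[OF fin ne] Max_ge[OF fin] by (auto simp: b_def)
  have sb: "s \<le> b" using b(2)[OF F(1)] .
  have notlater: "t \<le> b" if "active G s" "active G t" for G t
    using F(2)[OF that] b(2) le_trans by blast
  let ?N = "neighbours F s"
  have finN: "finite ?N" using finite_facets_P by (simp add: neighbours_def)
  have Nact: "\<exists>t. s \<le> t \<and> t \<le> b \<and> active G t" if G: "G \<in> ?N" for G
  proof -
    obtain z where z: "z \<in> vertices P" "z \<in> F" "z \<in> G" "s \<le> layer z" "G facet_of P"
      using G unfolding neighbours_def by blast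
    have "active F (layer z)" "active G (layer z)" using z FP unfolding active_def by blast+
    then show ?thesis using b(2) z(4) by blast
  qed
  have "card ?N \<le> later s"
    unfolding later_def by (rule card_mono[OF finite_active(1)]) (use Nact in blast)
  moreover have "Suc d \<le> card ?N"
  proof -
    obtain x where x: "x \<in> vertices P" "x \<in> F" "layer x = s" using F(1) unfolding active_def by blast
    have "Suc d \<le> card {G. G facet_of P \<and> x \<in> G}"
      by (rule card_facets_at_vertex[OF P dim _ x(1)]) simp
    also have "\<dots> \<le> card ?N"
      by (rule card_mono[OF finN]) (use x in \<open>auto simp: neighbours_def\<close>)
    finally show ?thesis .
  qed
  moreover have "card ?N + later (Suc b) \<le> later s + current (Suc b)"
  proof -
    let ?L = "{G. \<exists>t\<ge>s. active G t}" and ?M = "{G. \<exists>t\<ge>Suc b. active G t}"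
    have sub: "?M \<subseteq> ?L"
    proof
      fix G assume "G \<in> ?M"
      then obtain t where t: "Suc b \<le> t" "active G t" by blast
      then have "s \<le> t" using sb by linarith
      then show "G \<in> ?L" using t(2) by blast
    qed
    have "?N \<subseteq> (?L - ?M) \<union> {G. active G (Suc b)}"
    proof
      fix G assume "G \<in> ?N"
      then obtain t where t: "s \<le> t" "t \<le> b" "active G t" using Nact by blast
      show "G \<in> (?L - ?M) \<union> {G. active G (Suc b)}"
      proof (cases "G \<in> ?M")
        case True
        then obtain t' where "t' \<ge> Suc b" "active G t'" by blast
        then have "active G (Suc b)" using active_interval[OF t(3)] t(2) by simp
        then show ?thesis by blast
      qed (use t in blast)
    qed
    then have "card ?N \<le> card ((?L - ?M) \<union> {G. active G (Suc b)})"
      by (rule card_mono[rotated]) (use finite_active in auto)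
    also have "\<dots> \<le> card (?L - ?M) + current (Suc b)" unfolding current_def by (rule card_Un_le)
    also have "card (?L - ?M) = later s - later (Suc b)"
      unfolding later_def by (rule card_Diff_subset[OF finite_active(1) sub])
    finally have "card ?N \<le> later s - later (Suc b) + current (Suc b)" .
    moreover have "later (Suc b) \<le> later s"
      unfolding later_def by (rule card_mono[OF finite_active(1) sub])
    ultimately show ?thesis by linarith
  qed
  moreover have "current s + later (Suc b) \<le> later s"
  proof -
    let ?A = "{G. active G s}" and ?M = "{G. \<exists>t\<ge>Suc b. active G t}"
    have "?A \<inter> ?M = {}"
    proof (rule ccontr)
      assume "?A \<inter> ?M \<noteq> {}"
      then obtain G t where "active G s" "active G t" "t \<ge> Suc b" by blast
      then show False using notlater[of G t] by linarith
    qed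
    then have eq: "current s + later (Suc b) = card (?A \<union> ?M)"
      unfolding current_def later_def by (rule card_Un_disjoint[OF finite_active(2,1), symmetric])
    have "?A \<union> ?M \<subseteq> {G. \<exists>t\<ge>s. active G t}"
    proof
      fix G assume "G \<in> ?A \<union> ?M"
      then obtain t where t: "t = s \<or> Suc b \<le> t" "active G t" by blast
      then have "s \<le> t" using sb by linarith
      then show "G \<in> {G. \<exists>t\<ge>s. active G t}" using t(2) by blast
    qed
    then have "card (?A \<union> ?M) \<le> later s"
      unfolding later_def by (rule card_mono[OF finite_active(1)])
    then show ?thesis using eq by simp
  qed
  moreover have "b \<le> s + \<alpha> * (card ?N - Suc d)" by (rule facet_layers_le[OF F(1) b])
  ultimately show ?thesis using that[of b F] sb by blast
qed

text \<open>The greedy facets of the layers from \<open>s\<close> on see every facet at most twice, and those that are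
  active in layer \<open>s\<close> only once.\<close>

lemma layers_remaining_le:
  assumes v: "v \<in> vertices P" "s \<le> layer v"
  shows "int (layer v) + 1 - int s \<le> int \<alpha> * (2 * int (later s) - int (current s)) - (int \<alpha> * int (Suc d) - 1)"
  using v
proof (induction "layer v - s" arbitrary: s rule: less_induct)
  case less
  obtain F b where b: "s \<le> b" "b \<le> s + \<alpha> * (card (neighbours F s) - Suc d)"
    "Suc d \<le> card (neighbours F s)" "card (neighbours F s) \<le> later s"
    "card (neighbours F s) + later (Suc b) \<le> later s + current (Suc b)"
    "current s + later (Suc b) \<le> later s"
    using greedy_facet[OF less.prems] by blast
  define N where "N = int (card (neighbours F s))"
  have "int b \<le> int s + int \<alpha> * int (card (neighbours F s) - Suc d)" using b(2) by (simp only: of_nat_add[symmetric] of_nat_mult[symmetric] of_nat_le_iff)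
  then have len: "int b + 1 - int s \<le> int \<alpha> * (N - int (Suc d)) + 1"
    using b(3) by (simp add: N_def of_nat_diff)
  show ?case
  proof (cases "layer v \<le> b")
    case True
    have "N - int (Suc d) \<le> 2 * int (later s) - int (current s) - int (Suc d)"
      using b(4) current_le_later[of s] by (simp add: N_def)
    then have "int \<alpha> * (N - int (Suc d)) \<le> int \<alpha> * (2 * int (later s) - int (current s) - int (Suc d))"
      by (rule mult_left_mono) simp
    then show ?thesis using len True by (simp add: algebra_simps)
  next
    case False
    have "int (layer v) + 1 - int (Suc b)
        \<le> int \<alpha> * (2 * int (later (Suc b)) - int (current (Suc b))) - (int \<alpha> * int (Suc d) - 1)"
      by (rule less.hyps) (use False b(1) less.prems in auto)
    then have "int (layer v) + 1 - int s \<le> int \<alpha> * (N - int (Suc d)) + 1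
        + (int \<alpha> * (2 * int (later (Suc b)) - int (current (Suc b))) - (int \<alpha> * int (Suc d) - 1))"
      using len by simp
    also have "\<dots> = int \<alpha> * (N + 2 * int (later (Suc b)) - int (current (Suc b)) - int (Suc d))
        + 1 - (int \<alpha> * int (Suc d) - 1)" by (simp add: algebra_simps)
    \<comment> \<open>The two inequalities of the greedy facet are added. Of the subtracted
      \<open>Suc d\<close> only 1 is kept; times \<alpha> it pays for the edge between consecutive
      blocks of layers.\<close>
    also have "int \<alpha> * (N + 2 * int (later (Suc b)) - int (current (Suc b)) - int (Suc d))
        \<le> int \<alpha> * (2 * int (later s) - int (current s) - 1)"
      by (rule mult_left_mono) (use b(5,6) in \<open>auto simp: N_def\<close>)
    finally show ?thesis using \<alpha> by (simp add: algebra_simps)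
  qed
qed

text \<open>The first block is treated separately, because at least \<open>Suc d\<close> facets
  contain \<open>u\<close> and are counted only once. If this block already contains the layer of
  \<open>v\<close>, the first entry of the maximum applies.\<close>

lemma layer_bound:
  assumes v: "v \<in> vertices P" and n: "card {G. G facet_of P} \<le> Suc d + m"
  shows "layer v \<le> max (\<alpha> * m) (2 * \<alpha> * m + 1 - \<alpha> * Suc d)"
proof -
  obtain F b where b: "0 \<le> b" "b \<le> 0 + \<alpha> * (card (neighbours F 0) - Suc d)"
    "Suc d \<le> card (neighbours F 0)" "card (neighbours F 0) \<le> later 0"
    "card (neighbours F 0) + later (Suc b) \<le> later 0 + current (Suc b)"
    "current 0 + later (Suc b) \<le> later 0"
    using greedy_facet[OF v le0] by blast
  have later0: "later 0 \<le> Suc d + m"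
  proof -
    have "later 0 \<le> card {G. G facet_of P}"
      unfolding later_def by (rule card_mono[OF finite_facets_P]) (auto simp: active_def)
    then show ?thesis using n by simp
  qed
  have current0: "Suc d \<le> current 0"
  proof -
    have "Suc d \<le> card {G. G facet_of P \<and> u \<in> G}"
      by (rule card_facets_at_vertex[OF P dim _ u]) simp
    also have "\<dots> \<le> current 0"
      unfolding current_def by (rule card_mono[OF finite_active(2)]) (use u in \<open>auto simp: active_def intro!: bexI[of _ u]\<close>)
    finally show ?thesis .
  qed
  show ?thesis
  proof (cases "layer v \<le> b")
    case True
    have "\<alpha> * (card (neighbours F 0) - Suc d) \<le> \<alpha> * m"
      using b(4) later0 by (intro mult_le_mono2) simp
    then have "layer v \<le> \<alpha> * m" using True b(2) by linarith
    then show ?thesis by (rule max.coboundedI1)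
  next
    case False
    define N where "N = int (card (neighbours F 0))"
    have "int b \<le> int \<alpha> * int (card (neighbours F 0) - Suc d)" using b(2) by (simp only: of_nat_mult[symmetric] of_nat_le_iff add_0)
    then have len: "int b + 1 \<le> int \<alpha> * (N - int (Suc d)) + 1"
      using b(3) by (simp add: N_def of_nat_diff)
    have "int (layer v) + 1 - int (Suc b)
        \<le> int \<alpha> * (2 * int (later (Suc b)) - int (current (Suc b))) - (int \<alpha> * int (Suc d) - 1)"
      by (rule layers_remaining_le[OF v]) (use False in simp)
    then have "int (layer v) + 1 \<le> int \<alpha> * (N - int (Suc d)) + 1
        + (int \<alpha> * (2 * int (later (Suc b)) - int (current (Suc b))) - (int \<alpha> * int (Suc d) - 1))"
      using len by simp
    also have "\<dots> = int \<alpha> * (N + 2 * int (later (Suc b)) - int (current (Suc b)) - 2 * int (Suc d)) + 2"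
      by (simp add: algebra_simps)
    also have "int \<alpha> * (N + 2 * int (later (Suc b)) - int (current (Suc b)) - 2 * int (Suc d))
        \<le> int \<alpha> * (2 * int m - int (Suc d))"
      by (rule mult_left_mono) (use b(5,6) later0 current0 in \<open>auto simp: N_def\<close>)
    finally have "int (layer v) \<le> int (2 * \<alpha> * m + 1) - int (\<alpha> * Suc d)" by (simp add: algebra_simps)
    then show ?thesis by linarith
  qed
qed

end

lemma diam_bound_Larman:
  assumes "d \<ge> 1" "\<alpha> \<ge> 1" and bound: "\<And>m. diam_bound TYPE('a::euclidean_space) d m (\<alpha> * m)"
  shows "diam_bound TYPE('a) (Suc d) m (max (\<alpha> * m) (2 * \<alpha> * m + 1 - \<alpha> * Suc d))"
  unfolding diam_bound_def diam_le_def
proof (intro allI impI ballI)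
  fix P :: "'a set" and u v
  assume asm: "polyhedron P \<and> aff_dim P = int (Suc d) \<and> card {G. G facet_of P} \<le> Suc d + m"
    and u: "u \<in> vertices P" and v: "v \<in> vertices P"
  obtain k where "diam_bound TYPE('a) (Suc d) m k" using diam_bound_exists[of "Suc d" m] by auto
  then have "diam_le P k" by (rule diam_boundD) (use asm in auto)
  then have conn: "\<exists>j. (adjacent P ^^ j) u w" if "w \<in> vertices P" for w
    using u that unfolding diam_le_def by blast
  interpret layered_polyhedron P u d \<alpha>
    using asm u assms conn by unfold_locales simp_all
  have "layer v \<le> max (\<alpha> * m) (2 * \<alpha> * m + 1 - \<alpha> * Suc d)" by (rule layer_bound[OF v]) (use asm in auto)
  then show "\<exists>j\<le>max (\<alpha> * m) (2 * \<alpha> * m + 1 - \<alpha> * Suc d). (adjacent P ^^ j) u v"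
    using layer_path[OF v] by blast
qed

lemma diam_bound_linear:
  assumes "d \<ge> 2" shows "diam_bound TYPE('a::euclidean_space) d m (2 ^ (d - 2) * m)"
  using assms
proof (induction d arbitrary: m rule: dec_induct)
  case base
  then show ?case using diam_bound_2 by simp
next
  case (step d)
  have pos: "(2::nat) ^ (d - 2) * Suc d \<ge> 1" by (simp add: Suc_le_eq del: mult_Suc_right)
  have eq: "(2::nat) ^ (Suc d - 2) = 2 * 2 ^ (d - 2)"
  proof -
    have "Suc d - 2 = Suc (d - 2)" using step(1) by simp
    then show ?thesis by (simp only: power_Suc)
  qed
  have "diam_bound TYPE('a) (Suc d) m (max (2 ^ (d - 2) * m) (2 * 2 ^ (d - 2) * m + 1 - 2 ^ (d - 2) * Suc d))"
    by (rule diam_bound_Larman) (use step in auto)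
  moreover have "max (a * m) (2 * a * m + 1 - a * Suc d) \<le> 2 * a * m" if "a * Suc d \<ge> 1" for a :: nat
    using that by (simp add: mult.assoc)
  ultimately show ?case
    unfolding eq using diam_bound_mono pos by blast
qed

text \<open>Keeps the subtracted term that \<open>diam_bound_linear\<close> gives away; the tables
  use it beyond \<open>T\<close>. For \<open>m \<ge> d\<close> the second entry of the maximum is
  the larger one.\<close>

lemma diam_bound_linear':
  assumes "d \<ge> 3" "m \<ge> d"
  shows "diam_bound TYPE('a::euclidean_space) d m (2 ^ (d - 2) * m + 1 - 2 ^ (d - 3) * d)"
proof -
  obtain e where e: "d = Suc e" "e \<ge> 2" using assms(1) by (cases d) auto
  have eq: "(2::nat) ^ (d - 2) = 2 * 2 ^ (e - 2)"
  proof -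
    have "d - 2 = Suc (e - 2)" using e by simp
    then show ?thesis by (simp only: power_Suc)
  qed
  have "diam_bound TYPE('a) (Suc e) m (max (2 ^ (e - 2) * m) (2 * 2 ^ (e - 2) * m + 1 - 2 ^ (e - 2) * Suc e))"
    by (rule diam_bound_Larman) (use e diam_bound_linear in auto)
  moreover have "2 ^ (e - 2) * m \<le> 2 * 2 ^ (e - 2) * m + 1 - 2 ^ (e - 2) * Suc e"
  proof -
    have "2 ^ (e - 2) * Suc e \<le> 2 ^ (e - 2) * m" using assms(2) e(1) by (intro mult_le_mono2) simp
    then show ?thesis by simp
  qed
  ultimately have "diam_bound TYPE('a) (Suc e) m (2 * 2 ^ (e - 2) * m + 1 - 2 ^ (e - 2) * Suc e)"
    by (simp only: max_absorb2)
  moreover have "d - 3 = e - 2" using e by simp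
  ultimately show ?thesis using eq e(1) by simp
qed

section \<open>Piecewise linear upper bounds\<close>

text \<open>Linear interpolation between the given nodes, constant to the left of the first and to the right of the
  last one.\<close>

fun pl :: "(int \<times> int) list \<Rightarrow> real \<Rightarrow> real" where
  "pl [] t = 0"
| "pl [(x, v)] t = v"
| "pl ((x, v) # (y, w) # r) t =
    (if t \<le> x then v else if t \<le> y then v + (w - v) * ((t - x) / (y - x)) else pl ((y, w) # r) t)"

abbreviation nodes_sorted :: "(int \<times> int) list \<Rightarrow> bool" where
  "nodes_sorted A \<equiv> sorted_wrt (<) (map fst A)"

lemma pl_skip:
  assumes "x < y" "real_of_int y \<le> t"
  shows "pl ((x, v) # (y, w) # r) t = pl ((y, w) # r) t"
proof (cases "t = y")
  case True
  then have "pl ((y, w) # r) t = w" by (cases r) auto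
  then show ?thesis using True assms by simp
qed (use assms in auto)

lemma pl_segment:
  assumes "real_of_int x \<le> t" "t \<le> y" "x < y"
  shows "pl ((x, v) # (y, w) # r) t = v + (w - v) * ((t - x) / (y - x))"
  using assms by (cases "t = x") auto

lemma pl_affine:
  assumes "nodes_sorted A" "\<And>x v. (x, v) \<in> set A \<Longrightarrow> real_of_int x \<le> a \<or> b \<le> real_of_int x"
  shows "\<exists>p q. \<forall>t. a \<le> t \<longrightarrow> t \<le> b \<longrightarrow> pl A t = p + q * t"
  using assms
proof (induction A)
  case Nil
  show ?case by (rule exI[of _ 0], rule exI[of _ 0]) simp
next
  case (Cons n A)
  obtain x v where n: "n = (x, v)" by (cases n)
  show ?case
  proof (cases A)
    case Nil
    show ?thesis unfolding n Nil by (rule exI[of _ "real_of_int v"], rule exI[of _ 0]) simp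
  next
    case (Cons n' r)
    obtain y w where n': "n' = (y, w)" by (cases n')
    have xy: "x < y" using Cons.prems(1) n n' Cons by simp
    consider "b \<le> x" | "real_of_int y \<le> a" | "real_of_int x \<le> a" "b \<le> y"
      using Cons.prems(2)[of x v] Cons.prems(2)[of y w] n n' Cons by auto
    then show ?thesis
    proof cases
      case 1
      have "pl (n # A) t = real_of_int v + 0 * t" if "t \<le> b" for t :: real
        using that 1 unfolding n n' Cons by simp
      then show ?thesis by blast
    next
      case 2
      obtain p q where pq: "\<And>t. a \<le> t \<Longrightarrow> t \<le> b \<Longrightarrow> pl A t = p + q * t"
        using Cons.IH Cons.prems by auto
      have "pl (n # A) t = p + q * t" if "a \<le> t" "t \<le> b" for t
        using pq[OF that] pl_skip[OF xy, of t v w r] 2 that(1) unfolding n n' Cons by simp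
      then show ?thesis by blast
    next
      case 3
      let ?s = "(real_of_int w - v) / (y - x)"
      have "pl (n # A) t = (v - ?s * x) + ?s * t" if "a \<le> t" "t \<le> b" for t :: real
      proof -
        have "pl (n # A) t = v + (w - v) * ((t - x) / (y - x))"
          unfolding n n' Cons using pl_segment[of x t y v w r] 3 that xy by simp
        also have "\<dots> = v + ?s * (t - x)" by simp
        finally show ?thesis by (simp add: right_diff_distrib)
      qed
      then show ?thesis by blast
    qed
  qed
qed

lemma pl_node:
  assumes "nodes_sorted A" "(x, v) \<in> set A"
  shows "pl A x = v"
  using assms
proof (induction A)
  case (Cons n A)
  obtain y w where n: "n = (y, w)" by (cases n)
  show ?case
  proof (cases A)
    case Nil then show ?thesis using Cons.prems n by simp
  next
    case (Cons n' r)
    obtain z u where n': "n' = (z, u)" by (cases n')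
    have yz: "y < z" using Cons.prems(1) n n' Cons by simp
    show ?thesis
    proof (cases "(x, v) = (y, w)")
      case True then show ?thesis unfolding n n' Cons by simp
    next
      case False
      then have xA: "(x, v) \<in> set A" using Cons.prems(2) n by auto
      then have "z \<le> x" using Cons.prems(1) n n' Cons by force
      then show ?thesis
        using pl_skip[OF yz, of x w u r] Cons.IH xA Cons.prems(1) unfolding n n' Cons by simp
    qed
  qed
qed simp

lemma pl_nonneg:
  assumes "nodes_sorted A" "\<And>x v. (x, v) \<in> set A \<Longrightarrow> 0 \<le> v"
  shows "0 \<le> pl A t"
  using assms
proof (induction A t rule: pl.induct)
  case (3 x v y w r t)
  have v: "v \<ge> 0" "w \<ge> 0" using 3(3) by auto
  have xy: "x < y" using 3(2) by simp
  consider "t \<le> x" | "x < t" "t \<le> y" | "t > y" by linarith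
  then show ?case
  proof cases
    case 2
    define s where "s = (t - x) / (y - x)"
    have s: "0 \<le> s" "s \<le> 1" using 2 xy by (auto simp: s_def divide_simps)
    have "0 \<le> (1 - s) * v + s * w" using s v by simp
    also have "\<dots> = v + (w - v) * s" by (simp add: algebra_simps)
    finally show ?thesis using 2 by (simp add: s_def)
  next
    case 3
    then show ?thesis using "3.IH" "3.prems" xy by auto
  qed (use v in simp)
qed (auto)

lemma pl_uminus: "pl (map (apsnd uminus) A) t = - pl A t"
  by (induction A t rule: pl.induct) (auto simp: algebra_simps diff_divide_distrib)

text \<open>Turns the halved arguments of the recursion, with \<open>c\<close> the dimension plus 1,
  into a list of integer nodes again.\<close>

lemma pl_rescale:
  "pl (map (\<lambda>(x, v). (2 * x + c, 2 * v)) A) t = 2 * pl A ((t - c) / 2)"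
proof (induction A "(t - c) / 2" rule: pl.induct)
  case (3 x v y w r)
  have ratio: "(t - (2 * real_of_int x + real_of_int c)) / (2 * real_of_int y - 2 * real_of_int x)
      = ((t - c) / 2 - x) / (real_of_int y - real_of_int x)"
    by (cases "real_of_int y = real_of_int x") (simp_all add: divide_simps)
  consider "(t - c) / 2 \<le> x" | "x < (t - c) / 2" "(t - c) / 2 \<le> y" | "x < (t - c) / 2" "y < (t - c) / 2"
    by linarith
  then show ?case
  proof cases
    case 1
    then have "t \<le> 2 * real_of_int x + real_of_int c" by simp
    then show ?thesis using 1 by simp
  next
    case 2
    have t: "\<not> t \<le> 2 * real_of_int x + real_of_int c" "t \<le> 2 * real_of_int y + real_of_int c" using 2 by auto
    have "pl (map (\<lambda>(x, v). (2 * x + c, 2 * v)) ((x, v) # (y, w) # r)) t =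
      2 * v + (2 * w - 2 * v) * ((t - (2 * real_of_int x + real_of_int c)) / (2 * real_of_int y - 2 * real_of_int x))"
      using t by simp
    also have "\<dots> = 2 * (v + (w - v) * (((t - c) / 2 - x) / (real_of_int y - real_of_int x)))"
      unfolding ratio by (simp only: of_int_diff of_int_mult of_int_numeral) (simp only: distrib_left left_diff_distrib right_diff_distrib mult.assoc)
    also have "\<dots> = 2 * pl ((x, v) # (y, w) # r) ((t - c) / 2)" using 2 by simp
    finally show ?thesis .
  next
    case 3
    have t: "\<not> t \<le> 2 * real_of_int x + real_of_int c" "\<not> t \<le> 2 * real_of_int y + real_of_int c" using 3 by auto
    then show ?thesis using 3 "3.hyps" by simp
  qed
qed auto

lemma pl_diff:
  assumes "length vs = length xs" "length ws = length xs"
  shows "pl (zip xs (map2 (-) vs ws)) t = pl (zip xs vs) t - pl (zip xs ws) t"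
  using assms
proof (induction xs arbitrary: vs ws)
  case (Cons x xs)
  obtain v vs' w ws' where eq: "vs = v # vs'" "ws = w # ws'"
    using Cons.prems by (cases vs; cases ws) auto
  have IH: "pl (zip xs (map2 (-) vs' ws')) t = pl (zip xs vs') t - pl (zip xs ws') t"
    using Cons.IH[of vs' ws'] Cons.prems eq by simp
  show ?case
  proof (cases xs)
    case Nil then show ?thesis by (simp add: eq)
  next
    case (Cons y ys)
    obtain v1 vs1 w1 ws1 where eq': "vs' = v1 # vs1" "ws' = w1 # ws1"
      using Cons.prems eq \<open>xs = y # ys\<close> by (cases vs'; cases ws') auto
    define s where "s = (t - real_of_int x) / real_of_int (y - x)"
    have *: "pl ((x, a) # (y, b) # r) t =
        (if t \<le> x then a else if t \<le> y then a + real_of_int (b - a) * s else pl ((y, b) # r) t)" for a b r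
      by (simp add: s_def)
    show ?thesis using IH
      unfolding eq eq' Cons zip_Cons_Cons list.map case_prod_conv *
      by (auto simp: algebra_simps)
  qed
qed simp

lemma bracket:
  fixes S :: "int set"
  assumes "finite S" "l \<in> S" "h \<in> S" "real_of_int l \<le> t" "t \<le> real_of_int h"
  obtains a b where "a \<in> S" "b \<in> S" "real_of_int a \<le> t" "t \<le> real_of_int b"
    "\<And>x. x \<in> S \<Longrightarrow> x \<le> a \<or> b \<le> x"
proof -
  let ?L = "{x \<in> S. real_of_int x \<le> t}" and ?H = "{x \<in> S. t \<le> real_of_int x}"
  have fin: "finite ?L" "finite ?H" using assms(1) by auto
  have ne: "?L \<noteq> {}" "?H \<noteq> {}" using assms by auto
  have a: "Max ?L \<in> ?L" using Max_in[OF fin(1) ne(1)] .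
  have b: "Min ?H \<in> ?H" using Min_in[OF fin(2) ne(2)] .
  have "x \<le> Max ?L \<or> Min ?H \<le> x" if "x \<in> S" for x
    using Max_ge[OF fin(1), of x] Min_le[OF fin(2), of x] that by (cases "real_of_int x \<le> t") auto
  then show ?thesis using that[of "Max ?L" "Min ?H"] a b by auto
qed

lemma affine_nonneg_between:
  fixes p q :: real
  assumes "a \<le> t" "t \<le> b" "0 \<le> p + q * a" "0 \<le> p + q * b"
  shows "0 \<le> p + q * t"
proof (cases "q \<ge> 0")
  case True
  then have "q * a \<le> q * t" using assms(1) by (rule mult_left_mono[rotated])
  then show ?thesis using assms(3) by linarith
next
  case False
  then have "q * b \<le> q * t" using assms(2) by (intro mult_left_mono_neg) auto
  then show ?thesis using assms(4) by linarith
qed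

text \<open>Between consecutive nodes of the union of both lists both functions are affine, so the
  comparison at the nodes carries over.\<close>

lemma pl_le_pl:
  assumes B: "nodes_sorted B" and C: "nodes_sorted C"
    and CB: "\<And>x c. (x, c) \<in> set C \<Longrightarrow> x \<le> T \<Longrightarrow> pl B (real_of_int x) \<le> real_of_int c"
    and BC: "\<And>y w. (y, w) \<in> set B \<Longrightarrow> y \<le> T \<Longrightarrow> real_of_int w \<le> pl C (real_of_int y)"
    and l: "l \<in> fst ` set C" "real_of_int l \<le> t" and h: "T \<in> fst ` set C" "t \<le> real_of_int T"
  shows "pl B t \<le> pl C t"
proof -
  let ?S = "{x \<in> fst ` (set B \<union> set C). x \<le> T}"
  have lT: "l \<le> T" using l(2) h(2) by linarith
  obtain a b where ab: "a \<in> ?S" "b \<in> ?S" "real_of_int a \<le> t" "t \<le> real_of_int b"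
    "\<And>x. x \<in> ?S \<Longrightarrow> x \<le> a \<or> b \<le> x"
    by (rule bracket[of ?S l T t]) (use l h lT in auto)
  have gap: "x \<le> a \<or> b \<le> x" if "x \<in> fst ` (set B \<union> set C)" for x
    using ab(2,5) that by (cases "x \<le> T") auto
  have gapB: "real_of_int x \<le> real_of_int a \<or> real_of_int b \<le> real_of_int x" if "(x, v) \<in> set B" for x v
    using gap[of x] that by force
  have gapC: "real_of_int x \<le> real_of_int a \<or> real_of_int b \<le> real_of_int x" if "(x, v) \<in> set C" for x v
    using gap[of x] that by force
  obtain p q where pq: "\<And>t. real_of_int a \<le> t \<Longrightarrow> t \<le> b \<Longrightarrow> pl B t = p + q * t"
    using pl_affine[OF B, of "real_of_int a" "real_of_int b"] gapB by blast
  obtain p' q' where pq': "\<And>t. real_of_int a \<le> t \<Longrightarrow> t \<le> b \<Longrightarrow> pl C t = p' + q' * t"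
    using pl_affine[OF C, of "real_of_int a" "real_of_int b"] gapC by blast
  have node: "pl B x \<le> pl C x" if x: "x \<in> ?S" for x
  proof -
    consider v where "(x, v) \<in> set B" | v where "(x, v) \<in> set C" using x by auto
    then show ?thesis
    proof cases
      case 1 then show ?thesis using BC[OF 1] pl_node[OF B 1] x by simp
    next
      case 2 then show ?thesis using CB[OF 2] pl_node[OF C 2] x by simp
    qed
  qed
  have "0 \<le> (p' - p) + (q' - q) * t"
  proof (rule affine_nonneg_between[OF ab(3,4)])
    have "real_of_int a \<le> b" using ab(3,4) by linarith
    then show "0 \<le> (p' - p) + (q' - q) * real_of_int a" "0 \<le> (p' - p) + (q' - q) * real_of_int b"
      using node[OF ab(1)] node[OF ab(2)] pq[of a] pq[of b] pq'[of a] pq'[of b]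
      by (simp_all add: algebra_simps)
  qed
  then show ?thesis using pq[OF ab(3,4)] pq'[OF ab(3,4)] by (simp add: algebra_simps)
qed

lemma line_le_pl:
  fixes \<alpha> \<beta> :: real
  assumes A: "nodes_sorted A" and line: "\<And>x v. (x, v) \<in> set A \<Longrightarrow> l \<le> x \<Longrightarrow> \<alpha> * x + \<beta> \<le> v"
    and l: "l \<in> fst ` set A" "real_of_int l \<le> t" and h: "h \<in> fst ` set A" "t \<le> real_of_int h"
  shows "\<alpha> * t + \<beta> \<le> pl A t"
proof -
  let ?S = "fst ` set A"
  obtain a b where ab: "a \<in> ?S" "b \<in> ?S" "real_of_int a \<le> t" "t \<le> real_of_int b"
    "\<And>x. x \<in> ?S \<Longrightarrow> x \<le> a \<or> b \<le> x"
    by (rule bracket[of ?S l h t]) (use l h in auto)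
  have gap: "real_of_int x \<le> real_of_int a \<or> real_of_int b \<le> real_of_int x" if "(x, v) \<in> set A" for x v
    using ab(5)[of x] that by force
  obtain p q where pq: "\<And>t. real_of_int a \<le> t \<Longrightarrow> t \<le> b \<Longrightarrow> pl A t = p + q * t"
    using pl_affine[OF A, of "real_of_int a" "real_of_int b"] gap by blast
  show ?thesis
  proof (cases "l \<le> a")
    case True
    have "l \<le> b" using True ab(3,4) by linarith
    obtain v w where vw: "(a, v) \<in> set A" "(b, w) \<in> set A" using ab(1,2) by auto
    have "real_of_int a \<le> b" using ab(3,4) by linarith
    then have "0 \<le> (p - \<beta>) + (q - \<alpha>) * real_of_int a" "0 \<le> (p - \<beta>) + (q - \<alpha>) * real_of_int b"
      using line[OF vw(1) True] line[OF vw(2) \<open>l \<le> b\<close>] pl_node[OF A vw(1)] pl_node[OF A vw(2)] pq[of a] pq[of b]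
      by (simp_all add: algebra_simps)
    then have "0 \<le> (p - \<beta>) + (q - \<alpha>) * t" by (rule affine_nonneg_between[OF ab(3,4)])
    then show ?thesis using pq[OF ab(3,4)] by (simp add: algebra_simps)
  next
    case False
    then have "b \<le> l" using ab(5)[OF l(1)] by simp
    then have tl: "t = real_of_int l" using ab(4) l(2) by linarith
    obtain v where "(l, v) \<in> set A" using l(1) by auto
    then show ?thesis using line[of l v] pl_node[OF A, of l v] tl by simp
  qed
qed

text \<open>A merge of the two sorted lists that decides whether \<open>pl A\<close> lies below the
  points of the second list. Cross-multiplication keeps it in integer arithmetic, fit for
  evaluation.\<close>

fun above :: "(int \<times> int) list \<Rightarrow> (int \<times> int) list \<Rightarrow> bool" where
  "above A [] = True"
| "above [] (q # qs) = False"
| "above [(a, p)] ((y, w) # qs) = (p \<le> w \<and> above [(a, p)] qs)"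
| "above ((a, p) # (b, q) # r) ((y, w) # qs) =
    (if b < y then above ((b, q) # r) ((y, w) # qs)
     else (if y \<le> a then p \<le> w else (q - p) * (y - a) \<le> (w - p) * (b - a)) \<and>
       above ((a, p) # (b, q) # r) qs)"

lemma above_sound:
  assumes "above A Q" "nodes_sorted A" "nodes_sorted Q" "(y, w) \<in> set Q"
  shows "pl A y \<le> w"
  using assms
proof (induction A Q rule: above.induct)
  case (4 a p b q r y' w' qs)
  have ab: "a < b" using "4.prems"(2) by simp
  show ?case
  proof (cases "b < y'")
    case True
    have "y' \<le> y" using "4.prems"(3,4) by force
    then have "pl ((a, p) # (b, q) # r) y = pl ((b, q) # r) y"
      using True by (intro pl_skip[OF ab]) simp
    moreover have "pl ((b, q) # r) y \<le> w"
      using "4.IH"(1)[OF True] True "4.prems" by auto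
    ultimately show ?thesis by simp
  next
    case False
    show ?thesis
    proof (cases "(y, w) = (y', w')")
      case True
      show ?thesis
      proof (cases "y' \<le> a")
        case True
        then show ?thesis using \<open>(y, w) = (y', w')\<close> "4.prems"(1) False by simp
      next
        case ya: False
        have "(q - p) * (y - a) \<le> (w - p) * (b - a)" using "4.prems"(1) False ya True by simp
        then have "real_of_int ((q - p) * (y - a)) \<le> real_of_int ((w - p) * (b - a))" by (simp only: of_int_le_iff)
        then have "real_of_int (q - p) * (real_of_int (y - a) / real_of_int (b - a)) \<le> real_of_int (w - p)"
          using ab by (simp add: divide_simps)
        then show ?thesis using ya False True by simp
      qed
    next
      case ne: False
      then have "(y, w) \<in> set qs" using "4.prems"(4) by auto
      then show ?thesis using "4.IH"(2)[OF False] "4.prems" False by auto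
    qed
  qed
qed auto

text \<open>\<open>vs'\<close> and \<open>vs\<close> are the values of the bounds in dimensions \<open>d - 1\<close> and \<open>d = e + 3\<close>. Up to \<open>T\<close> the increment
  \<open>C\<close> has to absorb \<open>2 L ((t - d - 1) / 2)\<close>, where \<open>L\<close> interpolates \<open>vs\<close>; this function is \<open>B\<close>. Both sides being
  piecewise linear, it is enough to compare them at all nodes. Beyond \<open>T\<close> the linear bound takes over.\<close>

definition step_ok :: "int \<Rightarrow> nat \<Rightarrow> int list \<Rightarrow> int list \<Rightarrow> int list \<Rightarrow> int \<Rightarrow> bool" where
  "step_ok d e xs vs' vs T =
    (let A = zip xs vs;
         B = map (\<lambda>(x, v). (2 * x + (d + 1), 2 * v)) A;
         C = zip xs (map2 (-) vs vs')
     in length vs = length xs \<and> list_all (\<lambda>v. 0 \<le> v) vs \<and> T \<in> set xs \<and> (T = last xs \<or> d \<le> T)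
        \<and> above B (filter (\<lambda>p. fst p \<le> T) C)
        \<and> above (map (apsnd uminus) C) (map (apsnd uminus) (filter (\<lambda>p. fst p \<le> T) B))
        \<and> (T = last xs \<or> list_all (\<lambda>(x, v). T \<le> x \<longrightarrow> 2 ^ (e + 1) * x + (2 - 2 ^ e * d) \<le> v) A))"

fun steps_ok :: "int \<Rightarrow> nat \<Rightarrow> int list \<Rightarrow> int list \<Rightarrow> (int \<times> int list) list \<Rightarrow> bool" where
  "steps_ok d e xs vs' [] = True"
| "steps_ok d e xs vs' ((T, vs) # r) = (step_ok d e xs vs' vs T \<and> steps_ok (d + 1) (Suc e) xs vs r)"

text \<open>The interface between geometry and arithmetic: all that the numerical part uses about
  polyhedra.\<close>

locale diameter_recursion =
  fixes D :: "nat \<Rightarrow> nat \<Rightarrow> nat"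
  assumes low: "\<And>d m. d \<ge> 1 \<Longrightarrow> m \<le> d \<Longrightarrow> D (Suc d) m \<le> D d m"
    and split_eq: "\<And>d. d \<ge> 1 \<Longrightarrow> D (Suc d) (Suc d) \<le> D d (Suc d) + D (Suc d) 0 + 1"
    and split: "\<And>d m. d \<ge> 1 \<Longrightarrow> Suc d < m \<Longrightarrow>
      D (Suc d) m \<le> D d m + D (Suc d) ((m - Suc d) div 2) + D (Suc d) ((m - Suc d - 1) div 2) + 2"
    and linear: "\<And>d m. d \<ge> 2 \<Longrightarrow> D d m \<le> 2 ^ (d - 2) * m"
    and linear': "\<And>d m. d \<ge> 3 \<Longrightarrow> d \<le> m \<Longrightarrow> D d m \<le> 2 ^ (d - 2) * m + 1 - 2 ^ (d - 3) * d"
    and D1: "\<And>m. D 1 m \<le> 1" and D10: "D 1 0 = 0"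
begin

text \<open>One more than \<open>D\<close>, and \<open>0\<close> for negative arguments: so normalised, the recursion is homogeneous and covers
  \<open>m < d\<close> and \<open>m = d\<close> as well.\<close>

definition E :: "nat \<Rightarrow> int \<Rightarrow> real" where
  "E d x = (if x < 0 then 0 else real (D d (nat x)) + 1)"

lemma E_rec:
  assumes "d \<ge> 1" "m \<ge> 0"
  shows "E (Suc d) m \<le> E d m + E (Suc d) ((m - int (Suc d)) div 2) + E (Suc d) ((m - int (Suc d) - 1) div 2)"
proof -
  consider "nat m \<le> d" | "nat m = Suc d" | "Suc d < nat m" by linarith
  then show ?thesis
  proof cases
    case 1
    have "E d x \<ge> 0" for d x by (simp add: E_def)
    moreover have "E (Suc d) m \<le> E d m" using low[OF assms(1) 1] assms(2) by (simp add: E_def)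
    ultimately show ?thesis by (meson add_increasing2 order.trans)
  next
    case 2
    then have m: "m = int (Suc d)" using assms(2) by linarith
    have "E (Suc d) 0 = real (D (Suc d) 0) + 1" "E (Suc d) (-1) = 0" by (simp_all add: E_def)
    moreover have "real (D (Suc d) (Suc d)) \<le> real (D d (Suc d) + D (Suc d) 0 + 1)"
      using split_eq[OF assms(1)] by (simp only: of_nat_le_iff)
    moreover have "E (Suc d) m = real (D (Suc d) (Suc d)) + 1" "E d m = real (D d (Suc d)) + 1"
      unfolding m by (simp_all add: E_def nat_add_distrib)
    moreover have "(m - int (Suc d)) div 2 = 0" "(m - int (Suc d) - 1) div 2 = -1" unfolding m by simp_all
    ultimately show ?thesis by simp
  next
    case 3
    have e1: "nat ((m - int (Suc d)) div 2) = (nat m - Suc d) div 2"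
      and e2: "nat ((m - int (Suc d) - 1) div 2) = (nat m - Suc d - 1) div 2"
      using 3 by (simp_all add: nat_div_distrib nat_diff_distrib')
    have p: "(m - int (Suc d)) div 2 \<ge> 0" "(m - int (Suc d) - 1) div 2 \<ge> 0" using 3 by auto
    have "real (D (Suc d) (nat m)) \<le> real (D d (nat m) + D (Suc d) ((nat m - Suc d) div 2)
        + D (Suc d) ((nat m - Suc d - 1) div 2) + 2)"
      using split[OF assms(1) 3] by (simp only: of_nat_le_iff)
    then show ?thesis using p assms(2) unfolding E_def e1 e2 by simp
  qed
qed

lemma E_linear:
  assumes "d \<ge> 3" "int d \<le> m"
  shows "E d m \<le> 2 ^ (d - 2) * real_of_int m + (2 - 2 ^ (d - 3) * real d)"
proof -
  obtain k where k: "d = k + 3" using assms(1) by (metis add.commute le_Suc_ex)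
  have m: "d \<le> nat m" using assms(2) by simp
  have "(2::nat) ^ (d - 3) * d \<le> 2 ^ (d - 2) * nat m"
    using m k by (intro mult_le_mono) auto
  then have "2 ^ (d - 3) * d \<le> 2 ^ (d - 2) * nat m + 1" by simp
  moreover have "real (D d (nat m)) \<le> real (2 ^ (d - 2) * nat m + 1 - 2 ^ (d - 3) * d)"
    using linear'[OF assms(1) m] by (simp only: of_nat_le_iff)
  ultimately have "real (D d (nat m)) \<le> real (2 ^ (d - 2) * nat m + 1) - real (2 ^ (d - 3) * d)"
    by (simp only: of_nat_diff)
  then show ?thesis using assms by (simp add: E_def)
qed

definition table_row :: "nat \<Rightarrow> int list \<Rightarrow> int list \<Rightarrow> bool" where
  "table_row d xs vs \<longleftrightarrow> length vs = length xs \<and> (\<forall>m. m \<le> last xs \<longrightarrow> E d m \<le> pl (zip xs vs) m)"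

text \<open>Dimension \<open>Suc d\<close> occurs on both sides of the recursion, hence the
  induction on \<open>m\<close>. The two smaller arguments are consecutive or equal with mean
  \<open>(m - (Suc d + 1)) / 2\<close>, so their contribution is at most \<open>pl B m\<close>, and
  \<open>step_ok\<close> gives \<open>pl B \<le> pl C\<close> up to \<open>T\<close>.\<close>

lemma table_row_step:
  assumes ok: "step_ok (int (Suc d)) (d - 2) xs vs' vs T" and row: "table_row d xs vs'"
    and xs: "sorted_wrt (<) xs" "xs \<noteq> []" "hd xs = -1" and d: "d \<ge> 2"
  shows "table_row (Suc d) xs vs"
proof -
  define A where "A = zip xs vs"
  define B where "B = map (\<lambda>(x, v). (2 * x + (int (Suc d) + 1), 2 * v)) A"
  define C where "C = zip xs (map2 (-) vs vs')"
  have ok': "length vs = length xs" "\<And>v. v \<in> set vs \<Longrightarrow> 0 \<le> v" "T \<in> set xs" "T = last xs \<or> int (Suc d) \<le> T"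
    "above B (filter (\<lambda>p. fst p \<le> T) C)"
    "above (map (apsnd uminus) C) (map (apsnd uminus) (filter (\<lambda>p. fst p \<le> T) B))"
    "T = last xs \<or> (\<forall>(x, v) \<in> set A. T \<le> x \<longrightarrow> 2 ^ (d - 2 + 1) * x + (2 - 2 ^ (d - 2) * int (Suc d)) \<le> v)"
    using ok unfolding step_ok_def Let_def A_def[symmetric] B_def[symmetric] C_def[symmetric]
    by (auto simp: list_all_iff)
  have len: "length vs' = length xs" using row by (simp add: table_row_def)
  have fstA: "map fst A = xs" using ok'(1) by (simp add: A_def)
  have fstC: "map fst C = xs" using ok'(1) len by (simp add: C_def)
  have sA: "nodes_sorted A" and sC: "nodes_sorted C" using xs(1) fstA fstC by simp_all
  have sB: "nodes_sorted B"
  proof -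
    have "map fst B = map (\<lambda>x. 2 * x + (int (Suc d) + 1)) (map fst A)" by (auto simp: B_def)
    then show ?thesis using sA by (simp add: sorted_wrt_map)
  qed
  have sorted_filter: "nodes_sorted (filter p L)" if "nodes_sorted L" for p L
    using that by (simp add: sorted_wrt_map sorted_wrt_filter)
  have fst_neg: "map fst (map (apsnd uminus) L) = map fst L" for L :: "(int \<times> int) list" by simp
  have CB: "pl B (real_of_int x) \<le> real_of_int c" if "(x, c) \<in> set C" "x \<le> T" for x c
    using above_sound[OF ok'(5) sB sorted_filter[OF sC]] that by simp
  have BC: "real_of_int w \<le> pl C (real_of_int y)" if "(y, w) \<in> set B" "y \<le> T" for y w
  proof -
    have "(y, - w) \<in> set (map (apsnd uminus) (filter (\<lambda>p. fst p \<le> T) B))"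
      using that by (force simp: image_iff)
    then have "pl (map (apsnd uminus) C) (real_of_int y) \<le> real_of_int (- w)"
      by (rule above_sound[OF ok'(6), rotated 2])
        (use sC sorted_filter[OF sB] in \<open>simp_all only: fst_neg\<close>)
    then show ?thesis by (simp add: pl_uminus)
  qed
  have m1: "-1 \<in> set xs" using xs(2,3) hd_in_set by metis
  have dom: "pl B t \<le> pl C t" if "-1 \<le> t" "t \<le> T" for t
  proof (rule pl_le_pl[OF sB sC CB BC])
    show "-1 \<in> fst ` set C" "T \<in> fst ` set C" using m1 ok'(3) fstC by (metis image_set)+
  qed (use that in auto)
  have Bt: "pl B t = 2 * pl A ((t - (int (Suc d) + 1)) / 2)" for t
    unfolding B_def by (rule pl_rescale)
  have Ct: "pl C t = pl A t - pl (zip xs vs') t" for t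
    unfolding C_def A_def by (rule pl_diff[OF ok'(1) len])
  have nonneg: "0 \<le> pl A t" for t
  proof (rule pl_nonneg[OF sA])
    show "0 \<le> v" if "(x, v) \<in> set A" for x v using that ok'(2) by (auto simp: A_def dest: set_zip_rightD)
  qed
  \<comment> \<open>the nodes are integers, so \<open>pl A\<close> is linear between consecutive integers\<close>
  have mean: "pl A a + pl A b \<le> 2 * pl A ((real_of_int a + real_of_int b) / 2)" if ab: "a = b \<or> a = b + 1" for a b :: int
  proof -
    have "\<exists>p q. \<forall>t. real_of_int b \<le> t \<longrightarrow> t \<le> real_of_int a \<longrightarrow> pl A t = p + q * t"
    proof (rule pl_affine[OF sA])
      fix x v :: int
      have "x \<le> b \<or> a \<le> x" using ab by linarith
      then show "real_of_int x \<le> real_of_int b \<or> real_of_int a \<le> real_of_int x" by simp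
    qed
    then obtain p q where pq: "\<And>t. real_of_int b \<le> t \<Longrightarrow> t \<le> real_of_int a \<Longrightarrow> pl A t = p + q * t" by blast
    show ?thesis using pq[of a] pq[of b] pq[of "(real_of_int a + real_of_int b) / 2"] ab
      by (auto simp: field_simps)
  qed
  have "E (Suc d) m \<le> pl A m" if "m \<le> last xs" for m
    using that
  proof (induction "nat (m + 1)" arbitrary: m rule: less_induct)
    case less
    show ?case
    proof (cases "m < 0")
      case True then show ?thesis using nonneg by (simp add: E_def)
    next
      case False
      show ?thesis
      proof (cases "m \<le> T")
        case True
        let ?a = "(m - int (Suc d)) div 2" and ?b = "(m - int (Suc d) - 1) div 2"
        have "E (Suc d) ?a \<le> pl A ?a" "E (Suc d) ?b \<le> pl A ?b"
          by (rule less.hyps; use False less.prems in linarith)+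
        moreover have "?a = ?b \<or> ?a = ?b + 1" by presburger
        then have "pl A ?a + pl A ?b \<le> 2 * pl A ((real_of_int ?a + real_of_int ?b) / 2)" by (rule mean)
        moreover have "?a + ?b = m - int (Suc d) - 1" by presburger
        then have "real_of_int ?a + real_of_int ?b = m - (int (Suc d) + 1)" by linarith
        moreover have "E d m \<le> pl (zip xs vs') m" using row less.prems by (simp add: table_row_def)
        moreover have "E (Suc d) m \<le> E d m + E (Suc d) ?a + E (Suc d) ?b"
          by (rule E_rec) (use d False in auto)
        moreover have "pl B m \<le> pl C m" by (rule dom) (use True False in auto)
        ultimately show ?thesis unfolding Bt Ct by simp
      next
        case gt: False
        then have T: "T \<noteq> last xs" using less.prems by auto
        then have dT: "int (Suc d) \<le> T" using ok'(4) by simp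
        have "E (Suc d) m \<le> 2 ^ (Suc d - 2) * real_of_int m + (2 - 2 ^ (Suc d - 3) * real (Suc d))"
          by (rule E_linear) (use d dT gt in auto)
        also have "\<dots> = 2 ^ (d - 2 + 1) * real_of_int m + (2 - 2 ^ (d - 2) * real (Suc d))"
        proof -
          have "Suc d - 2 = d - 2 + 1" "Suc d - 3 = d - 2" using d by auto
          then show ?thesis by simp
        qed
        also have "\<dots> \<le> pl A m"
        proof (rule line_le_pl[OF sA])
          show "2 ^ (d - 2 + 1) * real_of_int x + (2 - 2 ^ (d - 2) * real (Suc d)) \<le> v"
            if "(x, v) \<in> set A" "T \<le> x" for x v
          proof -
            have "2 ^ (d - 2 + 1) * x + (2 - 2 ^ (d - 2) * int (Suc d)) \<le> v" using ok'(7) T that by blast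
            then have "real_of_int (2 ^ (d - 2 + 1) * x + (2 - 2 ^ (d - 2) * int (Suc d))) \<le> real_of_int v"
              by (simp only: of_int_le_iff)
            then show ?thesis by simp
          qed
          show "T \<in> fst ` set A" "last xs \<in> fst ` set A"
            using ok'(3) xs(2) fstA by (metis image_set last_in_set)+
        qed (use gt less.prems in auto)
        finally show ?thesis .
      qed
    qed
  qed
  then show ?thesis using ok'(1) by (simp add: table_row_def A_def)
qed

lemma table_row_steps:
  assumes "steps_ok (int (Suc d)) (d - 2) xs vs' rs" "table_row d xs vs'"
    and xs: "sorted_wrt (<) xs" "xs \<noteq> []" "hd xs = -1" and d: "d \<ge> 2" and i: "i < length rs"
  shows "table_row (Suc d + i) xs (snd (rs ! i))"
  using assms
proof (induction rs arbitrary: d vs' i)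
  case (Cons p rs)
  obtain T vs where p: "p = (T, vs)" by (cases p)
  have 1: "table_row (Suc d) xs vs"
    by (rule table_row_step[where vs' = vs' and T = T]) (use Cons.prems p in auto)
  show ?case
  proof (cases i)
    case 0 then show ?thesis using 1 p by simp
  next
    case (Suc j)
    have "Suc (d - 2) = Suc d - 2" using Cons.prems(6) by simp
    then have "steps_ok (int (Suc (Suc d))) (Suc d - 2) xs vs rs" using Cons.prems(1) p by (simp add: add.commute)
    then have "table_row (Suc (Suc d) + j) xs (snd (rs ! j))"
      by (rule Cons.IH[OF _ 1]) (use Cons.prems Suc in auto)
    then show ?thesis using Suc by simp
  qed
qed simp

lemma table_row_2:
  assumes "sorted_wrt (<) xs" "xs \<noteq> []" "hd xs = -1"
  shows "table_row 2 xs (map (\<lambda>x. x + 1) xs)"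
proof -
  let ?A = "zip xs (map (\<lambda>x. x + 1) xs)"
  have fst: "map fst ?A = xs" by simp
  have s: "nodes_sorted ?A" using assms(1) by simp
  have A: "v = x + 1" if "(x, v) \<in> set ?A" for x v
    using that by (auto simp: zip_map2 set_zip)
  have "E 2 m \<le> pl ?A m" if "m \<le> last xs" for m
  proof (cases "m < 0")
    case True
    have "-1 \<le> x" if "x \<in> set xs" for x
      using assms that by (cases xs) auto
    then have "0 \<le> v" if "(x, v) \<in> set ?A" for x v using A[OF that] that set_zip_leftD by fastforce
    then have "0 \<le> pl ?A m" by (rule pl_nonneg[OF s])
    then show ?thesis using True by (simp add: E_def)
  next
    case False
    have "D 2 (nat m) \<le> nat m" using linear[of 2 "nat m"] by simp
    then have "real (D 2 (nat m)) \<le> real (nat m)" by (simp only: of_nat_le_iff)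
    then have "E 2 m \<le> 1 * real_of_int m + 1" using False by (simp add: E_def)
    also have "\<dots> \<le> pl ?A m"
    proof (rule line_le_pl[OF s, where l = "-1" and h = "last xs"])
      show "-1 \<in> fst ` set ?A" "last xs \<in> fst ` set ?A"
        using fst assms(2,3) by (metis image_set hd_in_set last_in_set)+
      show "1 * real_of_int x + 1 \<le> v" if "(x, v) \<in> set ?A" for x v using A[OF that] by simp
    qed (use False that in auto)
    finally show ?thesis .
  qed
  then show ?thesis by (simp add: table_row_def)
qed

end

section \<open>Integer certificates for powers with logarithmic exponents\<close>

lemma powr_log_commute: "x > 0 \<Longrightarrow> b > 0 \<Longrightarrow> x powr log 2 b = b powr log 2 (x::real)"
  by (simp add: powr_def log_def)

text \<open>The hypothesis on \<open>2 ^ p\<close> says that \<open>p / q\<close> is at most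
  \<open>log 2 x\<close>. After exchanging base and exponent, \<open>b powr (p / q)\<close> is a
  lower bound, and comparing it with \<open>w\<close> needs only integer powers.\<close>

lemma le_powr_log:
  fixes x b w :: real
  assumes "b \<ge> 1" "x > 0" "2 ^ p \<le> x ^ q" "q > 0" "w \<ge> 0" "w ^ q \<le> b ^ p"
  shows "w \<le> x powr log 2 b"
proof -
  have "real p = log 2 (2 ^ p)" by (simp add: log_nat_power)
  also have "\<dots> \<le> log 2 (x ^ q)" using assms(3) by (subst log_le_cancel_iff) (use assms in auto)
  also have "\<dots> = real q * log 2 x" using assms(2) by (simp add: log_nat_power)
  finally have pq: "real p \<le> real q * log 2 x" .
  have "b ^ p = b powr real p" using assms(1) by (simp add: powr_realpow)
  also have "\<dots> \<le> b powr (real q * log 2 x)" using pq assms(1) by (intro powr_mono) auto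
  also have "\<dots> = (b powr log 2 x) powr real q" by (simp add: powr_powr mult.commute)
  also have "\<dots> = (b powr log 2 x) ^ q" using assms(1) by (intro powr_realpow) simp
  finally have "w ^ q \<le> (b powr log 2 x) ^ q" using assms(6) by linarith
  then have "w \<le> b powr log 2 x" using assms(4) by (intro power_le_imp_le_base[of w "q - 1"]) auto
  then show ?thesis using powr_log_commute[of x b] assms by simp
qed

text \<open>The weighted arithmetic-geometric mean inequality for \<open>s powr e\<close> and 1 with
  weights \<open>1 / e\<close> and \<open>1 - 1 / e\<close>.\<close>

lemma Bernoulli_powr:
  fixes s e :: real
  assumes "s > 0" "e \<ge> 1"
  shows "1 + e * (s - 1) \<le> s powr e"
proof -
  have "(s powr e) powr (1 / e) * 1 powr (1 - 1 / e) \<le> (1 / e) * s powr e + (1 - 1 / e) * 1"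
    using assms by (intro Youngs_inequality_0) (auto simp: divide_simps)
  then have "s \<le> (1 / e) * s powr e + (1 - 1 / e)" using assms by (simp add: powr_powr)
  then have "e * s \<le> e * ((1 / e) * s powr e + (1 - 1 / e))" using assms by (intro mult_left_mono) auto
  also have "\<dots> = s powr e + (e - 1)" using assms by (simp add: distrib_left right_diff_distrib)
  finally show ?thesis by (simp add: algebra_simps)
qed

lemma powr_tangent:
  fixes t c e :: real
  assumes "t > 0" "c > 0" "e \<ge> 1"
  shows "c powr e * (1 + e * (t / c - 1)) \<le> t powr e"
proof -
  have "c powr e * (1 + e * (t / c - 1)) \<le> c powr e * (t / c) powr e"
    using assms by (intro mult_left_mono Bernoulli_powr) auto
  also have "\<dots> = t powr e" using assms by (simp add: powr_divide)
  finally show ?thesis .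
qed

text \<open>\<open>1000 * (37 / 4) powr (b / 6)\<close> rounded down. Only odd residues occur, since
  \<open>j\<close> starts at 19 and grows by 2; the default 0 is a trivial lower bound.\<close>

fun sixth_root_bound :: "nat \<Rightarrow> int" where
  "sixth_root_bound b = (if b = 1 then 1448 else if b = 3 then 3041 else if b = 5 then 6384 else 0)"

lemma sixth_root_bound: "0 \<le> sixth_root_bound b" "real_of_int (sixth_root_bound b) ^ 6 \<le> 1000 ^ 6 * (37 / 4) ^ b"
  by (auto simp: power_divide)

text \<open>On \<open>[a, b]\<close> the interpolation is compared with the tangent of \<open>t \<mapsto> t powr log 2 (37 / 4)\<close> at \<open>c\<close>. As
  \<open>2 powr (j / 6) \<le> c\<close>, the value there is at least \<open>(37 / 4) powr (j / 6)\<close>, hence at least \<open>W\<close>; the exponent is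
  only needed up to \<open>77 / 24 \<le> log 2 (37 / 4) \<le> 321 / 100\<close>.\<close>

fun tangent_ok :: "(int \<times> int) list \<Rightarrow> (int \<times> int) list \<Rightarrow> nat \<Rightarrow> bool" where
  "tangent_ok ((a, p) # (b, q) # r) ((c, W) # cs) j \<longleftrightarrow>
     0 < a \<and> a \<le> c \<and> c \<le> b \<and> 0 \<le> W \<and> 2 ^ j \<le> c ^ 6 \<and> 1000 * W * 4 ^ (j div 6) \<le> 37 ^ (j div 6) * sixth_root_bound (j mod 6) \<and>
     (p - 1) * (100 * c) \<le> W * (100 * c - 321 * (c - a)) \<and> 321 * (c - a) \<le> 100 * c \<and>
     (q - 1) * (24 * c) \<le> W * (24 * c + 77 * (b - c)) \<and> tangent_ok ((b, q) # r) cs (j + 2)"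
| "tangent_ok [n] cs j = True"
| "tangent_ok A cs j = False"

lemma log_37_4: "77 / 24 \<le> log 2 (37 / 4)" "log 2 (37 / 4) \<le> 321 / 100"
proof -
  have "real 77 = log 2 (2 ^ 77)" by (rule log_pow_cancel[symmetric]) auto
  also have "\<dots> \<le> log 2 ((37 / 4) ^ 24)" by (subst log_le_cancel_iff) (auto simp: power_divide divide_simps)
  also have "\<dots> = real 24 * log 2 (37 / 4)" by (rule log_nat_power) simp
  finally show "77 / 24 \<le> log 2 (37 / 4)" by simp
  have "real 100 * log 2 (37 / 4) = log 2 ((37 / 4) ^ 100)" by (rule log_nat_power[symmetric]) simp
  also have "\<dots> \<le> log 2 (2 ^ 321)" by (subst log_le_cancel_iff) (auto simp: power_divide divide_simps)
  also have "\<dots> = real 321" by (rule log_pow_cancel) auto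
  finally show "log 2 (37 / 4) \<le> 321 / 100" by simp
qed

lemma tangent_sound:
  assumes "tangent_ok A cs j" "nodes_sorted A" "2 \<le> length A" "fst (hd A) \<le> t" "t \<le> fst (last A)"
  shows "pl A t - 1 \<le> t powr log 2 (37 / 4)"
  using assms
proof (induction A cs j rule: tangent_ok.induct)
  case (1 a p b q r c W cs j)
  have ab: "a < b" using "1.prems"(2) by simp
  have ok: "0 < a" "a \<le> c" "c \<le> b" "0 \<le> W" "2 ^ j \<le> c ^ 6" "1000 * W * 4 ^ (j div 6) \<le> 37 ^ (j div 6) * sixth_root_bound (j mod 6)"
    "(p - 1) * (100 * c) \<le> W * (100 * c - 321 * (c - a))"
    "(q - 1) * (24 * c) \<le> W * (24 * c + 77 * (b - c))" "tangent_ok ((b, q) # r) cs (j + 2)"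
    "321 * (c - a) \<le> 100 * c"
    using "1.prems"(1) by simp_all
  define e where "e = log 2 (37 / 4 :: real)"
  have e: "77 / 24 \<le> e" "e \<le> 321 / 100" unfolding e_def by (rule log_37_4)+
  have at: "real_of_int a \<le> t" using "1.prems"(4) by simp
  show ?case
  proof (cases "t \<le> b")
    case True
    have c: "real_of_int c > 0" using ok by simp
    have "real_of_int W \<le> real_of_int c powr e"
      unfolding e_def
    proof (rule le_powr_log[where p = j and q = 6])
      have "real_of_int (2 ^ j) \<le> real_of_int (c ^ 6)" using ok(5) by (simp only: of_int_le_iff)
      then show "2 ^ j \<le> real_of_int c ^ 6" by simp
      let ?k = "real_of_int (sixth_root_bound (j mod 6))"
      have "real_of_int (1000 * W * 4 ^ (j div 6)) \<le> real_of_int (37 ^ (j div 6) * sixth_root_bound (j mod 6))"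
        using ok(6) by (simp only: of_int_le_iff)
      then have "1000 * real_of_int W \<le> (37 / 4) ^ (j div 6) * ?k" by (simp add: power_divide field_simps)
      then have "(1000 * real_of_int W) ^ 6 \<le> ((37 / 4) ^ (j div 6) * ?k) ^ 6"
        using ok(4) by (intro power_mono) auto
      also have "\<dots> = (37 / 4) ^ (6 * (j div 6)) * ?k ^ 6" by (simp add: power_mult_distrib power_mult[symmetric] mult.commute)
      also have "\<dots> \<le> (37 / 4) ^ (6 * (j div 6)) * (1000 ^ 6 * (37 / 4) ^ (j mod 6))"
        by (intro mult_left_mono sixth_root_bound(2)) simp
      also have "\<dots> = 1000 ^ 6 * (37 / 4) ^ (6 * (j div 6) + j mod 6)"
        unfolding power_add by (rule mult.left_commute)
      also have "6 * (j div 6) + j mod 6 = j" by simp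
      finally show "real_of_int W ^ 6 \<le> (37 / 4) ^ j" by (simp add: power_mult_distrib)
    qed (use ok in auto)
    have tangent: "real_of_int c powr e * (1 + e * (x / c - 1)) \<le> x powr e" if "x > 0" for x
      using that c e by (intro powr_tangent) auto
    define L where "L = real_of_int c powr e"
    have L: "real_of_int W \<le> L" "0 \<le> L" using \<open>real_of_int W \<le> _\<close> by (auto simp: L_def)
    \<comment> \<open>To the left of \<open>c\<close> a larger exponent lowers the tangent, so the
      upper bound \<open>321 / 100\<close> is the safe one; to the right it is the lower bound
      \<open>77 / 24\<close>. The factor of \<open>W\<close> is nonnegative in both cases, so
      \<open>W\<close> may be replaced by the true value \<open>L\<close>.\<close>
    have left: "real_of_int (p - 1) \<le> L * (1 + e * (a / c - 1))"
    proof -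
      have "real_of_int ((p - 1) * (100 * c)) \<le> real_of_int (W * (100 * c - 321 * (c - a)))"
        using ok(7) by (simp only: of_int_le_iff)
      then have *: "real_of_int (p - 1) \<le> W * (1 - 321 / 100 * (1 - a / c))"
        using c by (simp add: field_simps)
      have "real_of_int (321 * (c - a)) \<le> real_of_int (100 * c)" using ok(10) by (simp only: of_int_le_iff)
      then have "1 - 321 / 100 * (1 - real_of_int a / c) \<ge> 0" using c by (simp add: field_simps)
      then have "W * (1 - 321 / 100 * (1 - a / c)) \<le> L * (1 - 321 / 100 * (1 - a / c))"
        using L by (intro mult_right_mono) auto
      also have "\<dots> \<le> L * (1 + e * (a / c - 1))"
      proof (rule mult_left_mono[OF _ L(2)])
        define u where "u = 1 - real_of_int a / c"
        have "real_of_int a / c - 1 = - u" "0 \<le> u" using ok c by (auto simp: u_def)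
        moreover have "e * u \<le> 321 / 100 * u" using e(2) \<open>0 \<le> u\<close> by (rule mult_right_mono)
        ultimately show "1 - 321 / 100 * (1 - real_of_int a / c) \<le> 1 + e * (a / c - 1)"
          by (simp add: u_def[symmetric])
      qed
      finally show ?thesis using * by linarith
    qed
    have right: "real_of_int (q - 1) \<le> L * (1 + e * (b / c - 1))"
    proof -
      have "real_of_int ((q - 1) * (24 * c)) \<le> real_of_int (W * (24 * c + 77 * (b - c)))"
        using ok(8) by (simp only: of_int_le_iff)
      then have "real_of_int (q - 1) \<le> W * (1 + 77 / 24 * (b / c - 1))"
        using c by (simp add: field_simps)
      also have "\<dots> \<le> L * (1 + e * (b / c - 1))"
      proof (intro mult_mono add_mono order.refl mult_right_mono)
        show "0 \<le> real_of_int b / c - 1" using ok c by simp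
        then show "0 \<le> 1 + 77 / 24 * (real_of_int b / c - 1)" by simp
      qed (use L e in auto)
      finally show ?thesis .
    qed
    have "pl ((a, p) # (b, q) # r) t = p + (q - p) * ((t - a) / (b - a))"
      using pl_segment[of a t b p q r] at True ab by simp
    define s where "s = (t - a) / (b - a)"
    have s: "0 \<le> s" "s \<le> 1" using at True ab by (auto simp: s_def divide_simps)
    have ts: "t = (1 - s) * a + s * b"
    proof -
      have "s * (b - a) = t - a" using ab by (simp add: s_def)
      then show ?thesis by (simp add: algebra_simps)
    qed
    have "pl ((a, p) # (b, q) # r) t - 1 = (1 - s) * (p - 1) + s * (q - 1)"
      using \<open>pl _ t = _\<close> unfolding s_def[symmetric] by (simp add: algebra_simps)
    also have "\<dots> \<le> (1 - s) * (L * (1 + e * (a / c - 1))) + s * (L * (1 + e * (b / c - 1)))"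
      using s left right by (intro add_mono mult_left_mono) auto
    also have "\<dots> = L * (1 + e * (((1 - s) * a + s * b) / c - 1))"
      by (simp add: algebra_simps add_divide_distrib diff_divide_distrib)
    also have "\<dots> \<le> t powr e" unfolding L_def ts[symmetric] using tangent[of t] at ok(1) by simp
    finally show ?thesis by (simp add: e_def)
  next
    case False
    have "r \<noteq> []" using "1.prems"(5) False by auto
    then have "2 \<le> length ((b, q) # r)" by (cases r) auto
    then have "pl ((b, q) # r) t - 1 \<le> t powr log 2 (37 / 4)"
      using "1.IH"[OF ok(9)] "1.prems" False by simp
    then show ?thesis using pl_skip[OF ab, of t p q r] False by simp
  qed
qed auto

lemma pl_dropWhile:
  assumes "nodes_sorted A" "s \<in> fst ` set A" "real_of_int s \<le> t"
  shows "pl (dropWhile (\<lambda>n. fst n < s) A) t = pl A t"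
  using assms
proof (induction A)
  case (Cons n A)
  obtain x v where n: "n = (x, v)" by (cases n)
  show ?case
  proof (cases "x < s")
    case True
    then have sA: "s \<in> fst ` set A" using Cons.prems(2) n by auto
    then obtain y w r where A: "A = (y, w) # r" by (cases A) auto
    have "x < y" using Cons.prems(1) n A by simp
    moreover have "y \<le> s" using sA Cons.prems(1) A by force
    ultimately have "pl (n # A) t = pl A t"
      unfolding n A using Cons.prems(3) by (intro pl_skip) auto
    then show ?thesis using Cons.IH sA Cons.prems True n by simp
  qed (simp add: n)
qed simp

section \<open>Dimensions 7, 8 and 37\<close>

text \<open>The nodes above \<open>8\<close> are the numbers \<open>2 powr (k / 3)\<close> rounded up. A row \<open>(T, vs)\<close> for dimension \<open>3, 4, \<dots>\<close>
  results from its predecessor by the recursion, rounded up, with the linear bound beyond \<open>T\<close>.\<close>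

definition grid :: "int list" where
 "grid =
   [-1, 0, 1, 2, 3, 4, 5, 6, 7, 8, 11, 13, 16, 21, 26, 32, 41, 51, 64, 81, 102, 128, 162, 204,
   256, 323, 407, 512, 646, 813, 1024, 1291, 1626, 2048, 2581, 3251, 4096, 5161, 6502, 8192,
   10322, 13004, 16384, 20643, 26008, 32768, 41286, 52016, 65536]"

definition grid_rows :: "(int \<times> int list) list" where
 "grid_rows = [
   (11, [0, 1, 2, 3, 5, 7, 9, 11, 13, 15, 24, 25, 31, 41, 51, 63, 81, 101, 127, 161, 203, 255,
   323, 407, 511, 645, 813, 1023, 1291, 1625, 2047, 2581, 3251, 4095, 5161, 6501, 8191, 10321,
   13003, 16383, 20643, 26007, 32767, 41285, 52015, 65535, 82571, 104031, 131071]),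
   (21, [0, 1, 2, 3, 5, 8, 11, 14, 17, 20, 34, 41, 56, 81, 98, 122, 158, 198, 250, 318, 402,
   506, 642, 810, 1018, 1286, 1622, 2042, 2578, 3246, 4090, 5158, 6498, 8186, 10318, 12998,
   16378, 20638, 26002, 32762, 41282, 52010, 65530, 82566, 104026, 131066, 165138, 208058,
   262138]),
   (41, [0, 1, 2, 3, 5, 8, 12, 16, 20, 24, 42, 54, 80, 125, 170, 230, 345, 390, 494, 630, 798,
   1006, 1278, 1614, 2030, 2566, 3238, 4078, 5150, 6486, 8174, 10310, 12990, 16366, 20630,
   25990, 32750, 41270, 51998, 65518, 82558, 104014, 131054, 165126, 208046, 262126, 330270,
   416110, 524270]),
   (64, [0, 1, 2, 3, 5, 8, 12, 17, 22, 27, 48, 64, 100, 169, 245, 350, 573, 759, 1072, 1250,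
   1586, 2002, 2546, 3218, 4050, 5122, 6466, 8146, 10290, 12962, 16338, 20610, 25970, 32722,
   41250, 51970, 65490, 82530, 103986, 131026, 165106, 208018, 262098, 330242, 416082, 524242,
   660530, 832210, 1048530]),
   (81, [0, 1, 2, 3, 5, 8, 12, 17, 23, 29, 53, 72, 116, 209, 319, 475, 824, 1199, 1814, 2549,
   3154, 3986, 5074, 6418, 8082, 10226, 12914, 16274, 20562, 25906, 32658, 41202, 51922, 65426,
   82482, 103922, 130962, 165042, 207954, 262034, 330194, 416018, 524178, 660466, 832146,
   1048466, 1321042, 1664402, 2097042]),
   (128, [0, 1, 2, 3, 5, 8, 12, 17, 23, 30, 57, 78, 129, 243, 388, 600, 1082, 1685, 2696, 4178,
   5982, 8679, 10114, 12802, 16130, 20418, 25794, 32514, 41090, 51778, 65282, 82370, 103810,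
   130818, 164930, 207810, 261890, 330050, 415874, 524034, 660354, 832002, 1048322, 1320898,
   1664258, 2096898, 2642050, 3328770, 4194050]),
   (162, [0, 1, 2, 3, 5, 8, 12, 17, 23, 30, 60, 83, 139, 272, 448, 720, 1342, 2203, 3683, 6102,
   9527, 14907, 20896, 25538, 32194, 40770, 51522, 64962, 82114, 103490, 130498, 164674,
   207554, 261570, 329794, 415554, 523714, 660034, 831682, 1048002, 1320642, 1663938, 2096578,
   2641730, 3328450, 4193730, 5284034, 6657474, 8388034]),
   (256, [0, 1, 2, 3, 5, 8, 12, 17, 23, 30, 62, 87, 147, 296, 501, 834, 1596, 2736, 4741, 8278,
   13745, 22693, 35164, 50165, 73795, 81410, 102914, 129794, 164098, 206850, 260866, 329218,
   414978, 523010, 659458, 830978, 1047298, 1319938, 1663234, 2095874, 2641154, 3327746,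
   4193026, 5283330, 6656770, 8387330, 10567938, 13314818, 16775938]),
   (256, [0, 1, 2, 3, 5, 8, 12, 17, 23, 30, 63, 90, 153, 316, 547, 938, 1839, 3271, 5835,
   10655, 18569, 31997, 53072, 82781, 131592, 162562, 205570, 259330, 327938, 413442, 521474,
   658178, 829698, 1045762, 1318658, 1661698, 2094338, 2639618, 3326210, 4191490, 5282050,
   6655234, 8385794, 10566402, 13313282, 16774402, 21135618, 26629378, 33551618]),
   (407, [0, 1, 2, 3, 5, 8, 12, 17, 23, 30, 63, 92, 158, 332, 587, 1031, 2067, 3796, 6958,
   13178, 23914, 42751, 74672, 123963, 207676, 298763, 437066, 518146, 655362, 826370, 1042434,
   1315842, 1658882, 2091010, 2636802, 3322882, 4188162, 5278722, 6651906, 8382466, 10563586,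
   13309954, 16771074, 21132290, 26626050, 33548290, 42270722, 53258242, 67102722]),
   (512, [0, 1, 2, 3, 5, 8, 12, 17, 23, 30, 63, 93, 162, 345, 621, 1113, 2276, 4303, 8090,
   15792, 29683, 54853, 99914, 174069, 303829, 478712, 758721, 1090869, 1309698, 1651714,
   2083842, 2630658, 3316738, 4180994, 5272578, 6644738, 8375298, 10556418, 13302786, 16763906,
   21126146, 26618882, 33541122, 42263554, 53251074, 67095554, 84540418, 106515458, 134204418]),
   (646, [0, 1, 2, 3, 5, 8, 12, 17, 23, 30, 63, 93, 165, 355, 650, 1184, 2462, 4785, 9213,
   18444, 35769, 68170, 128657, 233232, 421477, 707562, 1185347, 1879522, 2660774, 3301378,
   4165634, 5259266, 6631426, 8359938, 10543106, 13287426, 16748546, 21110786, 26603522,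
   33525762, 42250242, 53235714, 67080194, 84525058, 106500098, 134189058, 169078786,
   213028866, 268406786]),
   (813, [0, 1, 2, 3, 5, 8, 12, 17, 23, 30, 63, 93, 167, 363, 674, 1244, 2633, 5237, 10313,
   21087, 42077, 82549, 160691, 301394, 561670, 989873, 1731184, 2922778, 4538263, 6613719,
   8327170, 10514434, 13258754, 16715778, 21082114, 26570754, 33492994, 42217474, 53202946,
   67047426, 84496386, 106467330, 134156290, 169046018, 212996098, 268374018, 338153474,
   426053634, 536809474]),
   (1291, [0, 1, 2, 3, 5, 8, 12, 17, 23, 30, 63, 93, 168, 369, 694, 1297, 2789, 5654, 11376,
   23681, 48515, 97819, 195748, 378321, 725071, 1329525, 2409581, 4259560, 7043945, 11201441,
   16546770, 24228303, 26509314, 33423362, 42156034, 53133314, 66977794, 84426754, 106397698,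
   134086658, 168984578, 212926466, 268304386, 338083842, 425984002, 536739842, 676298754,
   852099074, 1073610754]),
   (65536, [0, 1, 2, 3, 5, 8, 12, 17, 23, 30, 63, 93, 168, 374, 710, 1343, 2930, 6032, 12393,
   26262, 54996, 113798, 233588, 463684, 911958, 1729760, 3232858, 5928305, 10283757, 17327171,
   27941304, 44178253, 60404486, 88400499, 129357102, 181078775, 242584650, 341680967,
   467165711, 668897622, 850671645, 1145573530, 1603951007, 2306207372, 2715151855,
   26092210317, 5285745521, 326811239270, 53195784783]),
   (65536, [0, 1, 2, 3, 5, 8, 12, 17, 23, 30, 63, 93, 168, 378, 723, 1383, 3056, 6368, 13356,
   28808, 61440, 130297, 273935, 557040, 1122234, 2193138, 4212127, 7966260, 14366344,
   25270714, 43194505, 71955705, 109705298, 173175519, 271114115, 398235664, 586078025,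
   880234203, 1260032100, 1836829998, 2605892195, 3660256552, 5271126293, 7510770521,
   10028195562, 36625407719, 20297295195, 347465282557, 126371844744]),
   (65536, [0, 1, 2, 3, 5, 8, 12, 17, 23, 30, 63, 93, 168, 381, 733, 1417, 3171, 6679, 14259,
   31300, 67782, 147154, 316487, 657860, 1355487, 2721524, 5357161, 10408916, 19401620,
   35326127, 63050098, 109349641, 178450426, 296647851, 486171860, 750804825, 1173771954,
   1845110749, 2753742259, 4174362850, 6283506392, 9154189519, 13603039915, 20056988933,
   28315167567, 63805162991, 60380965717, 404064832310, 253877170740]),
   (65536, [0, 1, 2, 3, 5, 8, 12, 17, 23, 30, 63, 93, 168, 383, 741, 1446, 3275, 6965, 15097,
   33722, 74129, 164212, 360924, 765711, 1611152, 3316088, 6676552, 13289792, 25499414,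
   47799110, 88307034, 158343905, 271244493, 469230325, 797088842, 1285879445, 2102380229,
   3425755812, 5310180847, 8358831573, 13108923287, 19745041202, 30282820419, 46225773527,
   67753289317, 124305332420, 152753902296, 539487146670, 502312156157]),
   (65536, [0, 1, 2, 3, 5, 8, 12, 17, 23, 30, 63, 93, 168, 384, 747, 1470, 3368, 7226, 15865,
   36060, 80444, 181323, 406910, 880102, 1888439, 3977306, 8177628, 16640066, 32768130,
   63004278, 119814084, 221111916, 393269844, 702935196, 1230586644, 2060599335, 3492106930,
   5864159901, 9404125369, 15305775413, 24788242934, 38495216444, 60817545032, 95699866554,
   144631286181, 245795129222, 343973449663, 828549068290, 993573183160]),
   (65536, [0, 1, 2, 3, 5, 8, 12, 17, 23, 30, 63, 93, 168, 384, 752, 1490, 3450, 7462, 16590,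
   38302, 86691, 198354, 454139, 1000487, 2186369, 4705030, 9866404, 20488280, 41313576,
   81262408, 158463948, 300009165, 550292726, 1011447759, 1817881809, 3143254025, 5489868406,
   9463611292, 15645135567, 26221639881, 43629647597, 69679465909, 113116884203, 182763015183,
   283766822839, 471733317563, 709123368028, 1395649706033, 1936400287313]),
   (65536, [0, 1, 2, 3, 5, 8, 12, 17, 23, 30, 63, 93, 168, 384, 756, 1506, 3521, 7673, 17272,
   40439, 92838, 215177, 502311, 1126279, 2503795, 5498525, 11747553, 24860094, 51237887,
   102897685, 205186984, 397563709, 748663934, 1410186926, 2594996426, 4614380384, 8272620098,
   14598031466, 24801560194, 42662977411, 72683166048, 119099972808, 198189185763,
   327776997648, 521551405531, 867550108879, 1363947119726, 2437885679111, 3670272107308]),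
   (65536, [0, 1, 2, 3, 5, 8, 12, 17, 23, 30, 63, 93, 168, 384, 759, 1519, 3581, 7859, 17911,
   42464, 98855, 231669, 551132, 1256857, 2839428, 6356494, 13824390, 29778099, 62638537,
   128234974, 260944680, 516464878, 995314057, 1916352388, 3603044066, 6567844085, 12050760992,
   21721841956, 37826621498, 66602282919, 115899829281, 194452977558, 330968076137,
   558974902123, 909725135179, 1528476534093, 2480558541571, 4255701512223, 6724936893694]),
   (65536, [0, 1, 2, 3, 5, 8, 12, 17, 23, 30, 63, 93, 168, 384, 761, 1529, 3634, 8030, 18507,
   44370, 104720, 247729, 600317, 1391578, 3191877, 7277132, 16098879, 35261704, 75607479,
   157597171, 326723008, 659550464, 1297743537, 2548958254, 4888488285, 9111894703,
   17071588442, 31380305748, 55886517521, 100500546150, 178311119979, 305750873521,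
   531282798766, 914610810864, 1519991448369, 2589307270662, 4307440053341, 7292750597857,
   11899438681856]),
   (65536, [0, 1, 2, 3, 5, 8, 12, 17, 23, 30, 63, 93, 168, 384, 762, 1537, 3680, 8186, 19059,
   46153, 110414, 263651, 649592, 1529785, 3560049, 8258483, 18571654, 41327627, 90231047,
   191302756, 403526727, 829793933, 1664008115, 3328855087, 6503373973, 12370185569,
   23622779971, 44220287224, 80390464909, 147386555739, 266229504103, 465803544728,
   824985558498, 1445507564350, 2449589403188, 4236409182223, 7194521372659, 12186876243069,
   20365120340084]),
   (65536, [0, 1, 2, 3, 5, 8, 12, 17, 23, 30, 63, 93, 168, 384, 762, 1543, 3720, 8327, 19568,
   47808, 115919, 279384, 698696, 1670809, 3942778, 9298227, 21242052, 47989816, 106589403,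
   229663397, 492373622, 1030290739, 2102699749, 4278740311, 8505529997, 16482749661,
   32035878755, 61001371795, 113022587887, 210942943291, 387470713604, 690762520614,
   1245249095997, 2218045561822, 3827948086998, 6722313994303, 11624217027639, 19834370316282,
   33797759830850]),
   (65536, [0, 1, 2, 3, 5, 8, 12, 17, 23, 30, 63, 93, 168, 384, 762, 1548, 3754, 8453, 20034,
   49332, 121221, 294881, 747382, 1813976, 4338843, 10393726, 24108152, 55259404, 124756085,
   272981692, 594288751, 1264243951, 2622923357, 5423157128, 10958742034, 21606923593,
   42689759885, 82607284480, 155775543633, 295598910100, 551598326496, 1000731296534,
   1834047580323, 3317636589231, 5824554283299, 10383259399852, 18249388285167, 31469927976426,
   54544722055350]),
   (65536, [0, 1, 2, 3, 5, 8, 12, 17, 23, 30, 63, 93, 168, 384, 762, 1552, 3783, 8568, 20457,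
   50781, 126309, 310103, 795432, 1958697, 4746979, 11542085, 27166946, 63144738, 144797671,
   321549267, 710298858, 1534949436, 3234270108, 6788482391, 13932894959, 27918213240,
   56014055548, 110057545713, 210985761832, 406629535671, 770191066087, 1420444918272,
   2643833685266, 4852727450306, 8658170586821, 15660068290204, 27939283943481, 48764989878103,
   85833785125241]),
   (65536, [0, 1, 2, 3, 5, 8, 12, 17, 23, 30, 63, 93, 168, 384, 762, 1555, 3807, 8672, 20837,
   52154, 131171, 325015, 842633, 2104395, 5165888, 12740182, 30414394, 71651394, 166773511,
   375645022, 841426913, 1845780729, 3946787597, 8402903807, 17504084425, 35611095241,
   72492518133, 144519302219, 281370165247, 550261525654, 1057133116247, 1980021656855,
   3739424409845, 6959378710547, 12607546657892, 23122780575769, 41834604270581,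
   73947446995124, 132031125529523]),
   (65536, [0, 1, 2, 3, 5, 8, 12, 17, 23, 30, 63, 93, 168, 384, 762, 1557, 3827, 8765, 21173,
   53452, 135799, 339583, 888777, 2250512, 5594243, 13984695, 33845484, 80782200, 190735521,
   435533538, 988686791, 2200173715, 4770947269, 10296386849, 21754697517, 44899749400,
   92666301152, 187319270889, 370064228734, 733785217123, 1428927625132, 2715789309960,
   5200107819459, 9806464148856, 18023771223407, 33499476039450, 61412922706227,
   109945976613162, 198956819834146]),
   (65536, [0, 1, 2, 3, 5, 8, 12, 17, 23, 30, 63, 93, 168, 384, 762, 1558, 3843, 8847, 21484,
   54674, 140185, 353775, 933698, 2396508, 6030698, 15272168, 37454321, 90537284, 216728089,
   501463690, 1153078143, 2601611331, 5717609531, 12500631870, 26773462770, 56018717899,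
   117137138975, 239955734421, 480661226593, 965672621824, 1905033447355, 3671188361773,
   7121982426396, 13601536551516, 25344416734360, 47709749707588, 88565790294789,
   160562579877589, 294267139369424]),
   (65536, [0, 1, 2, 3, 5, 8, 12, 17, 23, 30, 63, 93, 168, 384, 762, 1558, 3856, 8918, 21770,
   55820, 144323, 367562, 977238, 2541864, 6473895, 16599037, 41234194, 100914131, 244788032,
   573667430, 1335581474, 3053608392, 6797986909, 15049021939, 32655470033, 69223487992,
   146570407519, 304110528740, 617252512114, 1255701253118, 2508225054956, 4897753917370,
   9620540401748, 18597405284403, 35109632256900, 66903323191419, 125688937701818,
   230677200268917, 427913876655846]),
   (65536, [0, 1, 2, 3, 5, 8, 12, 17, 23, 30, 63, 93, 168, 384, 762, 1558, 3866, 8978, 22031,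
   56891, 148209, 380918, 1020296, 2686086, 6922469, 17962641, 45178546, 111907658, 274946060,
   652360563, 1537153753, 3559699151, 8023609188, 17976562803, 39502165585, 84791002603,
   181698051191, 381660973043, 784468682551, 1615083454080, 3264975449620, 6456178031292,
   12833505228841, 25099470685127, 47980343244780, 92504296237293, 175787078698518,
   326488617319598, 612691945705175]),
   (65536, [0, 1, 2, 3, 5, 8, 12, 17, 23, 30, 63, 93, 168, 384, 762, 1558, 3874, 9031, 22267,
   57886, 151840, 393823, 1062794, 2828702, 7375062, 19360232, 49280270, 123510302, 307226732,
   737742039, 1758724061, 4123424945, 9406287572, 21319814941, 47421322844, 103020097398,
   223321361203, 474691694168, 987521480506, 2056600915543, 4205861812617, 8417453749718,
   16923933770187, 33473859731398, 64758719308819, 126261562215319, 242594906793716,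
   455796129572877, 864887540203175]),
   (65536, [0, 1, 2, 3, 5, 8, 12, 17, 23, 30, 63, 93, 168, 384, 762, 1558, 3880, 9077, 22478,
   58806, 155214, 406261, 1104658, 2969269, 7830325, 20788987, 53531779, 135712124, 341648430,
   829993382, 2001189521, 4748321958, 10958078150, 25116818357, 56526989110, 124231863444,
   272313591786, 585506298113, 1232246281498, 2594744047105, 5365993535478, 10864101883643,
   22083592031659, 44156406670637, 86411072960937, 170305929374650, 330715962881729,
   628326864003094, 1205040211128909]),
   (65536, [0, 1, 2, 3, 5, 8, 12, 17, 23, 30, 63, 93, 168, 384, 762, 1558, 3885, 9117, 22664,
   59650, 158330, 418217, 1145818, 3107366, 8286925, 22246022, 57925074, 148500912, 378223375,
   929278256, 2265411518, 5437909186, 12691244929, 29407010759, 66939408947, 148769935112,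
   329622402163, 716638842969, 1525145017403, 3245855841079, 6785462184092, 13891481228943,
   28536613174587, 57662521345217, 114093353568076, 227214506311418, 445781135999380,
   856113874657519, 1658833335615023])]"

text \<open>All integers from \<open>-1\<close> to \<open>73\<close> are nodes here, so this table is exact for the recursion.\<close>

definition small_rows :: "(int \<times> int list) list" where
 "small_rows = [
   (8, [0, 1, 2, 3, 5, 7, 9, 11, 13, 15, 17, 19, 21, 23, 25, 27, 29, 31, 33, 35, 37, 39, 41,
   43, 45, 47, 49, 51, 53, 55, 57, 59, 61, 63, 65, 67, 69, 71, 73, 75, 77, 79, 81, 83, 85, 87,
   89, 91, 93, 95, 97, 99, 101, 103, 105, 107, 109, 111, 113, 115, 117, 119, 121, 123, 125,
   127, 129, 131, 133, 135, 137, 139, 141, 143, 145]),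
   (18, [0, 1, 2, 3, 5, 8, 11, 14, 17, 20, 23, 27, 31, 36, 41, 46, 51, 56, 61, 66, 70, 74, 78,
   82, 86, 90, 94, 98, 102, 106, 110, 114, 118, 122, 126, 130, 134, 138, 142, 146, 150, 154,
   158, 162, 166, 170, 174, 178, 182, 186, 190, 194, 198, 202, 206, 210, 214, 218, 222, 226,
   230, 234, 238, 242, 246, 250, 254, 258, 262, 266, 270, 274, 278, 282, 286]),
   (34, [0, 1, 2, 3, 5, 8, 12, 16, 20, 24, 28, 33, 39, 46, 54, 62, 71, 80, 89, 98, 106, 114,
   122, 130, 138, 146, 155, 164, 174, 184, 195, 206, 218, 230, 242, 254, 262, 270, 278, 286,
   294, 302, 310, 318, 326, 334, 342, 350, 358, 366, 374, 382, 390, 398, 406, 414, 422, 430,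
   438, 446, 454, 462, 470, 478, 486, 494, 502, 510, 518, 526, 534, 542, 550, 558, 566]),
   (55, [0, 1, 2, 3, 5, 8, 12, 17, 22, 27, 32, 38, 45, 54, 64, 75, 87, 100, 113, 127, 140, 153,
   166, 179, 192, 205, 219, 234, 250, 267, 285, 305, 326, 348, 370, 393, 412, 432, 452, 473,
   494, 515, 536, 558, 580, 601, 622, 643, 664, 685, 706, 727, 748, 769, 790, 811, 834, 850,
   866, 882, 898, 914, 930, 946, 962, 978, 994, 1010, 1026, 1042, 1058, 1074, 1090, 1106,
   1122]),
   (73, [0, 1, 2, 3, 5, 8, 12, 17, 23, 29, 35, 42, 50, 60, 72, 85, 100, 116, 133, 151, 169,
   187, 206, 225, 244, 263, 283, 304, 327, 351, 377, 405, 436, 468, 502, 537, 569, 602, 637,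
   673, 710, 747, 785, 824, 864, 903, 942, 981, 1020, 1059, 1099, 1139, 1179, 1219, 1259, 1299,
   1341, 1376, 1412, 1448, 1485, 1522, 1561, 1600, 1640, 1680, 1722, 1764, 1808, 1852, 1899,
   1946, 1994, 2042, 2092]),
   (73, [0, 1, 2, 3, 5, 8, 12, 17, 23, 30, 37, 45, 54, 65, 78, 93, 110, 129, 149, 171, 193,
   216, 240, 265, 290, 316, 343, 371, 401, 433, 467, 504, 544, 587, 632, 680, 725, 773, 823,
   876, 930, 986, 1043, 1102, 1162, 1223, 1284, 1345, 1406, 1468, 1531, 1595, 1659, 1724, 1789,
   1854, 1921, 1982, 2044, 2107, 2171, 2236, 2303, 2372, 2442, 2514, 2588, 2664, 2742, 2823,
   2907, 2994, 3082, 3173, 3266])]"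

text \<open>One point per grid interval from 8 on: \<open>c\<close> is \<open>2 powr (j / 6)\<close>
  rounded up for \<open>j = 19, 21, ...\<close>, close to the geometric mean of the interval ends,
  and \<open>W\<close> a lower estimate of \<open>(37 / 4) powr (j / 6)\<close>.\<close>

definition tangent_points :: "(int \<times> int) list" where
 "tangent_points = [
   (9, 1146), (12, 2406), (15, 5052), (18, 10600), (23, 22262), (29, 46736), (36, 98056), (46,
   205932), (58, 432316), (72, 907024), (91, 1904876), (115, 3998925), (144, 8389975), (182,
   17620107), (229, 36990057), (288, 77607273), (363, 162985992), (457, 342158032), (575,
   717867276), (725, 1507620432), (913, 3164961802), (1150, 6640272303), (1449, 13945489002),
   (1825, 29275896676), (2299, 61422518810), (2897, 128995773275), (3650, 270802044258), (4598,
   568158298996), (5793, 1193210902795), (7299, 2504918909387), (9196, 5255464265717), (11586,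
   11037200850860), (14597, 23170499911836), (18391, 48613044457885), (23171, 102094107870462),
   (29193, 214327124184489), (36781, 449670661235441), (46341, 944370497801779), (58386,
   1982525898706530)]"

text \<open>Fractions \<open>p / q\<close> just below \<open>log 2 m\<close> for \<open>m = -1, \<dots>, 73\<close>; the first two entries are void.\<close>

definition log_powers :: "(nat \<times> nat) list" where
 "log_powers = [
   (0, 1), (0, 1), (0, 1), (1, 1), (3, 2), (2, 1), (2, 1), (5, 2), (5, 2), (3, 1), (3, 1), (3,
   1), (10, 3), (7, 2), (7, 2), (11, 3), (15, 4), (4, 1), (4, 1), (4, 1), (21, 5), (17, 4),
   (13, 3), (13, 3), (9, 2), (9, 2), (23, 5), (14, 3), (14, 3), (19, 4), (19, 4), (24, 5), (34,
   7), (5, 1), (5, 1), (61, 12), (41, 8), (31, 6), (26, 5), (26, 5), (21, 4), (37, 7), (16, 3),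
   (43, 8), (27, 5), (49, 9), (82, 15), (11, 2), (61, 11), (39, 7), (28, 5), (45, 8), (17, 3),
   (57, 10), (40, 7), (23, 4), (23, 4), (29, 5), (29, 5), (35, 6), (35, 6), (41, 7), (47, 8),
   (53, 9), (65, 11), (6, 1), (6, 1), (6, 1), (6, 1), (73, 12), (61, 10), (49, 8), (43, 7),
   (37, 6), (37, 6)]"

lemma small_rows_ok:
  "steps_ok 3 0 [-1..73] (map (\<lambda>x. x + 1) [-1..73]) small_rows"
  "length small_rows = 6"
  by code_simp+

lemma grid_rows_ok:
  "steps_ok 3 0 grid (map (\<lambda>x. x + 1) grid) grid_rows"
  by code_simp

lemma grid_facts:
  "sorted_wrt (<) grid" "grid \<noteq> []" "hd grid = -1" "last grid = 65536" "length grid_rows = 35"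
  "list_all (\<lambda>x. x \<in> set grid) [1..8]"
  by code_simp+

text \<open>The hypotheses of \<open>le_powr_log\<close> with base \<open>7 / 2\<close>, freed of
  denominators.\<close>

lemma small_row_7:
  "list_all (\<lambda>((x, v), (p, q)). x \<le> 0 \<or> (1 \<le> v \<and> 0 < q \<and> 2 ^ p \<le> x ^ q \<and> (v - 1) ^ q * 2 ^ p \<le> 7 ^ p))
    (zip (zip [-1..73] (snd (small_rows ! 4))) log_powers)"
  "length log_powers = 75"
  by code_simp+

lemma small_row_8:
  "list_all (\<lambda>(x, v). x \<le> 0 \<or> v - 1 \<le> x ^ 2) (zip [-1..73] (snd (small_rows ! 5)))"
  by code_simp

lemma grid_row_37:
  "list_all (\<lambda>(x, v). x \<le> 0 \<or> 8 < x \<or> v - 1 \<le> x ^ 3) (zip grid (snd (grid_rows ! 34)))"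
  "tangent_ok (dropWhile (\<lambda>n. fst n < 8) (zip grid (snd (grid_rows ! 34)))) tangent_points 19"
  "fst (hd (dropWhile (\<lambda>n. fst n < 8) (zip grid (snd (grid_rows ! 34))))) = 8"
  "fst (last (dropWhile (\<lambda>n. fst n < 8) (zip grid (snd (grid_rows ! 34))))) = 65536"
  "2 \<le> length (dropWhile (\<lambda>n. fst n < 8) (zip grid (snd (grid_rows ! 34))))"
  by code_simp+

lemma sorted_wrt_dropWhile: "sorted_wrt P xs \<Longrightarrow> sorted_wrt P (dropWhile Q xs)"
  by (induction xs) auto

context diameter_recursion
begin

lemma D_le_node:
  assumes "table_row d xs vs" "sorted_wrt (<) xs" "(int m, v) \<in> set (zip xs vs)"
  shows "real (D d m) \<le> real_of_int (v - 1)"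
proof -
  have len: "length vs = length xs" and E: "\<And>x. x \<le> last xs \<Longrightarrow> E d x \<le> pl (zip xs vs) x"
    using assms(1) by (auto simp: table_row_def)
  have s: "nodes_sorted (zip xs vs)" using assms(2) len by simp
  have mem: "int m \<in> set xs" using assms(3) by (rule set_zip_leftD)
  have "int m \<le> last xs"
  proof -
    obtain i where i: "i < length xs" "xs ! i = int m" using mem by (auto simp: in_set_conv_nth)
    have "sorted xs" using assms(2) by (rule strict_sorted_imp_sorted)
    then have "xs ! i \<le> xs ! (length xs - 1)" using i(1) by (intro sorted_nth_mono) auto
    then show ?thesis using i mem by (metis empty_iff last_conv_nth list.set(1))
  qed
  then have "E d (int m) \<le> pl (zip xs vs) (int m)" by (rule E)
  also have "pl (zip xs vs) (int m) = v" using pl_node[OF s assms(3)] by simp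
  finally show ?thesis by (simp add: E_def)
qed

lemma node_exists:
  assumes "table_row d xs vs" "x \<in> set xs"
  obtains v where "(x, v) \<in> set (zip xs vs)"
proof -
  obtain i where "i < length xs" "xs ! i = x" using assms(2) by (auto simp: in_set_conv_nth)
  then have "(x, vs ! i) \<in> set (zip xs vs)" using assms(1) by (auto simp: set_zip table_row_def)
  then show ?thesis by (rule that)
qed

lemma sorted_small: "sorted_wrt (<) [-1..73::int]" by code_simp

lemma small_table:
  assumes "i < 6" shows "table_row (3 + i) [-1..73] (snd (small_rows ! i))"
proof -
  have xs: "sorted_wrt (<) [-1..73::int]" "[-1..73::int] \<noteq> []" "hd [-1..73::int] = -1" by code_simp+
  have "table_row (Suc 2 + i) [-1..73] (snd (small_rows ! i))"
    by (rule table_row_steps[OF _ table_row_2[OF xs] xs]) (use small_rows_ok assms in auto)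
  then show ?thesis by simp
qed

lemma D_0: "d \<ge> 2 \<Longrightarrow> D d 0 = 0"
  using linear[of d 0] by simp

lemma D_7: "real (D 7 m) \<le> real m powr log 2 (7 / 2)"
proof -
  consider "m = 0" | "1 \<le> m" "m \<le> 73" | "74 \<le> m" by linarith
  then show ?thesis
  proof cases
    case 1 then show ?thesis using D_0[of 7] by simp
  next
    case 2
    have row: "table_row 7 [-1..73] (snd (small_rows ! 4))" using small_table[of 4] by simp
    let ?vs = "snd (small_rows ! 4)"
    have len: "length ?vs = 75" using row by (simp add: table_row_def)
    define i where "i = nat (int m + 1)"
    have i: "i < 75" using 2 by (simp add: i_def)
    have xi: "[-1..73::int] ! i = int m" using i 2 by (simp add: i_def)
    have "((int m, ?vs ! i), log_powers ! i) \<in> set (zip (zip [-1..73] ?vs) log_powers)"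
      unfolding set_zip using i xi len small_row_7(2) by (auto intro!: exI[of _ i])
    moreover obtain p q where pq: "log_powers ! i = (p, q)" by (cases "log_powers ! i")
    ultimately have ok: "1 \<le> ?vs ! i" "0 < q" "2 ^ p \<le> int m ^ q" "(?vs ! i - 1) ^ q * 2 ^ p \<le> 7 ^ p"
      using small_row_7(1) 2 unfolding list_all_iff by fastforce+
    have "(int m, ?vs ! i) \<in> set (zip [-1..73] ?vs)"
      unfolding set_zip using i xi len by (auto intro!: exI[of _ i])
    then have "real (D 7 m) \<le> real_of_int (?vs ! i - 1)"
      by (rule D_le_node[OF row sorted_small])
    also have "\<dots> \<le> real m powr log 2 (7 / 2)"
    proof (rule le_powr_log[where p = p and q = q])
      have "real_of_int (2 ^ p) \<le> real_of_int (int m ^ q)" using ok(3) by (simp only: of_int_le_iff)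
      then show "2 ^ p \<le> real m ^ q" by simp
      have "real_of_int ((?vs ! i - 1) ^ q * 2 ^ p) \<le> real_of_int (7 ^ p)"
        using ok(4) by (simp only: of_int_le_iff)
      then show "real_of_int (?vs ! i - 1) ^ q \<le> (7 / 2) ^ p"
        by (simp add: power_divide pos_le_divide_eq)
    qed (use ok 2 in auto)
    finally show ?thesis .
  next
    case 3
    \<comment> \<open>74 is the first \<open>m\<close> with
      \<open>32 \<le> m powr log 2 (7 / 4)\<close>; this is why the small table ends at 73.\<close>
    have "D 7 m \<le> 32 * m" using linear[of 7 m] by simp
    then have "real (D 7 m) \<le> 32 * real m" by linarith
    also have "32 * real m \<le> real m powr log 2 (7 / 4) * real m"
    proof (rule mult_right_mono)
      have "(2::real) ^ 31 \<le> 74 ^ 5" by simp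
      also have "\<dots> \<le> real m ^ 5" using 3 by (intro power_mono) auto
      finally show "32 \<le> real m powr log 2 (7 / 4)"
        using 3 by (intro le_powr_log[where p = 31 and q = 5]) (auto simp: power_divide)
    qed simp
    also have "\<dots> = real m powr (log 2 (7 / 4) + 1)" using 3 by (simp add: powr_add)
    also have "log 2 (7 / 4) + 1 = log 2 (7 / 2 :: real)"
    proof -
      have "log 2 (7 / 4 * 2 :: real) = log 2 (7 / 4) + log 2 2" by (rule log_mult_pos) auto
      then show ?thesis by simp
    qed
    finally show ?thesis .
  qed
qed

lemma D_8: "real (D 8 m) \<le> real m powr log 2 (8 / 2)"
proof -
  have l4: "log 2 (8 / 2 :: real) = 2"
    using log_pow_cancel[of 2 2] by simp
  have pw: "real m powr 2 = real m ^ 2" if "m > 0" using that by (simp add: powr_numeral)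
  consider "m = 0" | "1 \<le> m" "m \<le> 73" | "74 \<le> m" by linarith
  then show ?thesis
  proof cases
    case 1 then show ?thesis using D_0[of 8] by simp
  next
    case 2
    have row: "table_row 8 [-1..73] (snd (small_rows ! 5))" using small_table[of 5] by simp
    have "int m \<in> set [-1..73]" using 2 by simp
    then obtain v where v: "(int m, v) \<in> set (zip [-1..73] (snd (small_rows ! 5)))"
      by (rule node_exists[OF row])
    have "real (D 8 m) \<le> real_of_int (v - 1)" by (rule D_le_node[OF row sorted_small v])
    also have "v - 1 \<le> int m ^ 2" using small_row_8 v 2 unfolding list_all_iff by fastforce
    finally show ?thesis using 2 pw l4 by simp
  next
    case 3
    have "D 8 m \<le> 64 * m" using linear[of 8 m] by simp
    also have "\<dots> \<le> m * m" using 3 by (intro mult_le_mono1) simp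
    finally have "real (D 8 m) \<le> real (m * m)" by (simp only: of_nat_le_iff)
    then show ?thesis using 3 pw l4 by (simp add: power2_eq_square)
  qed
qed

lemma D_37: "real (D 37 m) \<le> real m powr log 2 (37 / 4)"
proof -
  let ?vs = "snd (grid_rows ! 34)"
  let ?A = "zip grid ?vs"
  have row: "table_row 37 grid ?vs"
  proof -
    have "table_row (Suc 2 + 34) grid ?vs"
      by (rule table_row_steps[OF _ table_row_2[OF grid_facts(1-3)] grid_facts(1-3)])
        (use grid_rows_ok grid_facts in auto)
    then show ?thesis by simp
  qed
  have len: "length ?vs = length grid" using row by (simp add: table_row_def)
  have s: "nodes_sorted ?A" using grid_facts(1) len by simp
  have ge8: "x \<in> set grid" if "1 \<le> x" "x \<le> 8" for x using grid_facts(6) that by (auto simp: list_all_iff)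
  consider "m = 0" | "1 \<le> m" "m < 8" | "8 \<le> m" "m \<le> 65536" | "65536 < m" by linarith
  then show ?thesis
  proof cases
    case 1 then show ?thesis using D_0[of 37] by simp
  next
    case 2
    have "int m \<in> set grid" using 2 by (intro ge8) auto
    then obtain v where v: "(int m, v) \<in> set ?A" by (rule node_exists[OF row])
    have "real (D 37 m) \<le> real_of_int (v - 1)" by (rule D_le_node[OF row grid_facts(1) v])
    \<comment> \<open>Below 8 a comparison with cubes is enough, as
      \<open>3 \<le> log 2 (37 / 4)\<close>.\<close>
    also have "v - 1 \<le> int m ^ 3" using grid_row_37(1) v 2 unfolding list_all_iff by fastforce
    also have "real_of_int (int m ^ 3) = real m powr 3" using 2 by (simp add: powr_numeral)
    also have "\<dots> \<le> real m powr log 2 (37 / 4)" using 2 log_37_4 by (intro powr_mono) auto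
    finally show ?thesis by simp
  next
    case 3
    have "\<And>x. x \<le> 65536 \<Longrightarrow> E 37 x \<le> pl ?A (real_of_int x)"
      using row grid_facts(4) unfolding table_row_def by simp
    from this[of "int m"] have "E 37 (int m) \<le> pl ?A (real_of_int (int m))" using 3 by linarith
    also have "\<dots> = pl (dropWhile (\<lambda>n. fst n < 8) ?A) (real_of_int (int m))"
    proof (rule pl_dropWhile[OF s, symmetric])
      have "map fst ?A = grid" using len by simp
      then show "8 \<in> fst ` set ?A" using ge8[of 8] by (metis image_set order.refl one_le_numeral)
    qed (use 3 in simp)
    also have "\<dots> \<le> real m powr log 2 (37 / 4) + 1"
    proof -
      have "nodes_sorted (dropWhile (\<lambda>n. fst n < 8) ?A)"
        using s unfolding sorted_wrt_map by (rule sorted_wrt_dropWhile)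
      then have "pl (dropWhile (\<lambda>n. fst n < 8) ?A) (real_of_int (int m)) - 1 \<le> real_of_int (int m) powr log 2 (37 / 4)"
        by (rule tangent_sound[OF grid_row_37(2) _ grid_row_37(5)])
          (use 3 grid_row_37(3,4) in auto)
      then show ?thesis by simp
    qed
    finally show ?thesis by (simp add: E_def)
  next
    case 4
    define e where "e = log 2 (37 / 4 :: real)"
    have e: "77 / 24 \<le> e" unfolding e_def by (rule log_37_4)
    \<comment> \<open>The linear bound takes over at \<open>2 ^ 16\<close>, the end of the grid,
      because \<open>16 * (77 / 24 - 1) \<ge> 35\<close>.\<close>
    have "D 37 m \<le> 2 ^ 35 * m" using linear[of 37 m] by simp
    then have "real (D 37 m) \<le> real (2 ^ 35 * m)" by (simp only: of_nat_le_iff)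
    also have "\<dots> = 2 powr 35 * real m" by (simp add: powr_numeral)
    also have "\<dots> \<le> real m powr (e - 1) * real m"
    proof (rule mult_right_mono)
      have "2 powr 35 \<le> 2 powr (16 * (e - 1))" using e by (intro powr_mono) auto
      also have "\<dots> = (2 powr 16) powr (e - 1)" by (simp only: powr_powr)
      also have "\<dots> = 65536 powr (e - 1)" by (simp add: powr_numeral)
      also have "\<dots> \<le> real m powr (e - 1)" using 4 e by (intro powr_mono2) auto
      finally show "2 powr 35 \<le> real m powr (e - 1)" .
    qed simp
    also have "\<dots> = real m powr e" using 4 powr_add[of "real m" "e - 1" 1] by simp
    finally show ?thesis by (simp add: e_def)
  qed
qed

end

section \<open>Power bounds in growing dimension\<close>

text \<open>Divided by \<open>m powr log 2 h = h powr log 2 m\<close> and with \<open>y = d / m\<close>, the step from \<open>h - \<delta>\<close> to \<open>h\<close> asks for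
  \<open>(1 - \<delta> / h) powr log 2 m + 2 / h * (1 - y) powr log 2 h + 2 / h powr log 2 m \<le> 1\<close>. Bounding both powers by
  \<open>exp (- z) \<le> 1 / (1 + z + z\<^sup>2 / 2)\<close> leaves a comparison with \<open>gain (\<delta> * log 2 m) h\<close>, which is monotone in both
  arguments and so has to be checked only at the start of a range of dimensions.\<close>

definition gain :: "real \<Rightarrow> real \<Rightarrow> real" where
  "gain c h = h * c * (2 * h + c) / (2 * h ^ 2 + 2 * h * c + c ^ 2)"

text \<open>Two forms for the two monotonicities: the first shows growth in \<open>c\<close>. The
  second shows growth in \<open>h\<close>, as \<open>(1 + s / 2) / (1 + s + s ^ 2 / 2)\<close>
  decreases in \<open>s\<close>.\<close>

lemma gain_eq:
  assumes "h > 0" "c \<ge> 0"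
  shows "gain c h = h * (1 - 1 / (1 + c / h + (c / h) ^ 2 / 2))"
    and "gain c h = c * ((1 + c / h / 2) / (1 + c / h + (c / h) ^ 2 / 2))"
proof -
  define N where "N = 2 * h ^ 2 + 2 * h * c + c ^ 2"
  have pos: "N > 0" using assms by (simp add: N_def add_pos_nonneg)
  have D: "1 + c / h + (c / h) ^ 2 / 2 = N / (2 * h ^ 2)"
    using assms(1) by (simp add: N_def power2_eq_square field_simps)
  have "h * (1 - 1 / (1 + c / h + (c / h) ^ 2 / 2)) = h * ((N - 2 * h ^ 2) / N)"
    unfolding D using pos by (simp add: diff_divide_distrib)
  also have "N - 2 * h ^ 2 = c * (2 * h + c)" by (simp add: N_def power2_eq_square algebra_simps)
  finally show "gain c h = h * (1 - 1 / (1 + c / h + (c / h) ^ 2 / 2))"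
    by (simp add: gain_def N_def mult_ac)
  have "c * ((1 + c / h / 2) / (1 + c / h + (c / h) ^ 2 / 2)) = c * ((1 + c / h / 2) * (2 * h ^ 2)) / N"
    unfolding D by simp
  also have "(1 + c / h / 2) * (2 * h ^ 2) = h * (2 * h + c)"
    using assms(1) by (simp add: power2_eq_square field_simps)
  finally show "gain c h = c * ((1 + c / h / 2) / (1 + c / h + (c / h) ^ 2 / 2))"
    by (simp add: gain_def N_def mult_ac)
qed

lemma gain_mono:
  assumes "0 \<le> c" "c \<le> c'" "0 < h" "h \<le> h'"
  shows "gain c h \<le> gain c' h'"
proof -
  define s s' where "s = c / h'" and "s' = c / h"
  have s: "0 \<le> s" "s \<le> s'" using assms by (auto simp: s_def s'_def intro: divide_left_mono)
  have pos: "1 + x + x ^ 2 / 2 > 0" if "x \<ge> 0" for x :: real using that by (simp add: add_pos_nonneg)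
  have diff: "(1 + s / 2) * (1 + s' + s' ^ 2 / 2) - (1 + s' / 2) * (1 + s + s ^ 2 / 2)
      = (s' - s) / 2 + (s' - s) * (s' + s) / 2 + s * s' * (s' - s) / 4"
    by (simp add: power2_eq_square field_simps)
  have "0 \<le> (s' - s) / 2 + (s' - s) * (s' + s) / 2 + s * s' * (s' - s) / 4"
    using s by (intro add_nonneg_nonneg mult_nonneg_nonneg divide_nonneg_nonneg) auto
  then have "(1 + s' / 2) * (1 + s + s ^ 2 / 2) \<le> (1 + s / 2) * (1 + s' + s' ^ 2 / 2)" using diff by linarith
  then have "(1 + s' / 2) / (1 + s' + s' ^ 2 / 2) \<le> (1 + s / 2) / (1 + s + s ^ 2 / 2)"
    using pos[of s] pos[of s'] s by (simp add: frac_le_eq divide_le_eq pos_divide_le_eq) (simp add: field_simps)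
  then have "gain c h \<le> gain c h'"
    using assms by (simp only: gain_eq(2) s_def s'_def) (intro mult_left_mono, auto)
  also have "gain c h' \<le> gain c' h'"
  proof -
    have h': "h' > 0" using assms by simp
    have le: "c / h' \<le> c' / h'" "0 \<le> c / h'" using assms h' by (auto simp: divide_right_mono)
    have "1 + c / h' + (c / h') ^ 2 / 2 \<le> 1 + c' / h' + (c' / h') ^ 2 / 2"
      using le(1) power_mono[OF le, of 2] by linarith
    then have "1 / (1 + c' / h' + (c' / h') ^ 2 / 2) \<le> 1 / (1 + c / h' + (c / h') ^ 2 / 2)"
      using pos[of "c / h'"] le by (intro divide_left_mono mult_pos_pos) (auto intro: less_le_trans)
    then show ?thesis using assms h' by (simp only: gain_eq(1)) (intro mult_left_mono, auto)
  qed
  finally show ?thesis .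
qed

text \<open>For \<open>m = t d\<close> the pairs bound \<open>log 2 t\<close> and \<open>1 / t\<close> from below; half an octave of \<open>t\<close> per pair.\<close>

definition octaves :: "(real \<times> real) list" where
  "octaves = concat (map (\<lambda>a. [(real a, 7071 / 10000 / 2 ^ a), (real a + 1 / 2, 1 / 2 / 2 ^ a)]) [0..<9]) @ [(9, 0)]"

lemma octaves_cover:
  assumes "t \<ge> 1"
  obtains l w where "(l, w) \<in> set octaves" "0 \<le> l" "l \<le> log 2 t" "0 \<le> w" "w \<le> 1 / t"
proof -
  define a where "a = nat \<lfloor>log 2 t\<rfloor>"
  have l0: "log 2 t \<ge> 0" using assms by simp
  have a: "real a \<le> log 2 t" "log 2 t < real a + 1" using l0 by (auto simp: a_def)
  have ta: "2 powr log 2 t = t" using assms by simp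
  consider "a \<ge> 9" | "a < 9" "log 2 t \<le> real a + 1 / 2" | "a < 9" "real a + 1 / 2 < log 2 t" by linarith
  then show ?thesis
  proof cases
    case 1
    then show ?thesis using a assms by (intro that[of 9 0]) (auto simp: octaves_def)
  next
    case 2
    have "t \<le> 2 powr (real a + 1 / 2)" using 2(2) ta by (metis powr_mono one_le_numeral)
    also have "\<dots> = 2 ^ a * sqrt 2" by (simp add: powr_add powr_realpow powr_half_sqrt)
    also have "\<dots> \<le> 2 ^ a * (10000 / 7071)"
    proof (rule mult_left_mono)
      show "sqrt 2 \<le> 10000 / 7071" by (rule real_le_lsqrt) (auto simp: power2_eq_square)
    qed simp
    finally have "7071 / 10000 / 2 ^ a \<le> 1 / t" using assms by (simp add: field_simps)
    moreover have "(real a, 7071 / 10000 / 2 ^ a) \<in> set octaves" using 2(1) by (auto simp: octaves_def)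
    ultimately show ?thesis using a by (intro that) auto
  next
    case 3
    have "t \<le> 2 powr (real a + 1)" using a ta by (metis powr_mono one_le_numeral less_imp_le)
    also have "\<dots> = 2 ^ a * 2" by (simp add: powr_add powr_realpow)
    finally have "1 / 2 / 2 ^ a \<le> 1 / t" using assms by (simp add: field_simps)
    moreover have "(real a + 1 / 2, 1 / 2 / 2 ^ a) \<in> set octaves" using 3(1) by (auto simp: octaves_def)
    ultimately show ?thesis using a 3 by (intro that) auto
  qed
qed

text \<open>\<open>l\<close> and \<open>e\<close> stand for lower bounds of \<open>log 2 d\<close>
  and \<open>log 2 h\<close>, \<open>k\<close> and \<open>w\<close> for those of
  \<open>log 2 (m / d)\<close> and \<open>d / m\<close>. The term \<open>2 / h ^ 2\<close> pays for
  the additive 2 of the recursion.\<close>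

definition slope_ok :: "real \<Rightarrow> real \<Rightarrow> real \<Rightarrow> real \<Rightarrow> bool" where
  "slope_ok \<delta> h l e \<longleftrightarrow>
     list_all (\<lambda>(k, w). 2 / (1 + e * w + (e * w) ^ 2 / 2) + 2 / h ^ 2 \<le> gain (\<delta> * (l + k)) h) octaves"

lemma exp_minus_le:
  fixes z :: real
  assumes "0 \<le> a" "a \<le> z"
  shows "exp (- z) \<le> 1 / (1 + a + a ^ 2 / 2)"
proof -
  have pos: "1 + a + a ^ 2 / 2 > 0" using assms by (simp add: add_pos_nonneg)
  have "1 + a + a ^ 2 / 2 \<le> exp a" using exp_lower_Taylor_quadratic assms(1) by simp
  also have "\<dots> \<le> exp z" using assms by simp
  finally have "1 / exp z \<le> 1 / (1 + a + a ^ 2 / 2)" using pos by (intro divide_left_mono) auto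
  then show ?thesis by (simp add: exp_minus inverse_eq_divide)
qed

lemma slope_ineq:
  fixes m d h \<delta> :: real
  assumes ok: "slope_ok \<delta> H l e" and \<delta>: "0 < \<delta>" "\<delta> < h" and H: "1 \<le> H" "H \<le> h"
    and l: "3 \<le> l" "l \<le> log 2 d" and e: "0 \<le> e" "e \<le> log 2 h" and m: "0 < d" "d \<le> m"
  shows "m powr log 2 (h - \<delta>) + 2 * ((m - d) / 2) powr log 2 h + 2 \<le> m powr log 2 h"
proof -
  define x where "x = log 2 m"
  have m0: "m > 0" using m by simp
  have h0: "h > 0" "h \<ge> 1" using H by auto
  obtain k w where kw: "(k, w) \<in> set octaves" "0 \<le> k" "k \<le> log 2 (m / d)" "0 \<le> w" "w \<le> 1 / (m / d)"
    using octaves_cover[of "m / d"] m by auto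
  have x: "x = log 2 d + log 2 (m / d)" using m m0 by (simp add: x_def log_divide)
  have lkx: "l + k \<le> x" using x kw(3) l(2) by simp
  have x3: "x \<ge> 3" using lkx kw(2) l(1) by simp
  have crit: "2 / (1 + e * w + (e * w) ^ 2 / 2) + 2 / H ^ 2 \<le> gain (\<delta> * (l + k)) H"
    using ok kw(1) unfolding slope_ok_def list_all_iff by fastforce
  define g where "g = gain (\<delta> * x) h"
  have "gain (\<delta> * (l + k)) H \<le> g"
    unfolding g_def using \<delta> l kw lkx H by (intro gain_mono mult_left_mono) auto
  with crit have g: "2 / (1 + e * w + (e * w) ^ 2 / 2) + 2 / H ^ 2 \<le> g" by simp
  define z where "z = \<delta> * x / h"
  have z0: "z \<ge> 0" using \<delta> x3 h0 by (simp add: z_def)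
  have geq: "g = h * (1 - 1 / (1 + z + z ^ 2 / 2))"
    unfolding g_def z_def using h0 \<delta> x3 by (intro gain_eq(1)) auto
  define M where "M = h powr x"
  have M: "m powr log 2 h = M" unfolding M_def x_def using m0 h0 by (intro powr_log_commute) auto
  have M0: "M > 0" using h0 by (simp add: M_def)
  have A: "m powr log 2 (h - \<delta>) \<le> M * (1 / (1 + z + z ^ 2 / 2))"
  proof -
    have "m powr log 2 (h - \<delta>) = (h - \<delta>) powr x" unfolding x_def using m0 \<delta> by (intro powr_log_commute) auto
    also have "\<dots> = (h * (1 - \<delta> / h)) powr x" using h0 by (simp add: right_diff_distrib)
    also have "\<dots> = M * (1 - \<delta> / h) powr x" unfolding M_def by (simp only: powr_mult)
    also have "(1 - \<delta> / h) powr x \<le> exp (- \<delta> / h) powr x"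
    proof (rule powr_mono2)
      show "1 - \<delta> / h \<le> exp (- \<delta> / h)" using exp_ge_add_one_self[of "- \<delta> / h"] by simp
    qed (use x3 h0 \<delta> in auto)
    also have "exp (- \<delta> / h) powr x = exp (- z)" by (simp add: powr_def z_def)
    also have "\<dots> \<le> 1 / (1 + z + z ^ 2 / 2)" using z0 by (intro exp_minus_le) auto
    finally show ?thesis using M0 by (simp add: mult_left_mono)
  qed
  have B: "((m - d) / 2) powr log 2 h \<le> M * (1 / h * (1 / (1 + e * w + (e * w) ^ 2 / 2)))"
  proof -
    have y: "0 \<le> 1 - d / m" using m m0 by simp
    have "(1 - d / m) powr log 2 h \<le> exp (- d / m) powr log 2 h"
    proof (rule powr_mono2)
      show "1 - d / m \<le> exp (- d / m)" using exp_ge_add_one_self[of "- d / m"] by simp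
    qed (use y h0 in auto)
    also have "exp (- d / m) powr log 2 h = exp (- (log 2 h * (d / m)))" by (simp add: powr_def)
    also have "\<dots> \<le> 1 / (1 + e * w + (e * w) ^ 2 / 2)"
      using e kw(4,5) h0 by (intro exp_minus_le mult_mono) auto
    finally have le: "(1 - d / m) powr log 2 h \<le> 1 / (1 + e * w + (e * w) ^ 2 / 2)" .
    have "(m - d) / 2 = m * ((1 / 2) * (1 - d / m))" using m0 by (simp add: right_diff_distrib)
    then have "((m - d) / 2) powr log 2 h = (m * ((1 / 2) * (1 - d / m))) powr log 2 h" by (simp only:)
    also have "\<dots> = m powr log 2 h * ((1 / 2) powr log 2 h * (1 - d / m) powr log 2 h)"
      by (simp only: powr_mult)
    also have "(1 / 2) powr log 2 h = 1 / h" using h0 by (simp add: powr_divide)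
    finally have "((m - d) / 2) powr log 2 h = M * (1 / h * (1 - d / m) powr log 2 h)" by (simp only: M)
    then show ?thesis
      using M0 h0 le by (simp only:) (intro mult_left_mono, auto)
  qed
  \<comment> \<open>Since \<open>log 2 m \<ge> 3\<close>, the bound \<open>M\<close> is at least
    \<open>h ^ 3\<close>; this is the purpose of \<open>3 \<le> l\<close>.\<close>
  have C: "1 \<le> M * (1 / h * (1 / H ^ 2))"
  proof -
    have "h * H ^ 2 \<le> h * h ^ 2" using H by (intro mult_left_mono power_mono) auto
    also have "\<dots> = h powr 3" using h0 by (simp add: powr_numeral power_numeral_reduce)
    also have "\<dots> \<le> M" unfolding M_def using x3 h0 by (intro powr_mono) auto
    finally show ?thesis using h0 H by (simp add: field_simps)
  qed
  have "m powr log 2 (h - \<delta>) + 2 * ((m - d) / 2) powr log 2 h + 2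
      \<le> M * (1 / (1 + z + z ^ 2 / 2)) + 2 * (M * (1 / h * (1 / (1 + e * w + (e * w) ^ 2 / 2)))) + 2 * (M * (1 / h * (1 / H ^ 2)))"
    using A B C by linarith
  also have "\<dots> = M * (1 / (1 + z + z ^ 2 / 2) + 1 / h * (2 / (1 + e * w + (e * w) ^ 2 / 2) + 2 / H ^ 2))"
    by (simp add: algebra_simps)
  also have "\<dots> \<le> M * (1 / (1 + z + z ^ 2 / 2) + 1 / h * g)"
    using g h0 M0 by (intro mult_left_mono add_left_mono) auto
  also have "\<dots> = M" unfolding geq using h0 by simp
  finally show ?thesis using M by simp
qed

lemma powr_log_mono: "0 < h \<Longrightarrow> h \<le> h' \<Longrightarrow> real m powr log 2 h \<le> real m powr log 2 h'"
  by (cases "m = 0") (auto intro!: powr_mono)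

lemma le_log2:
  assumes "2 ^ p \<le> x ^ q" "0 < x" "0 < q"
  shows "real p / real q \<le> log 2 x"
proof -
  have "real p = log 2 (2 ^ p)" by (rule log_pow_cancel[symmetric]) auto
  also have "\<dots> \<le> log 2 (x ^ q)" using assms by (subst log_le_cancel_iff) auto
  also have "\<dots> = real q * log 2 x" using assms(2) by (simp add: log_nat_power)
  finally show ?thesis using assms(3) by (simp add: field_simps)
qed

lemmas slope_simps = slope_ok_def octaves_def gain_def upt_rec power2_eq_square power_divide

section \<open>Induction on the dimension with prescribed slopes\<close>

context diameter_recursion
begin

lemma D_step:
  assumes IH: "\<And>m. real (D d m) \<le> real m powr log 2 (h - \<delta>)" and d: "d \<ge> 2"
    and ok: "slope_ok \<delta> H l e" and \<delta>: "0 < \<delta>" "\<delta> < h" and H: "1 \<le> H" "H \<le> h"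
    and l: "3 \<le> l" "l \<le> log 2 (Suc d)" and e: "0 \<le> e" "e \<le> log 2 h"
  shows "real (D (Suc d) m) \<le> real m powr log 2 h"
proof (induction m rule: less_induct)
  case (less m)
  have step: "real m powr log 2 (h - \<delta>) + 2 * ((real m - Suc d) / 2) powr log 2 h + 2 \<le> real m powr log 2 h"
    if "Suc d \<le> m"
    by (rule slope_ineq[OF ok \<delta> H l e]) (use that in auto)
  consider "m \<le> d" | "m = Suc d" | "Suc d < m" by linarith
  then show ?case
  proof cases
    case 1
    have "D (Suc d) m \<le> D d m" using low 1 d by simp
    then have "real (D (Suc d) m) \<le> real m powr log 2 (h - \<delta>)" using IH[of m] by linarith
    also have "\<dots> \<le> real m powr log 2 h" using \<delta> by (intro powr_log_mono) auto
    finally show ?thesis .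
  next
    case 2
    have "D (Suc d) m \<le> D d m + 1" using split_eq[of d] D_0[of "Suc d"] d 2 by simp
    then have "real (D (Suc d) m) \<le> real m powr log 2 (h - \<delta>) + 1" using IH[of m] by linarith
    also have "\<dots> \<le> real m powr log 2 h"
      using step 2 powr_ge_zero[of "(real m - Suc d) / 2" "log 2 h"] by simp
    finally show ?thesis .
  next
    case 3
    let ?a = "(m - Suc d) div 2" and ?b = "(m - Suc d - 1) div 2"
    have lh: "0 \<le> log 2 h" using H by simp
    have half: "real (D (Suc d) a) \<le> ((real m - Suc d) / 2) powr log 2 h" if "a \<le> ?a" for a
    proof -
      have "2 * a \<le> m - Suc d" using that by presburger
      then have "real (2 * a) \<le> real (m - Suc d)" by (simp only: of_nat_le_iff)
      then have a: "real a \<le> (real m - Suc d) / 2" using 3 by (simp add: of_nat_diff)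
      have "real (D (Suc d) a) \<le> real a powr log 2 h" by (rule less.IH) (use that 3 in auto)
      also have "\<dots> \<le> ((real m - Suc d) / 2) powr log 2 h" using a lh by (intro powr_mono2) auto
      finally show ?thesis .
    qed
    have "D (Suc d) m \<le> D d m + D (Suc d) ?a + D (Suc d) ?b + 2" using split[of d m] d 3 by simp
    then have "real (D (Suc d) m) \<le> real (D d m) + real (D (Suc d) ?a) + real (D (Suc d) ?b) + 2" by linarith
    also have "\<dots> \<le> real m powr log 2 (h - \<delta>) + ((real m - Suc d) / 2) powr log 2 h
        + ((real m - Suc d) / 2) powr log 2 h + 2"
      by (intro add_mono IH half order.refl) (auto intro: div_le_mono)
    also have "\<dots> \<le> real m powr log 2 h" using step 3 by simp
    finally show ?thesis .
  qed
qed

text \<open>\<open>p / 20\<close> and \<open>r / 20\<close> are rational lower bounds of the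
  logarithms of \<open>Suc d1\<close> and of \<open>h1 + \<delta>\<close>, certified by 20th powers.
  By monotonicity the test at this first step covers all larger dimensions.\<close>

lemma D_slope:
  assumes base: "\<And>m. real (D d1 m) \<le> real m powr log 2 h1" and d: "2 \<le> d1" "d1 \<le> d"
    and ok: "slope_ok \<delta> (h1 + \<delta>) (real p / 20) (real r / 20)" and \<delta>: "0 < \<delta>" and h1: "1 \<le> h1"
    and p: "60 \<le> p" "2 ^ p \<le> real (Suc d1) ^ 20" and r: "2 ^ r \<le> (h1 + \<delta>) ^ 20"
  shows "real (D d m) \<le> real m powr log 2 (h1 + \<delta> * real (d - d1))"
  using d(2)
proof (induction d arbitrary: m rule: dec_induct)
  case base
  then show ?case using assms(1) by simp
next
  case (step d)
  define h where "h = h1 + \<delta> * real (Suc d - d1)"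
  have hd: "h - \<delta> = h1 + \<delta> * real (d - d1)"
    using step(1) by (simp add: h_def Suc_diff_le algebra_simps)
  have "0 \<le> \<delta> * real (d - d1)" using \<delta> by simp
  then have h: "h1 + \<delta> \<le> h" using hd by linarith
  have "real (D (Suc d) m) \<le> real m powr log 2 h"
  proof (rule D_step[OF _ _ ok])
    show "real (D d m) \<le> real m powr log 2 (h - \<delta>)" for m using step.IH hd by simp
    show "3 \<le> real p / 20" using p(1) by simp
    have "real p / 20 \<le> log 2 (Suc d1)" using le_log2[OF p(2)] by simp
    also have "\<dots> \<le> log 2 (Suc d)" using step(1) by simp
    finally show "real p / 20 \<le> log 2 (Suc d)" .
    have "real r / 20 \<le> log 2 (h1 + \<delta>)" using le_log2[OF r] h1 \<delta> by simp
    also have "\<dots> \<le> log 2 h" using h h1 \<delta> by simp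
    finally show "real r / 20 \<le> log 2 h" .
  qed (use d step h h1 \<delta> in auto)
  then show ?case by (simp add: h_def)
qed

text \<open>The slopes are the least multiples of \<open>1 / 1000\<close> that pass the test on their range; they reach \<open>1 / 8\<close> while the
  base is still below \<open>16 + d / 8\<close>.\<close>

lemma D_from_37:
  "37 \<le> d \<Longrightarrow> d \<le> 48 \<Longrightarrow> real (D d m) \<le> real m powr log 2 (37 / 4 + 213 / 1000 * real (d - 37))"
  by (rule D_slope[where p = 104 and r = 64]) (simp_all add: slope_simps D_37)

text \<open>The base continues the preceding bound:
  \<open>37 / 4 + 213 / 1000 * 11 = 11593 / 1000\<close>. The same holds for each lemma that
  follows; the ranges grow by a factor of about 1.3.\<close>

lemma D_from_48:
  "48 \<le> d \<Longrightarrow> d \<le> 62 \<Longrightarrow> real (D d m) \<le> real m powr log 2 (11593 / 1000 + 49 / 250 * real (d - 48))"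
  by (rule D_slope[where p = 112 and r = 71]) (use D_from_37[of 48] in \<open>simp_all add: slope_simps\<close>)

lemma D_from_62:
  "62 \<le> d \<Longrightarrow> d \<le> 81 \<Longrightarrow> real (D d m) \<le> real m powr log 2 (14337 / 1000 + 183 / 1000 * real (d - 62))"
  by (rule D_slope[where p = 119 and r = 77]) (use D_from_48[of 62] in \<open>simp_all add: slope_simps\<close>)

lemma D_from_81:
  "81 \<le> d \<Longrightarrow> d \<le> 105 \<Longrightarrow> real (D d m) \<le> real m powr log 2 (8907 / 500 + 43 / 250 * real (d - 81))"
  by (rule D_slope[where p = 127 and r = 83]) (use D_from_62[of 81] in \<open>simp_all add: slope_simps\<close>)

lemma D_from_105:
  "105 \<le> d \<Longrightarrow> d \<le> 136 \<Longrightarrow> real (D d m) \<le> real m powr log 2 (10971 / 500 + 163 / 1000 * real (d - 105))"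
  by (rule D_slope[where p = 134 and r = 89]) (use D_from_81[of 105] in \<open>simp_all add: slope_simps\<close>)

lemma D_from_136:
  "136 \<le> d \<Longrightarrow> d \<le> 177 \<Longrightarrow> real (D d m) \<le> real m powr log 2 (5399 / 200 + 39 / 250 * real (d - 136))"
  by (rule D_slope[where p = 141 and r = 95]) (use D_from_105[of 136] in \<open>simp_all add: slope_simps\<close>)

lemma D_from_177:
  "177 \<le> d \<Longrightarrow> d \<le> 230 \<Longrightarrow> real (D d m) \<le> real m powr log 2 (33391 / 1000 + 37 / 250 * real (d - 177))"
  by (rule D_slope[where p = 149 and r = 101]) (use D_from_136[of 177] in \<open>simp_all add: slope_simps\<close>)

lemma D_from_230:
  "230 \<le> d \<Longrightarrow> d \<le> 299 \<Longrightarrow> real (D d m) \<le> real m powr log 2 (8247 / 200 + 71 / 500 * real (d - 230))"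
  by (rule D_slope[where p = 157 and r = 107]) (use D_from_177[of 230] in \<open>simp_all add: slope_simps\<close>)

lemma D_from_299:
  "299 \<le> d \<Longrightarrow> d \<le> 389 \<Longrightarrow> real (D d m) \<le> real m powr log 2 (51033 / 1000 + 137 / 1000 * real (d - 299))"
  by (rule D_slope[where p = 164 and r = 113]) (use D_from_230[of 299] in \<open>simp_all add: slope_simps\<close>)

lemma D_from_389:
  "389 \<le> d \<Longrightarrow> d \<le> 506 \<Longrightarrow> real (D d m) \<le> real m powr log 2 (63363 / 1000 + 33 / 250 * real (d - 389))"
  by (rule D_slope[where p = 172 and r = 119]) (use D_from_299[of 389] in \<open>simp_all add: slope_simps\<close>)

lemma D_from_506:
  "506 \<le> d \<Longrightarrow> d \<le> 658 \<Longrightarrow> real (D d m) \<le> real m powr log 2 (78807 / 1000 + 127 / 1000 * real (d - 506))"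
  by (rule D_slope[where p = 179 and r = 126]) (use D_from_389[of 506] in \<open>simp_all add: slope_simps\<close>)

lemma D_from_658:
  "658 \<le> d \<Longrightarrow> real (D d m) \<le> real m powr log 2 (98111 / 1000 + 1 / 8 * real (d - 658))"
  by (rule D_slope[where p = 187 and r = 132]) (use D_from_506[of 658] in \<open>simp_all add: slope_simps\<close>)

lemma D_half:
  assumes "7 \<le> d"
  shows "real (D d m) \<le> real m powr log 2 (real d / 2)"
proof (cases "d = 7")
  case True
  then show ?thesis using D_7[of m] by simp
next
  case False
  then have d: "8 \<le> d" using assms by simp
  have "real (D d m) \<le> real m powr log 2 (8 / 2 + 1 / 2 * real (d - 8))"
    by (rule D_slope[OF D_8 _ d, where p = 63 and r = 43]) (simp_all add: slope_simps)
  also have "8 / 2 + 1 / 2 * real (d - 8) = real d / 2" using d by (simp add: of_nat_diff field_simps)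
  finally show ?thesis .
qed

lemma D_quarter:
  assumes "37 \<le> d"
  shows "real (D d m) \<le> real m powr log 2 (real d / 4)"
proof -
  have "real (D d m) \<le> real m powr log 2 (37 / 4 + 1 / 4 * real (d - 37))"
    by (rule D_slope[OF D_37 _ assms, where p = 104 and r = 64]) (simp_all add: slope_simps)
  also have "37 / 4 + 1 / 4 * real (d - 37) = real d / 4" using assms by (simp add: of_nat_diff field_simps)
  finally show ?thesis .
qed

lemma D_1_le: "1 \<le> d \<Longrightarrow> D d 1 \<le> 1"
proof (induction d rule: dec_induct)
  case base then show ?case by (rule D1)
next
  case (step d)
  then show ?case using low[of d 1] by simp
qed

lemma D_2_le: "2 \<le> d \<Longrightarrow> D d 2 \<le> 2"
proof (induction d rule: dec_induct)
  case base then show ?case using linear[of 2 2] by simp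
next
  case (step d)
  then show ?case using low[of d 2] by simp
qed

text \<open>The base \<open>16 + d / 8\<close> exceeds 16, so in the dimensions below the tables a
  fourth power is allowed. From \<open>m = 3\<close> on, \<open>2 ^ 4 \<le> m ^ 3\<close> lets the
  linear bound suffice.\<close>

lemma D_small_dim:
  assumes "1 \<le> d" "d \<le> 6"
  shows "D d m \<le> m ^ 4"
proof -
  consider "m = 0" | "m = 1" | "m \<ge> 2" "d = 1" | "m = 2" "d \<ge> 2" | "m \<ge> 3" "d \<ge> 2" using assms by linarith
  then show ?thesis
  proof cases
    case 1
    have "D d 0 = 0"
    proof (cases "d = 1")
      case True then show ?thesis using D10 by simp
    next
      case False then show ?thesis using D_0[of d] assms by simp
    qed
    then show ?thesis using 1 by simp
  next
    case 2 then show ?thesis using D_1_le[OF assms(1)] by simp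
  next
    case 3
    have "D d m \<le> 1" using D1[of m] 3(2) by (simp only:)
    also have "1 \<le> m ^ 4" using 3 by simp
    finally show ?thesis .
  next
    case 4 then show ?thesis using D_2_le[of d] by simp
  next
    case 5
    have "D d m \<le> 2 ^ (d - 2) * m" using linear[of d m] 5 by simp
    also have "\<dots> \<le> 2 ^ 4 * m" using assms by (intro mult_right_mono power_increasing) auto
    also have "\<dots> \<le> m ^ 3 * m"
    proof (rule mult_right_mono)
      have "(3::nat) ^ 3 \<le> m ^ 3" using 5 by (intro power_mono) auto
      then show "2 ^ 4 \<le> m ^ 3" by simp
    qed simp
    also have "\<dots> = m ^ 4" by (simp add: eval_nat_numeral)
    finally show ?thesis .
  qed
qed

lemma D_eighth_large:
  assumes "129 \<le> d"
  shows "real (D d m) \<le> real m powr log 2 (16 + real d / 8)"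
proof -
  \<comment> \<open>All slopes are at least \<open>1 / 8\<close>, so the excess over
    \<open>16 + d / 8\<close> grows along a range and needs checking only at its right end
    \<open>u\<close>. In the last range it is constant and negative.\<close>
  have *: ?thesis if bound: "real (D d m) \<le> real m powr log 2 (h + \<delta> * real (d - e))"
    and u: "h + \<delta> * real (u - e) \<le> 16 + real u / 8" "1 / 8 \<le> \<delta>" "e \<le> d" "d \<le> u" "0 < h" for h \<delta> e u
  proof -
    have eqs: "real (u - e) = real u - real e" "real (d - e) = real d - real e"
      using u by (simp_all add: of_nat_diff)
    have "1 / 8 * (real u - real d) \<le> \<delta> * (real u - real d)"
      using u by (intro mult_right_mono) auto
    moreover have "h + \<delta> * (real d - real e) = h + \<delta> * (real u - real e) - \<delta> * (real u - real d)"
      by (simp add: algebra_simps)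
    ultimately have le: "h + \<delta> * real (d - e) \<le> 16 + real d / 8"
      using u(1) unfolding eqs by argo
    have "0 \<le> \<delta> * real (d - e)" using u(2) by simp
    then have "0 < h + \<delta> * real (d - e)" using u(5) by linarith
    then show ?thesis using powr_log_mono[OF _ le, of m] bound by linarith
  qed
  consider "d \<le> 136" | "136 \<le> d" "d \<le> 177" | "177 \<le> d" "d \<le> 230" | "230 \<le> d" "d \<le> 299"
    | "299 \<le> d" "d \<le> 389" | "389 \<le> d" "d \<le> 506" | "506 \<le> d" "d \<le> 658" | "658 \<le> d" by linarith
  then show ?thesis
  proof cases
    case 1 show ?thesis by (rule *[OF D_from_105, where u = 136]) (use assms 1 in simp_all)
  next
    case 2 show ?thesis by (rule *[OF D_from_136[OF 2], where u = 177]) (use 2 in simp_all)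
  next
    case 3 show ?thesis by (rule *[OF D_from_177[OF 3], where u = 230]) (use 3 in simp_all)
  next
    case 4 show ?thesis by (rule *[OF D_from_230[OF 4], where u = 299]) (use 4 in simp_all)
  next
    case 5 show ?thesis by (rule *[OF D_from_299[OF 5], where u = 389]) (use 5 in simp_all)
  next
    case 6 show ?thesis by (rule *[OF D_from_389[OF 6], where u = 506]) (use 6 in simp_all)
  next
    case 7 show ?thesis by (rule *[OF D_from_506[OF 7], where u = 658]) (use 7 in simp_all)
  next
    case 8
    show ?thesis
      by (rule *[OF D_from_658[OF 8], where u = d]) (use 8 in \<open>simp_all add: of_nat_diff field_simps\<close>)
  qed
qed

text \<open>\<open>d / 4 \<le> 16 + d / 8\<close> holds exactly up to \<open>d = 128\<close>, so the
  decreasing slopes are needed only from 129 on.\<close>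

lemma D_eighth:
  assumes "1 \<le> d"
  shows "real (D d m) \<le> real m powr log 2 (16 + real d / 8)"
proof -
  consider "d \<le> 6" | "7 \<le> d" "d \<le> 37" | "37 \<le> d" "d \<le> 128" | "129 \<le> d" by linarith
  then show ?thesis
  proof cases
    case 1
    have "real (D d m) \<le> real (m ^ 4)" using D_small_dim[OF assms 1] by (simp only: of_nat_le_iff)
    also have "\<dots> = real m powr log 2 16"
    proof -
      have "log 2 (2 ^ 4 :: real) = 4" by (subst log_pow_cancel) auto
      then have "log 2 (16 :: real) = 4" by simp
      then show ?thesis by (cases "m = 0") (simp_all add: powr_numeral)
    qed
    also have "\<dots> \<le> real m powr log 2 (16 + real d / 8)" by (intro powr_log_mono) auto
    finally show ?thesis .
  next
    case 2
    have "real (D d m) \<le> real m powr log 2 (real d / 2)" by (rule D_half[OF 2(1)])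
    also have "\<dots> \<le> real m powr log 2 (16 + real d / 8)" using 2 by (intro powr_log_mono) auto
    finally show ?thesis .
  next
    case 3
    have "real (D d m) \<le> real m powr log 2 (real d / 4)" by (rule D_quarter[OF 3(1)])
    also have "\<dots> \<le> real m powr log 2 (16 + real d / 8)" using 3 by (intro powr_log_mono) auto
    finally show ?thesis .
  next
    case 4 then show ?thesis by (rule D_eighth_large)
  qed
qed

end

section \<open>The extremal diameter as an instance of the recursion, and the theorem\<close>

definition max_diam :: "'a::euclidean_space itself \<Rightarrow> nat \<Rightarrow> nat \<Rightarrow> nat" where
  "max_diam T d m = (LEAST k. diam_bound T d m k)"

lemma diam_bound_max_diam: "1 \<le> d \<Longrightarrow> diam_bound TYPE('a::euclidean_space) d m (max_diam TYPE('a) d m)"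
  unfolding max_diam_def by (rule LeastI_ex) (rule diam_bound_exists)

lemma max_diam_le: "diam_bound T d m k \<Longrightarrow> max_diam T d m \<le> k"
  unfolding max_diam_def by (rule Least_le)

lemma diameter_recursion_max_diam: "diameter_recursion (max_diam TYPE('a::euclidean_space))"
proof
  fix d m :: nat
  note b = diam_bound_max_diam[where 'a = 'a]
  show "max_diam TYPE('a) (Suc d) m \<le> max_diam TYPE('a) d m" if "1 \<le> d" "m \<le> d"
    by (rule max_diam_le, rule diam_bound_low[OF b[OF that(1)] that(2)])
  show "max_diam TYPE('a) (Suc d) (Suc d) \<le> max_diam TYPE('a) d (Suc d) + max_diam TYPE('a) (Suc d) 0 + 1"
    if "1 \<le> d"
    using max_diam_le[OF diam_bound_Kalai_Kleitman_eq[OF b[OF that] b[of "Suc d"]]] by simp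
  show "max_diam TYPE('a) (Suc d) m \<le> max_diam TYPE('a) d m + max_diam TYPE('a) (Suc d) ((m - Suc d) div 2)
      + max_diam TYPE('a) (Suc d) ((m - Suc d - 1) div 2) + 2" if "1 \<le> d" "Suc d < m"
    using max_diam_le[OF diam_bound_Kalai_Kleitman[OF b[OF that(1)] that(2) b[of "Suc d"] b[of "Suc d"]]] by simp
  show "max_diam TYPE('a) d m \<le> 2 ^ (d - 2) * m" if "2 \<le> d"
    by (rule max_diam_le, rule diam_bound_linear[OF that])
  show "max_diam TYPE('a) d m \<le> 2 ^ (d - 2) * m + 1 - 2 ^ (d - 3) * d" if "3 \<le> d" "d \<le> m"
    by (rule max_diam_le, rule diam_bound_linear'[OF that])
  show "max_diam TYPE('a) 1 m \<le> 1" by (rule max_diam_le, rule diam_bound_1)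
  show "max_diam TYPE('a) 1 0 = 0" using max_diam_le[OF diam_bound_1_0[where 'a = 'a]] by simp
qed

lemma graph_diameter_le:
  fixes P :: "'a::euclidean_space set"
  assumes P: "P \<in> polyhedra d n" and d: "1 \<le> d" "d \<le> n"
    and le: "real (max_diam TYPE('a) d (n - d)) \<le> x"
  shows "ereal_of_enat (graph_diameter P) \<le> ereal x"
proof -
  let ?k = "max_diam TYPE('a) d (n - d)"
  have poly: "polyhedron P" "aff_dim P = int d" "card (facets P) = n"
    using P by (auto simp: polyhedra_def)
  have "facets P = {G. G facet_of P}" by (rule facets_eq_facet_of) (use poly d in auto)
  then have "diam_le P ?k"
    using poly d by (intro diam_boundD[OF diam_bound_max_diam[OF d(1)]]) auto
  then have "graph_diameter P \<le> enat ?k"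
    unfolding graph_diameter_def diam_le_def by (intro Inf_lower) blast
  then have "ereal_of_enat (graph_diameter P) \<le> ereal_of_enat (enat ?k)"
    by (simp only: ereal_of_enat_le_iff)
  also have "\<dots> = ereal (real ?k)" by simp
  also have "\<dots> \<le> ereal x" using le by simp
  finally show ?thesis .
qed

text \<open>The error is \<open>log 2 (1 + 128 / d)\<close>, because
  \<open>16 + d / 8 = (1 + 128 / d) * (d / 8)\<close>; the constant comes from
  \<open>ln (1 + x) \<le> x\<close>.\<close>

lemma log_shift_bigo:
  "(\<lambda>d::nat. log 2 (16 + real d / 8) - (-3 + log 2 (real d))) \<in> O(\<lambda>d. 1 / real d)"
proof (rule bigoI[where c = "128 / ln 2"])
  show "\<forall>\<^sub>F d in at_top. norm (log 2 (16 + real d / 8) - (-3 + log 2 (real d))) \<le> 128 / ln 2 * norm (1 / real d)"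
    using eventually_ge_at_top[of "1::nat"]
  proof eventually_elim
    case (elim d)
    have d: "real d > 0" using elim by simp
    have "16 + real d / 8 = (1 + 128 / real d) * (real d / 8)" using d by (simp add: field_simps)
    moreover have "log 2 ((1 + 128 / real d) * (real d / 8)) = log 2 (1 + 128 / real d) + log 2 (real d / 8)"
      by (rule log_mult_pos) (use d in \<open>simp_all add: add_pos_pos\<close>)
    ultimately have "log 2 (16 + real d / 8) = log 2 (1 + 128 / real d) + log 2 (real d / 8)" by (simp only:)
    also have "log 2 (real d / 8) = log 2 (real d) - log 2 (2 ^ 3)" using d by (simp add: log_divide_pos)
    also have "log 2 (2 ^ 3 :: real) = 3" by (subst log_pow_cancel) auto
    finally have eq: "log 2 (16 + real d / 8) - (-3 + log 2 (real d)) = ln (1 + 128 / real d) / ln 2"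
      by (simp add: log_def)
    have "0 \<le> ln (1 + 128 / real d)" using d by simp
    moreover have "ln (1 + 128 / real d) \<le> 128 / real d" by (rule ln_add_one_self_le_self) (use d in simp)
    ultimately have "ln (1 + 128 / real d) / ln 2 \<le> 128 / real d / ln 2"
      "norm (ln (1 + 128 / real d) / ln 2) = ln (1 + 128 / real d) / ln 2"
      by (intro divide_right_mono, auto)
    then have "norm (ln (1 + 128 / real d) / ln 2) \<le> 128 / real d / ln 2" by (simp only:)
    also have "\<dots> = 128 / ln 2 * norm (1 / real d)" by simp
    finally show ?case unfolding eq .
  qed
qed

theorem theorem1:
  shows
   "(\<forall>d n :: nat. 7 \<le> d \<and> d \<le> n \<longrightarrow>
       (\<forall>P \<in> (polyhedra d n :: (real^'m) set set).
          ereal_of_enat (graph_diameter P) \<le> ereal ((real n - real d) powr log 2 (real d / 2))) \<and>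
       (real n - real d) powr log 2 (real d / 2) = (real n - real d) powr (-1 + log 2 (real d)))
    \<and>
    (\<forall>d n :: nat. 37 \<le> d \<and> d \<le> n \<longrightarrow>
       (\<forall>P \<in> (polyhedra d n :: (real^'m) set set).
          ereal_of_enat (graph_diameter P) \<le> ereal ((real n - real d) powr log 2 (real d / 4))) \<and>
       (real n - real d) powr log 2 (real d / 4) = (real n - real d) powr (-2 + log 2 (real d)))
    \<and>
    (\<forall>d n :: nat. 1 \<le> d \<and> d \<le> n \<longrightarrow>
       (\<forall>P \<in> (polyhedra d n :: (real^'m) set set).
          ereal_of_enat (graph_diameter P) \<le> ereal ((real n - real d) powr log 2 (16 + real d / 8))))
    \<and>
    (\<exists>\<epsilon> :: nat \<Rightarrow> real. \<epsilon> \<in> O(\<lambda>d. 1 / real d) \<and>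
       (\<forall>d\<ge>1. log 2 (16 + real d / 8) = -3 + log 2 (real d) + \<epsilon> d))"
proof -
  interpret diameter_recursion "max_diam TYPE(real^'m)" by (rule diameter_recursion_max_diam)
  have log_half: "log 2 (real d / 2) = -1 + log 2 (real d)"
    and log_quarter: "log 2 (real d / 4) = -2 + log 2 (real d)" if "1 \<le> d" for d :: nat
  proof -
    have "log 2 (2 ^ 2 :: real) = 2" by (subst log_pow_cancel) auto
    then have "log 2 (4 :: real) = 2" by simp
    then show "log 2 (real d / 2) = -1 + log 2 (real d)" "log 2 (real d / 4) = -2 + log 2 (real d)"
      using that by (simp_all add: log_divide_pos)
  qed
  have diff: "real n - real d = real (n - d)" if "d \<le> n" for d n :: nat
    using that by (simp add: of_nat_diff)
  have a: "ereal_of_enat (graph_diameter P) \<le> ereal ((real n - real d) powr log 2 (real d / 2))"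
    if "7 \<le> d" "d \<le> n" "P \<in> (polyhedra d n :: (real^'m) set set)" for d n P
    unfolding diff[OF that(2)]
    by (rule graph_diameter_le[OF that(3) _ that(2) D_half[OF that(1)]]) (use that(1) in linarith)
  have b: "ereal_of_enat (graph_diameter P) \<le> ereal ((real n - real d) powr log 2 (real d / 4))"
    if "37 \<le> d" "d \<le> n" "P \<in> (polyhedra d n :: (real^'m) set set)" for d n P
    unfolding diff[OF that(2)]
    by (rule graph_diameter_le[OF that(3) _ that(2) D_quarter[OF that(1)]]) (use that(1) in linarith)
  have c: "ereal_of_enat (graph_diameter P) \<le> ereal ((real n - real d) powr log 2 (16 + real d / 8))"
    if "1 \<le> d" "d \<le> n" "P \<in> (polyhedra d n :: (real^'m) set set)" for d n P
    unfolding diff[OF that(2)]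
    by (rule graph_diameter_le[OF that(3) that(1,2) D_eighth[OF that(1)]])
  show ?thesis
  proof (intro conjI)
    show "\<forall>d n :: nat. 7 \<le> d \<and> d \<le> n \<longrightarrow>
       (\<forall>P \<in> (polyhedra d n :: (real^'m) set set).
          ereal_of_enat (graph_diameter P) \<le> ereal ((real n - real d) powr log 2 (real d / 2))) \<and>
       (real n - real d) powr log 2 (real d / 2) = (real n - real d) powr (-1 + log 2 (real d))"
    proof (intro allI impI conjI ballI)
      fix d n :: nat and P :: "(real^'m) set"
      assume dn: "7 \<le> d \<and> d \<le> n"
      then show "(real n - real d) powr log 2 (real d / 2) = (real n - real d) powr (-1 + log 2 (real d))"
        by (subst log_half) auto
      assume "P \<in> polyhedra d n"
      then show "ereal_of_enat (graph_diameter P) \<le> ereal ((real n - real d) powr log 2 (real d / 2))"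
        using a dn by blast
    qed
    show "\<forall>d n :: nat. 37 \<le> d \<and> d \<le> n \<longrightarrow>
       (\<forall>P \<in> (polyhedra d n :: (real^'m) set set).
          ereal_of_enat (graph_diameter P) \<le> ereal ((real n - real d) powr log 2 (real d / 4))) \<and>
       (real n - real d) powr log 2 (real d / 4) = (real n - real d) powr (-2 + log 2 (real d))"
    proof (intro allI impI conjI ballI)
      fix d n :: nat and P :: "(real^'m) set"
      assume dn: "37 \<le> d \<and> d \<le> n"
      then show "(real n - real d) powr log 2 (real d / 4) = (real n - real d) powr (-2 + log 2 (real d))"
        by (subst log_quarter) auto
      assume "P \<in> polyhedra d n"
      then show "ereal_of_enat (graph_diameter P) \<le> ereal ((real n - real d) powr log 2 (real d / 4))"
        using b dn by blast
    qed
    show "\<forall>d n :: nat. 1 \<le> d \<and> d \<le> n \<longrightarrow>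
       (\<forall>P \<in> (polyhedra d n :: (real^'m) set set).
          ereal_of_enat (graph_diameter P) \<le> ereal ((real n - real d) powr log 2 (16 + real d / 8)))"
      using c by blast
    show "\<exists>\<epsilon> :: nat \<Rightarrow> real. \<epsilon> \<in> O(\<lambda>d. 1 / real d) \<and>
       (\<forall>d\<ge>1. log 2 (16 + real d / 8) = -3 + log 2 (real d) + \<epsilon> d)"
      by (rule exI, rule conjI, rule log_shift_bigo) simp
  qed
qed

end
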